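(* Let $\Omega\subset\mathbb R^N$ be a bounded open set, $0<s<1$, and let $f:\Omega\times\mathbb R\to\mathbb R$ satisfy the structural and global $(\triangle_2)$ conditions listed in the context. Let $g\in L^p(\Omega)$ with $$p>\tfrac{N}{2s}\ \text{ if } N>2s,\qquad p>1\ \text{ if } N=2s,\qquad p=1\ \text{ if } N<2s.$$ Then every weak solution $u$ of $$(-\Delta_D)^su+f(x,u)=g\ \text{ in }\Omega,\qquad u=0\ \text{ on }\partial\Omega,$$ belongs to $L^\infty(\Omega)$. Moreover there is a constant $C=C(N,s,p,\Omega)>0$ such that $$\|u\|_{L^\infty(\Omega)}\le C\|g\|_{L^p(\Omega)}.$$
   Context: Spectral fractional Laplacian. $\Omega\subset\mathbb R^N$ is an arbitrary bounded open set, and $-\Delta_D$ is the positive self-adjoint operator on $L^2(\Omega)$ associated with the form $\int_\Omega\nabla u\cdot\nabla v\,dx$, $u,v\in H^1_0(\Omega)$ (closure of $C_c^\infty(\Omega)$ in $H^1(\Omega)$). Its eigenvalues are $0<\lambda_1\le\lambda_2\le\cdots\to\infty$, with $L^2$-orthonormal eigenfunctions $\varphi_n$. For $r\ge0$, $\mathbb H^r(\Omega)=\{u=\sum_n u_n\varphi_n\in L^2(\Omega):\|u\|_{\mathbb H^r(\Omega)}^2:=\sum_n\lambda_n^r u_n^2<\infty\}$, $u_n=\int_\Omega u\varphi_n\,dx$. For $r\in(0,1)$, $(-\Delta_D)^r u=\sum_n\lambda_n^r u_n\varphi_n$. Conditions on $f$. (i) For a.e. $x\in\Omega$: $f(x,\cdot)$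 is odd, strictly increasing and continuous, $f(x,0)=0$ and $\lim_{t\to\infty}f(x,t)=\infty$; for all $t\in\mathbb R$, $f(\cdot,t)$ is measurable. Let $\widetilde f(x,\cdot)$ be the inverse function of $f(x,\cdot)$, and $F(x,t)=\int_0^{|t|}f(x,\tau)\,d\tau$, $\widetilde F(x,t)=\int_0^{|t|}\widetilde f(x,\tau)\,d\tau$. (ii) Global $(\triangle_2)$-condition: there are constants $c_1,c_2\in(0,1]$, independent of $x$, such that for a.e. $x\in\Omega$ and all $t\ge0$, $c_1tf(x,t)\le F(x,t)\le tf(x,t)$ and $c_2t\widetilde f(x,t)\le\widetilde F(x,t)\le t\widetilde f(x,t)$. Spaces. $L_F(\Omega)=\{u:\Omega\to\mathbb R\text{ measurable}: F(\cdot,u(\cdot))\in L^1(\Omega)\}$ with the Luxemburg norm $\|u\|_{F,\Omega}=\inf\{k>0:\int_\Omega F(x,u(x)/k)\,dx\le1\}$. $\mathcal V=\mathbb H^s(\Omega)\cap L_F(\Omega)$ with norm $\|u\|_{\mathbb H^s(\Omega)}+\|u\|_{F,\Omega}$; $\mathcal V^\star$ is its dual with pairing $\langle\cdot,\cdot\rangle$. A function $g\in L^p(\Omega)$ with $p$ as in the claim is regarded as an element of $\mathcal V^\star$ through $\langle g,v\rangle=\int_\Omega gv\,dx$. Weak solution. For $g\in\mathcal V^\star$, $u\in\mathcal V$ is a weak solution if $\int_\Omega(-\Delta_D)^{s/2}u\,(-\Delta_D)^{s/2}v\,dx+\int_\Omega f(x,u)v\,dx=\langle g,v\rangle$ for every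 $v\in\mathcal V$. *)

theory Defs
  imports "HOL-Probability.Essential_Supremum"
begin

section \<open>Lebesgue spaces\<close>

definition Lp :: "'a measure \<Rightarrow> ennreal \<Rightarrow> ('a \<Rightarrow> 'b::real_normed_vector) set" where
  "Lp M p = {u \<in> borel_measurable M.
     if p = \<infinity> then esssup M (\<lambda>x. ennreal (norm (u x))) < \<infinity>
     else integrable M (\<lambda>x. norm (u x) powr enn2real p)}"

text \<open>Only meaningful on \<^term>\<open>Lp M p\<close>.\<close>

definition Lp_norm :: "'a measure \<Rightarrow> ennreal \<Rightarrow> ('a \<Rightarrow> 'b::real_normed_vector) \<Rightarrow> real" where
  "Lp_norm M p u =
     (if p = \<infinity> then enn2real (esssup M (\<lambda>x. ennreal (norm (u x))))
      else (LINT x|M. norm (u x) powr enn2real p) powr (1 / enn2real p))"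

section \<open>The space \<open>H\<^sup>1\<^sub>0\<close> and the Dirichlet Laplacian\<close>

text \<open>Functions on \<open>\<Omega>\<close> are total functions on the ambient space; only their values on \<open>\<Omega>\<close>,
  up to null sets, matter.\<close>

primrec C_k :: "nat \<Rightarrow> ('a::euclidean_space \<Rightarrow> real) \<Rightarrow> bool" where
  "C_k 0 h \<longleftrightarrow> continuous_on UNIV h"
| "C_k (Suc k) h \<longleftrightarrow> (\<forall>x. h differentiable at x) \<and>
     (\<forall>b\<in>Basis. C_k k (\<lambda>x. frechet_derivative h (at x) b))"

definition test_functions :: "'a::euclidean_space set \<Rightarrow> ('a \<Rightarrow> real) set" where
  "test_functions \<Omega> = {\<psi>. (\<forall>k. C_k k \<psi>) \<and>
     compact (closure {x. \<psi> x \<noteq> 0}) \<and> closure {x. \<psi> x \<noteq> 0} \<subseteq> \<Omega>}"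

definition is_weak_gradient ::
    "'a::euclidean_space set \<Rightarrow> ('a \<Rightarrow> real) \<Rightarrow> ('a \<Rightarrow> 'a) \<Rightarrow> bool" where
  "is_weak_gradient \<Omega> u G \<longleftrightarrow> G \<in> Lp (lebesgue_on \<Omega>) 2 \<and>
     (\<forall>\<psi>\<in>test_functions \<Omega>. \<forall>b\<in>Basis.
        (LINT x|lebesgue_on \<Omega>. u x * frechet_derivative \<psi> (at x) b) =
        - (LINT x|lebesgue_on \<Omega>. (G x \<bullet> b) * \<psi> x))"

definition H1 :: "'a::euclidean_space set \<Rightarrow> ('a \<Rightarrow> real) set" where
  "H1 \<Omega> = {u \<in> Lp (lebesgue_on \<Omega>) 2. \<exists>G. is_weak_gradient \<Omega> u G}"

text \<open>The weak gradient is unique up to null sets; an arbitrary representative is chosen.\<close>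

definition weak_gradient :: "'a::euclidean_space set \<Rightarrow> ('a \<Rightarrow> real) \<Rightarrow> 'a \<Rightarrow> 'a" where
  "weak_gradient \<Omega> u = (SOME G. is_weak_gradient \<Omega> u G)"

definition H1_norm :: "'a::euclidean_space set \<Rightarrow> ('a \<Rightarrow> real) \<Rightarrow> real" where
  "H1_norm \<Omega> u = sqrt ((Lp_norm (lebesgue_on \<Omega>) 2 u)\<^sup>2 +
     (Lp_norm (lebesgue_on \<Omega>) 2 (weak_gradient \<Omega> u))\<^sup>2)"

definition H10 :: "'a::euclidean_space set \<Rightarrow> ('a \<Rightarrow> real) set" where
  "H10 \<Omega> = {u \<in> H1 \<Omega>. \<forall>\<epsilon>>0. \<exists>\<psi>\<in>test_functions \<Omega>. H1_norm \<Omega> (\<lambda>x. u x - \<psi> x) < \<epsilon>}"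

definition dirichlet_form ::
    "'a::euclidean_space set \<Rightarrow> ('a \<Rightarrow> real) \<Rightarrow> ('a \<Rightarrow> real) \<Rightarrow> real" where
  "dirichlet_form \<Omega> u v =
     (LINT x|lebesgue_on \<Omega>. weak_gradient \<Omega> u x \<bullet> weak_gradient \<Omega> v x)"

text \<open>The graph of the operator associated with the form: all \<open>(u, h)\<close> with \<open>-\<Delta>\<^sub>D u = h\<close>.\<close>

definition dirichlet_laplacian ::
    "'a::euclidean_space set \<Rightarrow> (('a \<Rightarrow> real) \<times> ('a \<Rightarrow> real)) set" where
  "dirichlet_laplacian \<Omega> = {(u, h). u \<in> H10 \<Omega> \<and> h \<in> Lp (lebesgue_on \<Omega>) 2 \<and>
     (\<forall>v\<in>H10 \<Omega>. dirichlet_form \<Omega> u v = (LINT x|lebesgue_on \<Omega>. h x * v x))}"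

text \<open>The last condition is completeness of the orthonormal system in \<open>L\<^sup>2\<close>; it makes
  \<open>lam\<close> list all eigenvalues, repeated according to multiplicity.\<close>

definition dirichlet_eigensystem ::
    "'a::euclidean_space set \<Rightarrow> (nat \<Rightarrow> real) \<Rightarrow> (nat \<Rightarrow> 'a \<Rightarrow> real) \<Rightarrow> bool" where
  "dirichlet_eigensystem \<Omega> lam e \<longleftrightarrow>
     0 < lam 0 \<and> mono lam \<and> filterlim lam at_top sequentially \<and>
     (\<forall>n. (e n, \<lambda>x. lam n * e n x) \<in> dirichlet_laplacian \<Omega>) \<and>
     (\<forall>m n. (LINT x|lebesgue_on \<Omega>. e m x * e n x) = (if m = n then 1 else 0)) \<and>
     (\<forall>u\<in>Lp (lebesgue_on \<Omega>) 2. (\<forall>n. (LINT x|lebesgue_on \<Omega>. u x * e n x) = 0) \<longrightarrow>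
        (AE x in lebesgue_on \<Omega>. u x = 0))"

section \<open>Spectral fractional powers\<close>

definition coef ::
    "'a::euclidean_space set \<Rightarrow> (nat \<Rightarrow> 'a \<Rightarrow> real) \<Rightarrow> ('a \<Rightarrow> real) \<Rightarrow> nat \<Rightarrow> real" where
  "coef \<Omega> e u n = (LINT x|lebesgue_on \<Omega>. u x * e n x)"

definition Hr :: "'a::euclidean_space set \<Rightarrow> (nat \<Rightarrow> real) \<Rightarrow> (nat \<Rightarrow> 'a \<Rightarrow> real) \<Rightarrow> real
    \<Rightarrow> ('a \<Rightarrow> real) set" where
  "Hr \<Omega> lam e r = {u \<in> Lp (lebesgue_on \<Omega>) 2. summable (\<lambda>n. lam n powr r * (coef \<Omega> e u n)\<^sup>2)}"

text \<open>A representative of the \<open>L\<^sup>2\<close>-sum of the series \<open>\<Sum>n. lam n powr r * coef \<Omega> e u n * e n\<close>,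
  which converges for \<open>u\<close> in \<open>Hr \<Omega> lam e (2 * r)\<close>.\<close>

definition frac_laplacian :: "'a::euclidean_space set \<Rightarrow> (nat \<Rightarrow> real) \<Rightarrow> (nat \<Rightarrow> 'a \<Rightarrow> real)
    \<Rightarrow> real \<Rightarrow> ('a \<Rightarrow> real) \<Rightarrow> 'a \<Rightarrow> real" where
  "frac_laplacian \<Omega> lam e r u = (SOME w. w \<in> Lp (lebesgue_on \<Omega>) 2 \<and>
     (\<lambda>k. Lp_norm (lebesgue_on \<Omega>) 2
        (\<lambda>x. w x - (\<Sum>n<k. lam n powr r * coef \<Omega> e u n * e n x))) \<longlonglongrightarrow> 0)"

section \<open>The nonlinearity\<close>

definition structural_condition ::
    "'a::euclidean_space set \<Rightarrow> ('a \<Rightarrow> real \<Rightarrow> real) \<Rightarrow> bool" where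
  "structural_condition \<Omega> f \<longleftrightarrow>
     (AE x in lebesgue_on \<Omega>. (\<forall>t. f x (- t) = - f x t) \<and> strict_mono (f x) \<and>
        continuous_on UNIV (f x) \<and> f x 0 = 0 \<and> filterlim (f x) at_top at_top) \<and>
     (\<forall>t. (\<lambda>x. f x t) \<in> borel_measurable (lebesgue_on \<Omega>))"

definition inverse_fun :: "('a \<Rightarrow> real \<Rightarrow> real) \<Rightarrow> 'a \<Rightarrow> real \<Rightarrow> real" where
  "inverse_fun f x = inv (f x)"

definition primitive :: "('a \<Rightarrow> real \<Rightarrow> real) \<Rightarrow> 'a \<Rightarrow> real \<Rightarrow> real" where
  "primitive f x t = integral {0..\<bar>t\<bar>} (f x)"

definition global_Delta2 ::
    "'a::euclidean_space set \<Rightarrow> ('a \<Rightarrow> real \<Rightarrow> real) \<Rightarrow> bool" where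
  "global_Delta2 \<Omega> f \<longleftrightarrow> (\<exists>c1 c2. 0 < c1 \<and> c1 \<le> 1 \<and> 0 < c2 \<and> c2 \<le> 1 \<and>
     (AE x in lebesgue_on \<Omega>. \<forall>t\<ge>0.
        c1 * t * f x t \<le> primitive f x t \<and> primitive f x t \<le> t * f x t \<and>
        c2 * t * inverse_fun f x t \<le> primitive (inverse_fun f) x t \<and>
        primitive (inverse_fun f) x t \<le> t * inverse_fun f x t))"

definition L_F :: "'a::euclidean_space set \<Rightarrow> ('a \<Rightarrow> real \<Rightarrow> real) \<Rightarrow> ('a \<Rightarrow> real) set" where
  "L_F \<Omega> f = {u \<in> borel_measurable (lebesgue_on \<Omega>).
     integrable (lebesgue_on \<Omega>) (\<lambda>x. primitive f x (u x))}"

section \<open>Weak solutions\<close>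

definition V_space :: "'a::euclidean_space set \<Rightarrow> (nat \<Rightarrow> real) \<Rightarrow> (nat \<Rightarrow> 'a \<Rightarrow> real) \<Rightarrow> real
    \<Rightarrow> ('a \<Rightarrow> real \<Rightarrow> real) \<Rightarrow> ('a \<Rightarrow> real) set" where
  "V_space \<Omega> lam e s f = Hr \<Omega> lam e s \<inter> L_F \<Omega> f"

text \<open>The datum \<open>T\<close> is a functional on \<open>V_space\<close>; the identity does not involve its continuity,
  so \<open>T\<close> is not required to lie in the dual space.\<close>

definition weak_solution :: "'a::euclidean_space set \<Rightarrow> (nat \<Rightarrow> real) \<Rightarrow> (nat \<Rightarrow> 'a \<Rightarrow> real) \<Rightarrow> real
    \<Rightarrow> ('a \<Rightarrow> real \<Rightarrow> real) \<Rightarrow> (('a \<Rightarrow> real) \<Rightarrow> real) \<Rightarrow> ('a \<Rightarrow> real) \<Rightarrow> bool" where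
  "weak_solution \<Omega> lam e s f T u \<longleftrightarrow> u \<in> V_space \<Omega> lam e s f \<and>
     (\<forall>v\<in>V_space \<Omega> lam e s f.
        (LINT x|lebesgue_on \<Omega>. frac_laplacian \<Omega> lam e (s / 2) u x * frac_laplacian \<Omega> lam e (s / 2) v x)
        + (LINT x|lebesgue_on \<Omega>. f x (u x) * v x) = T v)"

definition Lp_functional :: "'a::euclidean_space set \<Rightarrow> ('a \<Rightarrow> real) \<Rightarrow> ('a \<Rightarrow> real) \<Rightarrow> real" where
  "Lp_functional \<Omega> g v = (LINT x|lebesgue_on \<Omega>. g x * v x)"

end

theory Submission
  imports Defs
begin

text \<open>
  Write \<open>E u v = (\<Sum>n. lam n powr s * coef u n * coef v n)\<close>. Since \<open>\<lambda> powr s\<close> is a positive multiple of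
  \<open>\<integral>\<alpha>. \<alpha> powr (s - 1) * (\<lambda> / (\<alpha> + \<lambda>))\<close>, the sub-Markov property of the resolvents
  \<open>\<alpha> * (\<alpha> - \<Delta>\<^sub>D)\<^sup>-\<^sup>1\<close> shows that truncations \<open>v = max 0 (min (\<plusminus>u) l - k)\<close>, \<open>0 \<le> k < l\<close>, are
  admissible test functions with \<open>E v v \<le> \<plusminus>E u v\<close>; as \<open>f x (u x) * (\<plusminus>v x) \<ge> 0\<close>, the equation gives
  \<open>E v v \<le> \<integral>\<bar>g\<bar> * v\<close>. Averaging over translations by at most \<open>r\<close> and comparing \<open>v\<close> with its
  resolvent at \<open>\<alpha> = 1 / (4 r)\<^sup>2\<close> yields a Faber--Krahn inequality
  \<open>\<parallel>v\<parallel>\<^sub>2\<^sup>2 \<le> C m powr (2 s / N) * E v v\<close>, where \<open>m\<close> is the measure of \<open>{v \<noteq> 0}\<close>. With Hoelder's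
  inequality the measure \<open>a k\<close> of \<open>{\<plusminus>u > k}\<close> satisfies
  \<open>(l - k) * a l \<le> C * \<parallel>g\<parallel>\<^sub>p * a k powr (1 - 1 / p + 2 s / N)\<close>. The exponent exceeds \<open>1\<close> exactly
  when \<open>p > N / (2 s)\<close>, and then Stampacchia's iteration makes \<open>a\<close> vanish beyond a multiple of
  \<open>\<parallel>g\<parallel>\<^sub>p\<close>.
\<close>

section \<open>Smooth functions\<close>

text \<open>The domain is an arbitrary bounded open set, so neither an extension operator nor
  boundary regularity is available. What survives is that test functions, extended by zero, can be
  translated in the whole space, and that every finite combination of eigenfunctions is, together
  with its gradient, an L^2 limit of test functions. Gradient estimates are therefore proved for
  test functions, passed to the finite sums \<open>psum\<close>, and only there expressed through
  the eigenvalues; from then on the argument concerns coefficient sequences. The resolvent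
  inequality is carried over to the power s in the form E v v + E d d \<le> E u u with d = u - v:
  its series have nonnegative terms, so Tonelli applies, whereas the mixed series E d v is signed.
  In the Faber--Krahn step two error terms must be absorbed; a ball of measure 16 m and \<alpha> = 1
  / (4 r)^2 make each of them a quarter of the squared norm. The exponent 2 s / N appears because r
  is proportional to m powr (1 / N).\<close>

lemma frechet_derivative_eqI:
  "(h has_derivative h') (at x) \<Longrightarrow> frechet_derivative h (at x) = h'"
  by (metis frechet_derivative_at)

lemma C_k_Suc_I:
  assumes "\<And>x. (h has_derivative h' x) (at x)"
    and "\<And>b. b \<in> Basis \<Longrightarrow> C_k k (\<lambda>x. h' x b)"
  shows "C_k (Suc k) h"
proof -
  have "frechet_derivative h (at x) = h' x" for x
    using assms(1) by (rule frechet_derivative_eqI)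
  then show ?thesis
    using assms by (auto simp: differentiable_def)
qed

lemma C_k_Suc_E:
  assumes "C_k (Suc k) h"
  shows "(h has_derivative frechet_derivative h (at x)) (at x)"
    and "b \<in> Basis \<Longrightarrow> C_k k (\<lambda>x. frechet_derivative h (at x) b)"
  using assms by (auto simp: frechet_derivative_works)

lemma C_k_continuous: "C_k k h \<Longrightarrow> continuous_on UNIV h"
  by (cases k) (auto simp: differentiable_imp_continuous_within continuous_at_imp_continuous_on)

lemma C_k_Suc_D: "C_k (Suc k) h \<Longrightarrow> C_k k h"
proof (induction k arbitrary: h)
  case 0
  then show ?case using C_k_continuous by (metis C_k.simps(1))
next
  case (Suc k)
  then show ?case
    using C_k.simps(2) by blast
qed

lemma C_k_const [simp]: "C_k k (\<lambda>x. c)"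
proof (induction k arbitrary: c)
  case (Suc k)
  show ?case
    by (rule C_k_Suc_I[where h' = "\<lambda>x y. 0"]) (use Suc in auto)
qed simp

lemma C_k_add:
  assumes "C_k k h1" "C_k k h2"
  shows "C_k k (\<lambda>x. h1 x + h2 x)"
  using assms
proof (induction k arbitrary: h1 h2)
  case 0
  then show ?case by (simp add: continuous_on_add)
next
  case (Suc k)
  show ?case
    by (rule C_k_Suc_I[OF has_derivative_add])
      (use Suc C_k_Suc_E in blast)+
qed

text \<open>The product rule pairs each factor with a derivative of the other, so the induction
  needs the derivatives in class \<open>k\<close> and, through \<open>C_k_Suc_D\<close>, the
  undifferentiated factors as well.\<close>

lemma C_k_mult:
  assumes "C_k k h1" "C_k k h2"
  shows "C_k k (\<lambda>x. h1 x * h2 x)"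
  using assms
proof (induction k arbitrary: h1 h2)
  case 0
  then show ?case by (simp add: continuous_on_mult)
next
  case (Suc k)
  have "C_k k h1" "C_k k h2"
    using Suc.prems by (blast intro: C_k_Suc_D)+
  moreover have "C_k k (\<lambda>x. frechet_derivative h1 (at x) b)" "C_k k (\<lambda>x. frechet_derivative h2 (at x) b)"
    if "b \<in> Basis" for b
    using C_k_Suc_E(2)[OF Suc.prems(1) that] C_k_Suc_E(2)[OF Suc.prems(2) that] by auto
  ultimately show ?case
    by (intro C_k_Suc_I[OF has_derivative_mult[OF C_k_Suc_E(1)[OF Suc.prems(1)] C_k_Suc_E(1)[OF Suc.prems(2)]]]
        C_k_add Suc.IH)
qed

lemma C_k_cmult: "C_k k h \<Longrightarrow> C_k k (\<lambda>x. c * h x)"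
  by (simp add: C_k_mult)

lemma C_k_diff: "C_k k h1 \<Longrightarrow> C_k k h2 \<Longrightarrow> C_k k (\<lambda>x. h1 x - h2 x)"
  using C_k_add[of k h1 "\<lambda>x. (-1) * h2 x"] C_k_cmult[of k h2 "-1"] by simp

text \<open>A family closed under differentiation drives the induction on the order: the chain rule
  replaces \<open>\<phi>\<close> by another member times a partial derivative of \<open>h\<close>,
  so no formula for higher derivatives of a composition is required.\<close>

lemma C_k_compose:
  fixes S :: "(real \<Rightarrow> real) set"
  assumes S: "\<And>\<phi>. \<phi> \<in> S \<Longrightarrow> \<exists>\<phi>'\<in>S. \<forall>t. (\<phi> has_real_derivative \<phi>' t) (at t)"
    and "\<phi> \<in> S" "\<And>k. C_k k h"
  shows "C_k k (\<lambda>x. \<phi> (h x))"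
  using assms(2)
proof (induction k arbitrary: \<phi>)
  case 0
  then obtain \<phi>' where "\<forall>t. (\<phi> has_real_derivative \<phi>' t) (at t)" using S by blast
  then have "continuous_on UNIV \<phi>"
    by (meson DERIV_isCont continuous_at_imp_continuous_on)
  moreover have "continuous_on UNIV h" using assms(3)[of 0] by simp
  ultimately show ?case
    by (intro C_k.simps(1)[THEN iffD2] continuous_on_compose2[of UNIV \<phi> UNIV h]) auto
next
  case (Suc k)
  then obtain \<phi>' where \<phi>': "\<phi>' \<in> S" "\<And>t. (\<phi> has_real_derivative \<phi>' t) (at t)"
    using S by blast
  have hd: "(h has_derivative frechet_derivative h (at x)) (at x)" for x
    using C_k_Suc_E(1)[OF assms(3)[of 1, unfolded One_nat_def]] .
  have "((\<lambda>x. \<phi> (h x)) has_derivative (\<lambda>y. frechet_derivative h (at x) y * \<phi>' (h x))) (at x)" for x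
    using has_derivative_compose[OF hd \<phi>'(2)[unfolded has_field_derivative_def]]
    by (simp add: mult.commute)
  then show ?case
  proof (rule C_k_Suc_I)
    fix b :: 'a assume "b \<in> Basis"
    then have "C_k k (\<lambda>x. frechet_derivative h (at x) b)"
      using C_k_Suc_E(2)[OF assms(3)] by blast
    then show "C_k k (\<lambda>x. frechet_derivative h (at x) b * \<phi>' (h x))"
      using Suc.IH[OF \<phi>'(1)] by (rule C_k_mult)
  qed
qed

lemma C_k_affine: "C_k k (\<lambda>x. (x - c) \<bullet> b)"
proof (cases k)
  case 0
  then show ?thesis by (auto intro!: continuous_intros)
next
  case (Suc k)
  show ?thesis unfolding Suc
    by (rule C_k_Suc_I[where h' = "\<lambda>x y. y \<bullet> b"]) (auto intro!: derivative_eq_intros)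
qed

lemma C_k_sqnorm: "C_k k (\<lambda>x. (x - c) \<bullet> (x - c))"
proof (cases k)
  case 0
  then show ?thesis by (auto intro!: continuous_intros)
next
  case (Suc k)
  have "((\<lambda>x. (x - c) \<bullet> (x - c)) has_derivative (\<lambda>y. 2 * ((x - c) \<bullet> y))) (at x)" for x
  proof -
    have "((\<lambda>x. (x - c) \<bullet> (x - c)) has_derivative (\<lambda>y. (x - c) \<bullet> y + y \<bullet> (x - c))) (at x)"
      by (auto intro!: derivative_eq_intros)
    then show ?thesis
      by (rule has_derivative_eq_rhs) (use inner_commute[of "x - c"] in \<open>auto simp: fun_eq_iff\<close>)
  qed
  then show ?thesis unfolding Suc
    by (rule C_k_Suc_I) (intro C_k_cmult C_k_affine)
qed

section \<open>Test functions\<close>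

lemma exp_inverse_tends_0: "((\<lambda>t::real. poly P (inverse t) * exp (- inverse t)) \<longlongrightarrow> 0) (at_right 0)"
proof -
  have "((\<lambda>t::real. poly P t * exp (- t)) \<longlongrightarrow> 0) at_top"
  proof -
    have "((\<lambda>t::real. t ^ i / exp t) \<longlongrightarrow> 0) at_top" for i
      by (rule tendsto_power_div_exp_0)
    then have "((\<lambda>t::real. \<Sum>i\<le>degree P. coeff P i * (t ^ i / exp t)) \<longlongrightarrow> (\<Sum>i\<le>degree P. coeff P i * 0)) at_top"
      by (intro tendsto_intros)
    then show ?thesis
      by (simp add: poly_altdef sum_distrib_right exp_minus divide_inverse mult.assoc)
  qed
  then show ?thesis
    by (rule filterlim_compose) (rule filterlim_inverse_at_top_right)
qed

text \<open>With \<open>P = 1\<close> this is the classical function exp(-1/t), extended by zero.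
  The polynomial in 1/t makes the family closed under differentiation, as \<open>C_k_compose\<close>
  requires.\<close>

definition flat :: "real poly \<Rightarrow> real \<Rightarrow> real" where
  "flat P t = (if t > 0 then poly P (inverse t) * exp (- inverse t) else 0)"

text \<open>For \<open>t > 0\<close> the derivative of P(1/t) exp(-1/t) is (P - P')(1/t) exp(-1/t) /
  t^2, which explains the new polynomial; at 0 the exponential decay beats every power of
  1/t.\<close>

lemma flat_deriv:
  "(flat P has_real_derivative flat (monom 1 2 * (P - pderiv P)) t) (at t)"
proof (cases t "0::real" rule: linorder_cases)
  case less
  have "((\<lambda>_. 0) has_real_derivative 0) (at t)" by simp
  then have "(flat P has_real_derivative 0) (at t)"
    by (rule has_field_derivative_transform_within[where d = "-t"])
      (use less in \<open>auto simp: flat_def dist_real_def\<close>)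
  then show ?thesis using less by (simp add: flat_def)
next
  case greater
  have "((\<lambda>t. poly P (inverse t) * exp (- inverse t)) has_real_derivative
      poly (monom 1 2 * (P - pderiv P)) (inverse t) * exp (- inverse t)) (at t)"
    using greater
    by (auto intro!: derivative_eq_intros DERIV_chain2[OF poly_DERIV]
        simp: poly_monom field_simps power2_eq_square)
  then have "(flat P has_real_derivative
      poly (monom 1 2 * (P - pderiv P)) (inverse t) * exp (- inverse t)) (at t)"
    by (rule has_field_derivative_transform_within[where d = t])
      (use greater in \<open>auto simp: flat_def dist_real_def\<close>)
  then show ?thesis using greater by (simp add: flat_def)
next
  case equal
  have "((\<lambda>h. (flat P (0 + h) - flat P 0) / h) \<longlongrightarrow> 0) (at_right 0)"
  proof (rule Lim_transform_eventually)
    \<comment> \<open>Division by the increment is absorbed as one more power of 1/t.\<close>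
    show "((\<lambda>t. poly (monom 1 1 * P) (inverse t) * exp (- inverse t)) \<longlongrightarrow> 0) (at_right 0)"
      by (rule exp_inverse_tends_0)
    show "\<forall>\<^sub>F x in at_right 0. poly (monom 1 1 * P) (inverse x) * exp (- inverse x) =
            (flat P (0 + x) - flat P 0) / x"
      by (auto simp: flat_def poly_monom field_simps eventually_at_right_less eventually_at_filter)
  qed
  moreover have "((\<lambda>h. (flat P (0 + h) - flat P 0) / h) \<longlongrightarrow> 0) (at_left 0)"
    by (rule Lim_transform_eventually[OF tendsto_const])
      (auto simp: flat_def eventually_at_filter)
  ultimately have "((\<lambda>h. (flat P (0 + h) - flat P 0) / h) \<longlongrightarrow> 0) (at 0)"
    by (simp add: filterlim_split_at)
  then show ?thesis
    unfolding equal by (simp add: DERIV_def flat_def)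
qed

lemma C_k_flat: "(\<And>k. C_k k h) \<Longrightarrow> C_k k (\<lambda>x. flat P (h x))"
  by (rule C_k_compose[of "range flat" "flat P"]) (use flat_deriv in blast)+

lemma C_k_exp: "(\<And>k. C_k k h) \<Longrightarrow> C_k k (\<lambda>x. exp (a * h x))"
proof (rule C_k_compose[of "{\<lambda>t. c * exp (a * t) | c. True}" "\<lambda>t. exp (a * t)"])
  fix \<phi> assume "\<phi> \<in> {\<lambda>t. c * exp (a * t) |c. True}"
  then obtain c where "\<phi> = (\<lambda>t. c * exp (a * t))" by blast
  then show "\<exists>\<phi>'\<in>{\<lambda>t. c * exp (a * t) |c. True}. \<forall>t. (\<phi> has_real_derivative \<phi>' t) (at t)"
    by (intro bexI[of _ "\<lambda>t. (c * a) * exp (a * t)"]) (auto intro!: derivative_eq_intros)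
qed (auto intro: exI[of _ 1])

text \<open>If \<sigma>' = q(\<sigma>), then P(\<sigma>) has derivative (P' q)(\<sigma>), so the
  polynomials in \<open>\<sigma>\<close>, joined by the antiderivative \<open>\<phi>\<close>, are
  closed under differentiation. Meant for \<open>softplus\<close>, whose derivative
  \<open>logistic\<close> solves such an equation.\<close>

lemma C_k_compose_ode:
  fixes \<sigma> \<phi> :: "real \<Rightarrow> real"
  assumes \<phi>: "\<And>t. (\<phi> has_real_derivative \<sigma> t) (at t)"
    and \<sigma>: "\<And>t. (\<sigma> has_real_derivative poly q (\<sigma> t)) (at t)" and h: "\<And>k. C_k k h"
  shows "C_k k (\<lambda>x. \<phi> (h x))"
proof (rule C_k_compose[of "insert \<phi> (range (\<lambda>P t. poly P (\<sigma> t)))" "\<phi>"])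
  fix \<phi>' assume "\<phi>' \<in> insert \<phi> (range (\<lambda>P t. poly P (\<sigma> t)))"
  then consider "\<phi>' = \<phi>" | P where "\<phi>' = (\<lambda>t. poly P (\<sigma> t))" by blast
  then show "\<exists>\<phi>''\<in>insert \<phi> (range (\<lambda>P t. poly P (\<sigma> t))). \<forall>t. (\<phi>' has_real_derivative \<phi>'' t) (at t)"
  proof cases
    case 1
    have "\<sigma> = (\<lambda>t. poly [:0, 1:] (\<sigma> t))" by simp
    then have "\<sigma> \<in> range (\<lambda>P t. poly P (\<sigma> t))" by blast
    then show ?thesis using 1 \<phi> by blast
  next
    case 2
    have "(\<phi>' has_real_derivative poly (pderiv P * q) (\<sigma> t)) (at t)" for t
      unfolding 2 using DERIV_chain2[OF poly_DERIV \<sigma>] by simp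
    then show ?thesis by (intro bexI[of _ "\<lambda>t. poly (pderiv P * q) (\<sigma> t)"]) blast+
  qed
qed (use h in auto)

lemma test_functionsD:
  assumes "\<psi> \<in> test_functions \<Omega>"
  shows "C_k k \<psi>" "compact (closure {x. \<psi> x \<noteq> 0})" "closure {x. \<psi> x \<noteq> 0} \<subseteq> \<Omega>"
    "continuous_on UNIV \<psi>" "x \<notin> \<Omega> \<Longrightarrow> \<psi> x = 0"
    "(\<psi> has_derivative frechet_derivative \<psi> (at x)) (at x)"
proof -
  show "C_k k \<psi>" for k using assms unfolding test_functions_def by auto
  from this[of 0] this[of "Suc 0"] show "continuous_on UNIV \<psi>" "(\<psi> has_derivative frechet_derivative \<psi> (at x)) (at x)"
    using C_k_Suc_E(1)[of 0 \<psi>] by auto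
  show *: "compact (closure {x. \<psi> x \<noteq> 0})" "closure {x. \<psi> x \<noteq> 0} \<subseteq> \<Omega>"
    using assms unfolding test_functions_def by auto
  show "x \<notin> \<Omega> \<Longrightarrow> \<psi> x = 0"
    using *(2) closure_subset[of "{x. \<psi> x \<noteq> 0}"] by blast
qed

lemma test_functions_supportI:
  assumes "\<And>k. C_k k \<psi>" "compact K" "K \<subseteq> \<Omega>" "\<And>x. x \<notin> K \<Longrightarrow> \<psi> x = 0"
  shows "\<psi> \<in> test_functions \<Omega>"
proof -
  have "closure {x. \<psi> x \<noteq> 0} \<subseteq> K"
    using assms(2,4) by (intro closure_minimal) (auto simp: compact_imp_closed)
  then have "compact (closure {x. \<psi> x \<noteq> 0})"
    by (metis assms(2) bounded_closure bounded_subset closed_closure compact_eq_bounded_closed)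
  with \<open>closure {x. \<psi> x \<noteq> 0} \<subseteq> K\<close> assms show ?thesis
    unfolding test_functions_def by auto
qed

lemma test_functions_zero [simp]: "(\<lambda>x. 0) \<in> test_functions \<Omega>"
  by (rule test_functions_supportI[where K = "{}"]) auto

lemma test_functions_add:
  assumes "\<psi> \<in> test_functions \<Omega>" "\<zeta> \<in> test_functions \<Omega>"
  shows "(\<lambda>x. \<psi> x + \<zeta> x) \<in> test_functions \<Omega>"
proof (rule test_functions_supportI)
  show "compact (closure {x. \<psi> x \<noteq> 0} \<union> closure {x. \<zeta> x \<noteq> 0})"
    "closure {x. \<psi> x \<noteq> 0} \<union> closure {x. \<zeta> x \<noteq> 0} \<subseteq> \<Omega>"
    using assms test_functionsD by blast+
  show "\<psi> x + \<zeta> x = 0" if "x \<notin> closure {x. \<psi> x \<noteq> 0} \<union> closure {x. \<zeta> x \<noteq> 0}" for x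
    using that closure_subset[of "{x. \<psi> x \<noteq> 0}"] closure_subset[of "{x. \<zeta> x \<noteq> 0}"]
    by (metis (mono_tags, lifting) UnCI add_0 contra_subsetD mem_Collect_eq)
qed (use assms test_functionsD(1) C_k_add in blast)

lemma test_functions_mult_left:
  assumes "\<psi> \<in> test_functions \<Omega>" "\<And>k. C_k k h"
  shows "(\<lambda>x. h x * \<psi> x) \<in> test_functions \<Omega>"
proof (rule test_functions_supportI)
  show "compact (closure {x. \<psi> x \<noteq> 0})" "closure {x. \<psi> x \<noteq> 0} \<subseteq> \<Omega>"
    using assms test_functionsD by blast+
  show "h x * \<psi> x = 0" if "x \<notin> closure {x. \<psi> x \<noteq> 0}" for x
    using that closure_subset[of "{x. \<psi> x \<noteq> 0}"] by auto
qed (use assms test_functionsD(1) C_k_mult in blast)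

lemma test_functions_compose:
  assumes "\<psi> \<in> test_functions \<Omega>" "\<And>k. C_k k (\<lambda>x. \<phi> (\<psi> x))" "\<phi> 0 = 0"
  shows "(\<lambda>x. \<phi> (\<psi> x)) \<in> test_functions \<Omega>"
proof (rule test_functions_supportI)
  show "compact (closure {x. \<psi> x \<noteq> 0})" "closure {x. \<psi> x \<noteq> 0} \<subseteq> \<Omega>"
    using assms test_functionsD by blast+
  show "\<phi> (\<psi> x) = 0" if "x \<notin> closure {x. \<psi> x \<noteq> 0}" for x
    using contra_subsetD[OF closure_subset that] assms(3) by simp
qed (use assms in blast)

lemma test_functions_sum:
  "(\<And>i. i \<in> I \<Longrightarrow> \<psi> i \<in> test_functions \<Omega>) \<Longrightarrow> (\<lambda>x. \<Sum>i\<in>I. c i * \<psi> i x) \<in> test_functions \<Omega>"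
proof (induction I rule: infinite_finite_induct)
  case (insert i I)
  have "(\<lambda>x. c i * \<psi> i x) \<in> test_functions \<Omega>"
    by (rule test_functions_mult_left) (use insert in auto)
  then have "(\<lambda>x. c i * \<psi> i x + (\<Sum>i\<in>I. c i * \<psi> i x)) \<in> test_functions \<Omega>"
    using insert by (intro test_functions_add) auto
  then show ?case using insert by simp
qed auto

text \<open>The open set is a countable union of balls whose closures it contains (Lindelof), each
  carrying a smooth bump. With B_j the sum of the first j bumps, 1 - exp(-j B_j) tends to 1 where
  some bump is positive and vanishes elsewhere; as a finite sum, B_j keeps compact support.\<close>

lemma open_indicator_approx:
  fixes U :: "'a::euclidean_space set"
  assumes "open U" "U \<subseteq> \<Omega>"
  obtains \<psi> where "\<And>j::nat. \<psi> j \<in> test_functions \<Omega>" "\<And>j x. 0 \<le> \<psi> j x \<and> \<psi> j x \<le> 1"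
    "\<And>x. (\<lambda>j. \<psi> j x) \<longlonglongrightarrow> indicat_real U x"
proof -
  have "\<forall>x\<in>U. \<exists>r>0. cball x r \<subseteq> U"
    using assms(1) unfolding open_contains_cball .
  then obtain rad where rad: "\<And>x. x \<in> U \<Longrightarrow> rad x > 0" "\<And>x. x \<in> U \<Longrightarrow> cball x (rad x) \<subseteq> U"
    by metis
  have "\<exists>C\<subseteq>U. countable C \<and> U = (\<Union>x\<in>C. ball x (rad x))"
  proof -
    obtain F' where F': "F' \<subseteq> (\<lambda>x. ball x (rad x)) ` U" "countable F'"
        "\<Union>F' = \<Union>((\<lambda>x. ball x (rad x)) ` U)"
      using Lindelof[of "(\<lambda>x. ball x (rad x)) ` U"] by auto
    have "ball x (rad x) \<subseteq> U" if "x \<in> U" for x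
      using rad(2)[OF that] ball_subset_cball by blast
    moreover have "x \<in> ball x (rad x)" if "x \<in> U" for x
      using rad(1)[OF that] by simp
    ultimately have "(\<Union>x\<in>U. ball x (rad x)) = U" by blast
    moreover have "\<exists>C. countable C \<and> C \<subseteq> U \<and> F' = (\<lambda>x. ball x (rad x)) ` C"
      using F'(1,2) countable_subset_image[of F' "\<lambda>x. ball x (rad x)" U] by simp
    ultimately show ?thesis using F'(3) by auto
  qed
  then obtain C where C: "C \<subseteq> U" "countable C" "U = (\<Union>x\<in>C. ball x (rad x))" by blast
  show ?thesis
  proof (cases "C = {}")
    case True
    then show ?thesis
      using C by (intro that[of "\<lambda>j x. 0"]) auto
  next
    case False
    define c where "c = from_nat_into C"
    have rc: "range c = C" using False C(2) by (simp add: c_def range_from_nat_into)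
    have cU: "c i \<in> U" for i using rc C(1) by blast
    \<comment> \<open>The argument is positive exactly on the open ball, and the squared norm keeps
      it smooth at the centre.\<close>
    define b where "b i x = flat 1 ((rad (c i))\<^sup>2 - (x - c i) \<bullet> (x - c i))" for i x
    have bpos: "b i x > 0 \<longleftrightarrow> x \<in> ball (c i) (rad (c i))" "b i x \<ge> 0" for i x
    proof -
      have "(x - c i) \<bullet> (x - c i) < (rad (c i))\<^sup>2 \<longleftrightarrow> x \<in> ball (c i) (rad (c i))"
        using rad(1)[OF cU[of i]] abs_le_square_iff[of "rad (c i)" "norm (x - c i)"]
        by (auto simp: dot_square_norm dist_norm norm_minus_commute[of "c i"] not_le[symmetric])
      then show "b i x > 0 \<longleftrightarrow> x \<in> ball (c i) (rad (c i))" "b i x \<ge> 0"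
        by (auto simp: b_def flat_def)
    qed
    have bt: "b i \<in> test_functions \<Omega>" for i
    proof (rule test_functions_supportI)
      show "C_k k (b i)" for k
        unfolding b_def by (intro C_k_flat C_k_diff C_k_const C_k_sqnorm)
      show "b i x = 0" if "x \<notin> cball (c i) (rad (c i))" for x
        using bpos[of i x] that contra_subsetD[OF ball_subset_cball that] by linarith
      show "cball (c i) (rad (c i)) \<subseteq> \<Omega>"
        using rad(2)[OF cU[of i]] assms(2) by blast
    qed simp
    define B where "B j x = (\<Sum>i<j. b i x)" for j x
    have B: "B j \<in> test_functions \<Omega>" for j
      unfolding B_def using test_functions_sum[of "{..<j}" b \<Omega> "\<lambda>_. 1"] bt by simp
    define \<psi> where "\<psi> j x = 1 - exp (- real j * B j x)" for j x
    show ?thesis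
    proof (rule that[of \<psi>])
      show "\<psi> j \<in> test_functions \<Omega>" for j
        unfolding \<psi>_def
        by (rule test_functions_compose[OF B, where \<phi> = "\<lambda>t. 1 - exp (- real j * t)"])
          (intro C_k_diff C_k_const C_k_exp test_functionsD(1)[OF B], simp)
      have B0: "B j x \<ge> 0" for j x unfolding B_def by (simp add: sum_nonneg bpos)
      then show "0 \<le> \<psi> j x \<and> \<psi> j x \<le> 1" for j x
        unfolding \<psi>_def by simp
      show "(\<lambda>j. \<psi> j x) \<longlonglongrightarrow> indicat_real U x" for x
      proof (cases "x \<in> U")
        case True
        then obtain i where i: "x \<in> ball (c i) (rad (c i))" using C(3) rc by blast
        have le: "b i x \<le> B j x" if "j > i" for j
          unfolding B_def using that bpos(2) by (intro member_le_sum) auto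
        have "filterlim (\<lambda>j. real j * B j x) at_top sequentially"
        proof (rule filterlim_at_top_mono)
          show "filterlim (\<lambda>j. real j * b i x) at_top sequentially"
            using bpos(1)[of i x] i
            by (intro filterlim_at_top_mult_tendsto_pos[OF tendsto_const _ filterlim_real_sequentially]) auto
          show "\<forall>\<^sub>F j in sequentially. real j * b i x \<le> real j * B j x"
            using eventually_gt_at_top[of i] by eventually_elim (use le in \<open>auto intro: mult_left_mono\<close>)
        qed
        then have "(\<lambda>j. exp (- (real j * B j x))) \<longlonglongrightarrow> 0"
          by (intro filterlim_compose[OF exp_at_bot]) (simp add: filterlim_uminus_at_top)
        then have "(\<lambda>j. 1 - exp (- (real j * B j x))) \<longlonglongrightarrow> 1 - 0"
          by (intro tendsto_intros)
        then show ?thesis using True by (simp add: \<psi>_def)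
      next
        case False
        have "b i x = 0" for i
        proof -
          have "x \<notin> ball (c i) (rad (c i))"
            using False C(3) rc by blast
          then show ?thesis using bpos[of i x] by linarith
        qed
        then have "\<psi> j x = 0" for j by (simp add: \<psi>_def B_def)
        then show ?thesis using False by simp
      qed
    qed
  qed
qed

section \<open>The space \<open>L\<^sup>2\<close>\<close>

lemma Lp2_iff:
  fixes u :: "'a \<Rightarrow> 'b::real_inner"
  shows "u \<in> Lp M 2 \<longleftrightarrow> u \<in> borel_measurable M \<and> integrable M (\<lambda>x. u x \<bullet> u x)"
  unfolding Lp_def by (simp add: dot_square_norm)

text \<open>A general inner product space as codomain lets the same lemmas serve functions and their
  gradients.\<close>

definition ip :: "'a measure \<Rightarrow> ('a \<Rightarrow> 'b::real_inner) \<Rightarrow> ('a \<Rightarrow> 'b) \<Rightarrow> real" where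
  "ip M u v = (LINT x|M. u x \<bullet> v x)"

abbreviation "nrm M \<equiv> Lp_norm M 2"

lemma Lp2_norm: "nrm M u = sqrt (ip M u u)" for u :: "'a \<Rightarrow> 'b::real_inner"
  unfolding Lp_norm_def ip_def by (simp add: dot_square_norm powr_half_sqrt)

lemma ip_nonneg [simp]: "0 \<le> ip M u u"
  unfolding ip_def by (rule Bochner_Integration.integral_nonneg) simp

lemma nrm_nonneg [simp]: "0 \<le> nrm M u" for u :: "'a \<Rightarrow> 'b::real_inner"
  by (simp add: Lp2_norm)

lemma nrm_square: "(nrm M u)\<^sup>2 = ip M u u" for u :: "'a \<Rightarrow> 'b::real_inner"
  by (simp add: Lp2_norm)

lemma ip_commute: "ip M u v = ip M v u"
  by (simp add: ip_def inner_commute)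

context
  fixes M :: "'a measure"
begin

lemma L2_measurable: "u \<in> Lp M 2 \<Longrightarrow> u \<in> borel_measurable M"
  for u :: "'a \<Rightarrow> 'b::real_inner"
  by (simp add: Lp2_iff)

lemma L2_inner_integrable:
  fixes u v :: "'a \<Rightarrow> 'b::euclidean_space"
  assumes "u \<in> Lp M 2" "v \<in> Lp M 2"
  shows "integrable M (\<lambda>x. u x \<bullet> v x)"
proof (rule Bochner_Integration.integrable_bound)
  show "integrable M (\<lambda>x. u x \<bullet> u x + v x \<bullet> v x)"
    using assms by (simp add: Lp2_iff)
  have [measurable]: "u \<in> borel_measurable M" "v \<in> borel_measurable M"
    using assms by (auto simp: Lp2_iff)
  show "(\<lambda>x. u x \<bullet> v x) \<in> borel_measurable M" by measurable
  show "AE x in M. norm (u x \<bullet> v x) \<le> norm (u x \<bullet> u x + v x \<bullet> v x)"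
  proof (rule AE_I2)
    fix x
    have "norm (u x \<bullet> v x) \<le> norm (u x) * norm (v x)"
      using Cauchy_Schwarz_ineq2 by simp
    also have "\<dots> \<le> (norm (u x))\<^sup>2 + (norm (v x))\<^sup>2"
      using sum_squares_bound[of "norm (u x)" "norm (v x)"] mult_nonneg_nonneg[OF norm_ge_zero norm_ge_zero, of "u x" "v x"] by linarith
    finally show "norm (u x \<bullet> v x) \<le> norm (u x \<bullet> u x + v x \<bullet> v x)"
      by (simp add: dot_square_norm)
  qed
qed

lemma L2_add:
  fixes u v :: "'a \<Rightarrow> 'b::euclidean_space"
  assumes "u \<in> Lp M 2" "v \<in> Lp M 2"
  shows "(\<lambda>x. u x + v x) \<in> Lp M 2"
proof -
  have "integrable M (\<lambda>x. u x \<bullet> u x + 2 * (u x \<bullet> v x) + v x \<bullet> v x)"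
    using assms L2_inner_integrable by (intro Bochner_Integration.integrable_add integrable_mult_right) auto
  moreover have "(\<lambda>x. u x + v x) \<in> borel_measurable M"
    using assms by (intro borel_measurable_add L2_measurable)
  ultimately show ?thesis
    by (simp add: Lp2_iff inner_add_left inner_add_right inner_commute algebra_simps)
qed

lemma L2_scale: "u \<in> Lp M 2 \<Longrightarrow> (\<lambda>x. c *\<^sub>R u x) \<in> Lp M 2"
  for u :: "'a \<Rightarrow> 'b::euclidean_space"
  unfolding Lp2_iff by auto

lemma L2_cmult: "u \<in> Lp M 2 \<Longrightarrow> (\<lambda>x. c * u x) \<in> Lp M 2" for u :: "'a \<Rightarrow> real"
  using L2_scale[of u c] by simp

lemma L2_diff: "u \<in> Lp M 2 \<Longrightarrow> v \<in> Lp M 2 \<Longrightarrow> (\<lambda>x. u x - v x) \<in> Lp M 2"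
  for u v :: "'a \<Rightarrow> 'b::euclidean_space"
  using L2_add[of u "\<lambda>x. (-1) *\<^sub>R v x"] L2_scale[of v "-1"] by simp

lemma L2_zero [simp]: "(\<lambda>x. 0 :: 'b::real_inner) \<in> Lp M 2"
  unfolding Lp2_iff by simp

lemma L2_sum: "(\<And>i. i \<in> I \<Longrightarrow> u i \<in> Lp M 2) \<Longrightarrow> (\<lambda>x. \<Sum>i\<in>I. u i x) \<in> Lp M 2"
  for u :: "'i \<Rightarrow> 'a \<Rightarrow> 'b::euclidean_space"
  by (induction I rule: infinite_finite_induct) (auto intro: L2_add)

lemma L2_bound:
  fixes u :: "'a \<Rightarrow> real"
  assumes "v \<in> borel_measurable M" "u \<in> Lp M 2" "\<And>x. x \<in> space M \<Longrightarrow> \<bar>v x\<bar> \<le> \<bar>u x\<bar>"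
  shows "v \<in> Lp M 2"
proof -
  have "integrable M (\<lambda>x. v x * v x)"
  proof (rule Bochner_Integration.integrable_bound)
    show "integrable M (\<lambda>x. u x * u x)" using assms(2) by (simp add: Lp2_iff)
    show "AE x in M. norm (v x * v x) \<le> norm (u x * u x)"
      using assms(3) by (intro AE_I2) (simp add: abs_mult[symmetric] mult_mono' flip: abs_le_square_iff power2_eq_square)
  qed (use assms(1) in measurable)
  then show ?thesis using assms(1) by (simp add: Lp2_iff)
qed

lemma ip_add_left:
  fixes u v w :: "'a \<Rightarrow> 'b::euclidean_space"
  assumes "u \<in> Lp M 2" "v \<in> Lp M 2" "w \<in> Lp M 2"
  shows "ip M (\<lambda>x. u x + v x) w = ip M u w + ip M v w"
  unfolding ip_def inner_add_left
  using assms by (simp add: L2_inner_integrable)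

lemma ip_diff_left:
  fixes u v w :: "'a \<Rightarrow> 'b::euclidean_space"
  assumes "u \<in> Lp M 2" "v \<in> Lp M 2" "w \<in> Lp M 2"
  shows "ip M (\<lambda>x. u x - v x) w = ip M u w - ip M v w"
  unfolding ip_def inner_diff_left
  using assms by (simp add: L2_inner_integrable)

lemma ip_scale_left: "ip M (\<lambda>x. c *\<^sub>R u x) w = c * ip M u w"
  unfolding ip_def by simp

lemma ip_cmult_left: "ip M (\<lambda>x. c * u x) w = c * ip M u w" for u :: "'a \<Rightarrow> real"
  unfolding ip_def by (simp add: mult.assoc)

lemma ip_sum_left:
  fixes u :: "'i \<Rightarrow> 'a \<Rightarrow> 'b::euclidean_space"
  assumes "\<And>i. i \<in> I \<Longrightarrow> u i \<in> Lp M 2" "w \<in> Lp M 2"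
  shows "ip M (\<lambda>x. \<Sum>i\<in>I. u i x) w = (\<Sum>i\<in>I. ip M (u i) w)"
  unfolding ip_def inner_sum_left
  using assms by (simp add: L2_inner_integrable)

lemma ip_add_right:
  fixes u v w :: "'a \<Rightarrow> 'b::euclidean_space"
  assumes "u \<in> Lp M 2" "v \<in> Lp M 2" "w \<in> Lp M 2"
  shows "ip M w (\<lambda>x. u x + v x) = ip M w u + ip M w v"
  using ip_add_left[OF assms] by (simp add: ip_commute[of M w])

lemma ip_diff_right:
  fixes u v w :: "'a \<Rightarrow> 'b::euclidean_space"
  assumes "u \<in> Lp M 2" "v \<in> Lp M 2" "w \<in> Lp M 2"
  shows "ip M w (\<lambda>x. u x - v x) = ip M w u - ip M w v"
  using ip_diff_left[OF assms] by (simp add: ip_commute[of M w])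

lemma ip_diff_diff:
  fixes u v :: "'a \<Rightarrow> 'b::euclidean_space"
  assumes "u \<in> Lp M 2" "v \<in> Lp M 2"
  shows "ip M (\<lambda>x. u x - v x) (\<lambda>x. u x - v x) = ip M u u - 2 * ip M u v + ip M v v"
  using assms by (simp add: ip_diff_left ip_diff_right L2_diff ip_commute[of M v u])

lemma ip_cong_AE:
  fixes u v w :: "'a \<Rightarrow> 'b::euclidean_space"
  assumes "u \<in> Lp M 2" "v \<in> Lp M 2" "w \<in> Lp M 2" "AE x in M. u x = v x"
  shows "ip M u w = ip M v w"
proof -
  have [measurable]: "u \<in> borel_measurable M" "v \<in> borel_measurable M" "w \<in> borel_measurable M"
    using assms by (auto simp: Lp2_iff)
  show ?thesis
    unfolding ip_def using assms(4) by (intro integral_cong_AE) auto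
qed

lemma Cauchy_Schwarz_ip:
  fixes u v :: "'a \<Rightarrow> 'b::euclidean_space"
  assumes "u \<in> Lp M 2" "v \<in> Lp M 2"
  shows "\<bar>ip M u v\<bar> \<le> nrm M u * nrm M v"
proof -
  have *: "0 \<le> ip M u u - 2 * t * ip M u v + t\<^sup>2 * ip M v v" for t
  proof -
    have "0 \<le> ip M (\<lambda>x. u x - t *\<^sub>R v x) (\<lambda>x. u x - t *\<^sub>R v x)" by simp
    also have "\<dots> = ip M u u - 2 * t * ip M u v + t\<^sup>2 * ip M v v"
      using assms ip_diff_diff[of u "\<lambda>x. t *\<^sub>R v x"]
      by (simp add: L2_scale ip_scale_left ip_commute[of M _ "\<lambda>x. t *\<^sub>R v x"] power2_eq_square ip_commute[of M v u])
    finally show ?thesis .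
  qed
  have "(ip M u v)\<^sup>2 \<le> ip M u u * ip M v v"
  proof (cases "ip M v v = 0")
    case True
    have "ip M u v = 0"
    proof (rule ccontr)
      assume "ip M u v \<noteq> 0"
      \<comment> \<open>This \<open>t\<close> turns the nonnegative quadratic expression into
        -1.\<close>
      then show False
        using *[of "(ip M u u + 1) / (2 * ip M u v)"] True by (simp add: field_simps)
    qed
    then show ?thesis by simp
  next
    case False
    then have "ip M v v > 0" using ip_nonneg[of M v] by linarith
    then show ?thesis
      using *[of "ip M u v / ip M v v"] by (simp add: power2_eq_square field_simps)
  qed
  then show ?thesis
    unfolding Lp2_norm real_sqrt_mult[symmetric] by (simp add: real_le_rsqrt)
qed

lemma nrm_triangle:
  fixes u v :: "'a \<Rightarrow> 'b::euclidean_space"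
  assumes "u \<in> Lp M 2" "v \<in> Lp M 2"
  shows "nrm M (\<lambda>x. u x + v x) \<le> nrm M u + nrm M v"
proof (rule power2_le_imp_le)
  have "(nrm M (\<lambda>x. u x + v x))\<^sup>2 = ip M u u + 2 * ip M u v + ip M v v"
    using assms by (simp add: nrm_square ip_add_left ip_add_right L2_add ip_commute[of M v u])
  also have "\<dots> \<le> (nrm M u + nrm M v)\<^sup>2"
    using Cauchy_Schwarz_ip[OF assms] by (simp add: power2_sum nrm_square)
  finally show "(nrm M (\<lambda>x. u x + v x))\<^sup>2 \<le> (nrm M u + nrm M v)\<^sup>2" .
qed simp

lemma nrm_minus_commute: "nrm M (\<lambda>x. u x - v x) = nrm M (\<lambda>x. v x - u x)"
  for u v :: "'a \<Rightarrow> 'b::real_inner"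
  unfolding Lp_norm_def by (simp add: norm_minus_commute)

lemma nrm_scale: "nrm M (\<lambda>x. c *\<^sub>R u x) = \<bar>c\<bar> * nrm M u" for u :: "'a \<Rightarrow> 'b::real_inner"
proof -
  have "ip M (\<lambda>x. c *\<^sub>R u x) (\<lambda>x. c *\<^sub>R u x) = c\<^sup>2 * ip M u u"
    unfolding ip_def by (simp add: power2_eq_square mult.assoc)
  then show ?thesis by (simp add: Lp2_norm real_sqrt_mult)
qed

lemma nrm_sum_tendsto_0:
  fixes u :: "'i \<Rightarrow> nat \<Rightarrow> 'a \<Rightarrow> 'b::euclidean_space"
  assumes "\<And>i j. i \<in> I \<Longrightarrow> u i j \<in> Lp M 2" "\<And>i. i \<in> I \<Longrightarrow> (\<lambda>j. nrm M (u i j)) \<longlonglongrightarrow> 0"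
  shows "(\<lambda>j. nrm M (\<lambda>x. \<Sum>i\<in>I. c i *\<^sub>R u i j x)) \<longlonglongrightarrow> 0"
proof -
  have le: "nrm M (\<lambda>x. \<Sum>i\<in>I. c i *\<^sub>R u i j x) \<le> (\<Sum>i\<in>I. \<bar>c i\<bar> * nrm M (u i j))" for j
    using assms(1)
  proof (induction I rule: infinite_finite_induct)
    case (insert i I)
    have "nrm M (\<lambda>x. c i *\<^sub>R u i j x + (\<Sum>i\<in>I. c i *\<^sub>R u i j x))
        \<le> nrm M (\<lambda>x. c i *\<^sub>R u i j x) + nrm M (\<lambda>x. \<Sum>i\<in>I. c i *\<^sub>R u i j x)"
      using insert by (intro nrm_triangle L2_scale L2_sum) auto
    then show ?case using insert by (auto simp: nrm_scale)
  qed (auto simp: Lp2_norm ip_def)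
  have "(\<lambda>j. \<Sum>i\<in>I. \<bar>c i\<bar> * nrm M (u i j)) \<longlonglongrightarrow> (\<Sum>i\<in>I. \<bar>c i\<bar> * 0)"
    using assms(2) by (intro tendsto_intros) auto
  then have lim: "(\<lambda>j. \<Sum>i\<in>I. \<bar>c i\<bar> * nrm M (u i j)) \<longlonglongrightarrow> 0" by simp
  show ?thesis
    by (rule tendsto_sandwich[OF _ _ tendsto_const lim]; rule always_eventually; rule allI)
      (rule nrm_nonneg, rule le)
qed

lemma ip_tendsto:
  fixes u v :: "'a \<Rightarrow> 'b::euclidean_space"
  assumes "u \<in> Lp M 2" "v \<in> Lp M 2" "\<And>k. U k \<in> Lp M 2" "\<And>k. V k \<in> Lp M 2"
    and "(\<lambda>k. nrm M (\<lambda>x. u x - U k x)) \<longlonglongrightarrow> 0" "(\<lambda>k. nrm M (\<lambda>x. v x - V k x)) \<longlonglongrightarrow> 0"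
  shows "(\<lambda>k. ip M (U k) (V k)) \<longlonglongrightarrow> ip M u v"
proof -
  let ?a = "\<lambda>k. nrm M (\<lambda>x. u x - U k x)" and ?b = "\<lambda>k. nrm M (\<lambda>x. v x - V k x)"
  have le: "\<bar>ip M (U k) (V k) - ip M u v\<bar> \<le> ?a k * ?b k + ?a k * nrm M v + nrm M u * ?b k" for k
  proof -
    let ?u = "\<lambda>x. u x - U k x" and ?v = "\<lambda>x. v x - V k x"
    have L: "?u \<in> Lp M 2" "?v \<in> Lp M 2" using assms L2_diff by auto
    have "ip M (U k) (V k) - ip M u v = ip M ?u ?v - ip M ?u v - ip M u ?v"
      using assms L by (simp add: ip_diff_left ip_diff_right)
    moreover have "\<bar>ip M ?u ?v\<bar> \<le> ?a k * ?b k" "\<bar>ip M ?u v\<bar> \<le> ?a k * nrm M v"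
      "\<bar>ip M u ?v\<bar> \<le> nrm M u * ?b k"
      using L assms Cauchy_Schwarz_ip by blast+
    ultimately show ?thesis by linarith
  qed
  have "(\<lambda>k. ?a k * ?b k + ?a k * nrm M v + nrm M u * ?b k) \<longlonglongrightarrow> 0 * 0 + 0 * nrm M v + nrm M u * 0"
    using assms by (intro tendsto_intros)
  then have lim: "(\<lambda>k. ?a k * ?b k + ?a k * nrm M v + nrm M u * ?b k) \<longlonglongrightarrow> 0" by simp
  have "(\<lambda>k. ip M (U k) (V k) - ip M u v) \<longlonglongrightarrow> 0"
    by (rule Lim_null_comparison[OF _ lim], rule always_eventually, rule allI) (use le in \<open>simp only: real_norm_def\<close>)
  then show ?thesis by (simp add: LIM_zero_iff)
qed

lemma ip_tendsto_left:
  fixes u v :: "'a \<Rightarrow> 'b::euclidean_space"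
  assumes "u \<in> Lp M 2" "v \<in> Lp M 2" "\<And>k. U k \<in> Lp M 2"
    and "(\<lambda>k. nrm M (\<lambda>x. u x - U k x)) \<longlonglongrightarrow> 0"
  shows "(\<lambda>k. ip M (U k) v) \<longlonglongrightarrow> ip M u v"
  using assms by (intro ip_tendsto) (auto simp: Lp2_norm ip_def)

lemma nrm_tendsto:
  fixes u :: "'a \<Rightarrow> 'b::euclidean_space"
  assumes "u \<in> Lp M 2" "\<And>k. U k \<in> Lp M 2" "(\<lambda>k. nrm M (\<lambda>x. u x - U k x)) \<longlonglongrightarrow> 0"
  shows "(\<lambda>k. nrm M (U k)) \<longlonglongrightarrow> nrm M u"
  unfolding Lp2_norm using assms by (intro tendsto_intros ip_tendsto)

lemma ip_nonneg_of_AE: "AE x in M. 0 \<le> u x \<bullet> v x \<Longrightarrow> 0 \<le> ip M u v"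
  unfolding ip_def by (rule integral_nonneg_AE)

lemma L2_eq_0:
  fixes u :: "'a \<Rightarrow> real"
  assumes "u \<in> Lp M 2" "ip M u u = 0"
  shows "AE x in M. u x = 0"
  using assms integral_nonneg_eq_0_iff_AE[of M "\<lambda>x. u x * u x"]
  by (simp add: Lp2_iff ip_def)

end

section \<open>Completeness of L^2 over a finite measure\<close>

lemma (in finite_measure) L2_integrable:
  fixes u :: "'a \<Rightarrow> real"
  assumes "u \<in> Lp M 2"
  shows "integrable M u" "(LINT x|M. \<bar>u x\<bar>) \<le> nrm M u * sqrt (measure M (space M))"
proof -
  have 1: "(\<lambda>x. 1 :: real) \<in> Lp M 2" by (simp add: Lp2_iff)
  have a: "(\<lambda>x. \<bar>u x\<bar>) \<in> Lp M 2"
    using assms unfolding Lp2_iff by auto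
  show "integrable M u" using L2_inner_integrable[OF assms 1] by simp
  have "(LINT x|M. \<bar>u x\<bar>) = ip M (\<lambda>x. \<bar>u x\<bar>) (\<lambda>x. 1)" by (simp add: ip_def)
  also have "\<dots> \<le> nrm M (\<lambda>x. \<bar>u x\<bar>) * nrm M (\<lambda>x. 1 :: real)"
    using Cauchy_Schwarz_ip[OF a 1] by simp
  also have "\<dots> = nrm M u * sqrt (measure M (space M))"
    by (simp add: Lp2_norm ip_def)
  finally show "(LINT x|M. \<bar>u x\<bar>) \<le> nrm M u * sqrt (measure M (space M))" .
qed

text \<open>A subsequence with norm differences below 2^-j has summable L^1 differences, since the
  measure is finite, and so converges almost everywhere. Fatou's lemma then turns the Cauchy
  property into norm convergence of the whole sequence.\<close>

theorem (in finite_measure) Riesz_Fischer: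
  fixes S :: "nat \<Rightarrow> 'a \<Rightarrow> real"
  assumes S: "\<And>k. S k \<in> Lp M 2"
    and Cauchy: "\<And>\<epsilon>. \<epsilon> > 0 \<Longrightarrow> \<exists>K. \<forall>m\<ge>K. \<forall>n\<ge>K. nrm M (\<lambda>x. S m x - S n x) < \<epsilon>"
  obtains w where "w \<in> Lp M 2" "(\<lambda>k. nrm M (\<lambda>x. w x - S k x)) \<longlonglongrightarrow> 0"
proof -
  have [measurable]: "S k \<in> borel_measurable M" for k using S by (auto simp: Lp2_iff)
  have "\<forall>j. \<exists>K. \<forall>m\<ge>K. \<forall>n\<ge>K. nrm M (\<lambda>x. S m x - S n x) < (1 / 2) ^ j"
    using Cauchy by simp
  then obtain K where K: "\<And>j m n. m \<ge> K j \<Longrightarrow> n \<ge> K j \<Longrightarrow> nrm M (\<lambda>x. S m x - S n x) < (1 / 2) ^ j"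
    by metis
  \<comment> \<open>Adding the partial sums of \<open>K\<close> makes \<open>r\<close> increasing
    and at least \<open>K\<close>; the summand \<open>j\<close> yields
    \<open>r (j + k) \<ge> k\<close>, needed in the Fatou estimate.\<close>
  define r where "r j = j + (\<Sum>i\<le>j. K i)" for j
  have rK: "r j \<ge> K j" for j unfolding r_def by (rule trans_le_add2, rule member_le_sum) auto
  have rmono: "r j \<ge> r i" if "i \<le> j" for i j
    unfolding r_def using that by (intro add_mono sum_mono2) auto
  define d where "d j x = S (r (Suc j)) x - S (r j) x" for j x
  have d2: "d j \<in> Lp M 2" for j unfolding d_def by (intro L2_diff S)
  have [measurable]: "d j \<in> borel_measurable M" for j using d2 by (auto simp: Lp2_iff)
  let ?c = "sqrt (measure M (space M))"
  have dn: "(LINT x|M. \<bar>d j x\<bar>) \<le> (1 / 2) ^ j * ?c" for j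
  proof -
    have "nrm M (d j) \<le> (1 / 2) ^ j"
      unfolding d_def using K[of j "r (Suc j)" "r j"] rK[of j] rmono[of j "Suc j"] by simp
    then have "nrm M (d j) * ?c \<le> (1 / 2) ^ j * ?c" by (rule mult_right_mono) simp
    then show ?thesis using L2_integrable(2)[OF d2[of j]] by linarith
  qed
  have "(\<integral>\<^sup>+x. (\<Sum>j. ennreal \<bar>d j x\<bar>) \<partial>M) = (\<Sum>j. \<integral>\<^sup>+x. ennreal \<bar>d j x\<bar> \<partial>M)"
    by (rule nn_integral_suminf) simp
  also have "\<dots> \<le> (\<Sum>j. ennreal ((1 / 2) ^ j * ?c))"
  proof (rule suminf_le)
    show "(\<integral>\<^sup>+x. ennreal \<bar>d j x\<bar> \<partial>M) \<le> ennreal ((1 / 2) ^ j * ?c)" for j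
      using L2_integrable(1)[OF d2[of j]] dn[of j] by (subst nn_integral_eq_integral) (auto intro!: ennreal_leI)
  qed auto
  also have "\<dots> < \<infinity>"
  proof -
    have "summable (\<lambda>j. (1 / 2 :: real) ^ j * ?c)" by (intro summable_mult2 summable_geometric) simp
    then show ?thesis by (subst suminf_ennreal2) auto
  qed
  finally have "AE x in M. (\<Sum>j. ennreal \<bar>d j x\<bar>) \<noteq> \<infinity>"
    by (intro nn_integral_PInf_AE) auto
  then have conv: "AE x in M. convergent (\<lambda>j. S (r j) x)"
  proof eventually_elim
    case (elim x)
    then have "summable (\<lambda>j. \<bar>d j x\<bar>)"
      by (intro summable_suminf_not_top) auto
    then have "summable (\<lambda>j. d j x)" by (rule summable_rabs_cancel)
    then have "convergent (\<lambda>n. \<Sum>j<n. d j x)" by (simp add: summable_iff_convergent)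
    then have "convergent (\<lambda>n. (\<Sum>j<n. d j x) + S (r 0) x)" by (intro convergent_add convergent_const)
    moreover have "(\<Sum>j<n. d j x) + S (r 0) x = S (r n) x" for n
      unfolding d_def by (subst sum_lessThan_telescope) simp
    ultimately show ?case by simp
  qed
  \<comment> \<open>Where the sequence diverges the value is arbitrary; this affects only a null
    set, and \<open>w\<close> is still measurable.\<close>
  define w where "w x = lim (\<lambda>j. S (r j) x)" for x
  have [measurable]: "w \<in> borel_measurable M" unfolding w_def by (rule borel_measurable_lim_metric) simp
  \<comment> \<open>Stated for nonnegative integrals, because square integrability of
    \<open>w - S m\<close> is itself deduced from this estimate.\<close>
  have bound: "(\<integral>\<^sup>+x. ennreal ((w x - S m x)\<^sup>2) \<partial>M) \<le> ennreal (\<epsilon>\<^sup>2)"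
    if m: "\<And>n. n \<ge> k \<Longrightarrow> nrm M (\<lambda>x. S n x - S m x) \<le> \<epsilon>" for m k \<epsilon>
  proof -
    have "(\<integral>\<^sup>+x. ennreal ((w x - S m x)\<^sup>2) \<partial>M) \<le> (\<integral>\<^sup>+x. liminf (\<lambda>j. ennreal ((S (r (j + k)) x - S m x)\<^sup>2)) \<partial>M)"
    proof (rule nn_integral_mono_AE, use conv in eventually_elim)
      case (elim x)
      then have "(\<lambda>j. S (r j) x) \<longlonglongrightarrow> w x" by (simp add: w_def convergent_LIMSEQ_iff)
      then have "(\<lambda>j. S (r (j + k)) x) \<longlonglongrightarrow> w x" by (rule LIMSEQ_ignore_initial_segment)
      then have "(\<lambda>j. ennreal ((S (r (j + k)) x - S m x)\<^sup>2)) \<longlonglongrightarrow> ennreal ((w x - S m x)\<^sup>2)"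
        by (intro tendsto_intros)
      then have "liminf (\<lambda>j. ennreal ((S (r (j + k)) x - S m x)\<^sup>2)) = ennreal ((w x - S m x)\<^sup>2)"
        by (rule lim_imp_Liminf[OF sequentially_bot])
      then show ?case by simp
    qed
    also have "\<dots> \<le> liminf (\<lambda>j. \<integral>\<^sup>+x. ennreal ((S (r (j + k)) x - S m x)\<^sup>2) \<partial>M)"
      by (rule nn_integral_liminf) simp
    also have "\<dots> \<le> liminf (\<lambda>j. ennreal (\<epsilon>\<^sup>2))"
    proof (intro Liminf_mono always_eventually allI)
      fix j
      have L: "(\<lambda>x. S (r (j + k)) x - S m x) \<in> Lp M 2" by (intro L2_diff S)
      have "(\<integral>\<^sup>+x. ennreal ((S (r (j + k)) x - S m x)\<^sup>2) \<partial>M) = ennreal ((nrm M (\<lambda>x. S (r (j + k)) x - S m x))\<^sup>2)"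
        unfolding nrm_square ip_def using L
        by (subst nn_integral_eq_integral) (auto simp: Lp2_iff power2_eq_square)
      also have "\<dots> \<le> ennreal (\<epsilon>\<^sup>2)"
      proof (intro ennreal_leI power_mono)
        have "r (j + k) \<ge> k" unfolding r_def by linarith
        then show "nrm M (\<lambda>x. S (r (j + k)) x - S m x) \<le> \<epsilon>" by (rule m)
      qed simp
      finally show "(\<integral>\<^sup>+x. ennreal ((S (r (j + k)) x - S m x)\<^sup>2) \<partial>M) \<le> ennreal (\<epsilon>\<^sup>2)" .
    qed
    finally show ?thesis by (simp add: Liminf_const)
  qed
  have diff: "(\<lambda>x. w x - S m x) \<in> Lp M 2 \<and> nrm M (\<lambda>x. w x - S m x) \<le> \<epsilon>"
    if m: "\<And>n. n \<ge> k \<Longrightarrow> nrm M (\<lambda>x. S n x - S m x) \<le> \<epsilon>" and "\<epsilon> \<ge> 0" for m k \<epsilon>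
  proof -
    have fin: "(\<integral>\<^sup>+x. ennreal ((w x - S m x)\<^sup>2) \<partial>M) \<le> ennreal (\<epsilon>\<^sup>2)"
      by (rule bound) (rule m)
    then have "integrable M (\<lambda>x. (w x - S m x)\<^sup>2)"
      by (intro integrableI_bounded) (auto simp: power2_eq_square intro: le_less_trans)
    then have L: "(\<lambda>x. w x - S m x) \<in> Lp M 2" by (simp add: Lp2_iff power2_eq_square)
    have "ennreal (ip M (\<lambda>x. w x - S m x) (\<lambda>x. w x - S m x)) = (\<integral>\<^sup>+x. ennreal ((w x - S m x)\<^sup>2) \<partial>M)"
      unfolding ip_def using L by (subst nn_integral_eq_integral) (auto simp: Lp2_iff power2_eq_square)
    then have "(nrm M (\<lambda>x. w x - S m x))\<^sup>2 \<le> \<epsilon>\<^sup>2"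
      using fin by (metis ennreal_le_iff nrm_square zero_le_power2)
    then show ?thesis using L \<open>\<epsilon> \<ge> 0\<close> power2_le_imp_le by blast
  qed
  show ?thesis
  proof (rule that[of w])
    obtain k where "\<forall>m\<ge>k. \<forall>n\<ge>k. nrm M (\<lambda>x. S m x - S n x) < 1"
      using Cauchy[of 1] by auto
    then have "(\<lambda>x. w x - S k x) \<in> Lp M 2"
      using diff[of k k 1] by (simp add: less_imp_le)
    from L2_add[OF this S[of k]] show "w \<in> Lp M 2" by simp
    show "(\<lambda>k. nrm M (\<lambda>x. w x - S k x)) \<longlonglongrightarrow> 0"
    proof (rule LIMSEQ_I)
      fix \<epsilon> :: real assume "\<epsilon> > 0"
      then obtain k where k: "\<forall>m\<ge>k. \<forall>n\<ge>k. nrm M (\<lambda>x. S m x - S n x) < \<epsilon> / 2"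
        using Cauchy[of "\<epsilon> / 2"] by auto
      have "nrm M (\<lambda>x. w x - S m x) \<le> \<epsilon> / 2" if "m \<ge> k" for m
        using diff[of k m "\<epsilon> / 2"] k that \<open>\<epsilon> > 0\<close> by (simp add: less_imp_le)
      then show "\<exists>no. \<forall>n\<ge>no. norm (nrm M (\<lambda>x. w x - S n x) - 0) < \<epsilon>"
        using \<open>\<epsilon> > 0\<close> by (intro exI[of _ k] allI impI) (simp, smt (verit) field_sum_of_halves)
    qed
  qed
qed

section \<open>Orthonormal bases\<close>

locale orthonormal_basis = finite_measure M for M :: "'a measure" +
  fixes e :: "nat \<Rightarrow> 'a \<Rightarrow> real"
  assumes e_L2 [simp]: "e n \<in> Lp M 2"
    and orthonormal: "ip M (e m) (e n) = (if m = n then 1 else 0)"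
    and complete: "u \<in> Lp M 2 \<Longrightarrow> (\<And>n. ip M u (e n) = 0) \<Longrightarrow> AE x in M. u x = 0"
begin

definition psum :: "(nat \<Rightarrow> real) \<Rightarrow> nat \<Rightarrow> 'a \<Rightarrow> real" where
  "psum c k x = (\<Sum>n<k. c n * e n x)"

lemma psum_L2 [simp]: "psum c k \<in> Lp M 2"
  unfolding psum_def by (intro L2_sum L2_cmult) simp

lemma ip_psum_left: "w \<in> Lp M 2 \<Longrightarrow> ip M (psum c k) w = (\<Sum>n<k. c n * ip M (e n) w)"
  unfolding psum_def by (subst ip_sum_left) (auto intro: L2_cmult simp: ip_cmult_left)

lemma ip_psum_e: "ip M (psum c k) (e n) = (if n < k then c n else 0)"
  by (simp add: ip_psum_left orthonormal if_distrib cong: if_cong)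

lemma ip_psum_psum: "ip M (psum c k) (psum c k) = (\<Sum>n<k. (c n)\<^sup>2)"
proof -
  have "ip M (psum c k) (psum c k) = (\<Sum>n<k. c n * ip M (psum c k) (e n))"
    using ip_psum_left[OF psum_L2] by (simp only: ip_commute[of M "e _"])
  then show ?thesis by (simp add: ip_psum_e power2_eq_square)
qed

lemma psum_diff:
  assumes "m \<le> n"
  shows "psum c n x - psum c m x = (\<Sum>i<n. (if i < m then 0 else c i) * e i x)"
proof -
  have "psum c m x = (\<Sum>i<n. (if i < m then c i else 0) * e i x)"
    unfolding psum_def using assms
    by (intro sum.mono_neutral_cong_left) auto
  then show ?thesis
    unfolding psum_def by (simp add: sum_subtractf[symmetric]) (rule sum.cong, auto)
qed

lemma nrm_psum_diff:
  assumes "m \<le> n"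
  shows "(nrm M (\<lambda>x. psum c n x - psum c m x))\<^sup>2 = (\<Sum>i=m..<n. (c i)\<^sup>2)"
proof -
  have "(\<lambda>x. psum c n x - psum c m x) = psum (\<lambda>i. if i < m then 0 else c i) n"
    by (rule ext) (simp only: psum_diff[OF assms], simp only: psum_def)
  then have "(nrm M (\<lambda>x. psum c n x - psum c m x))\<^sup>2 = (\<Sum>i<n. (if i < m then 0 else c i)\<^sup>2)"
    by (simp add: nrm_square ip_psum_psum)
  also have "\<dots> = (\<Sum>i=m..<n. (c i)\<^sup>2)"
    by (intro sum.mono_neutral_cong_right) auto
  finally show ?thesis .
qed

text \<open>Pairing with \<open>e n\<close> is continuous, and the n-th coefficient of the partial
  sums is constant from k = n + 1 on.\<close>

lemma coef_limit:
  assumes "w \<in> Lp M 2" "(\<lambda>k. nrm M (\<lambda>x. w x - psum c k x)) \<longlonglongrightarrow> 0"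
  shows "ip M w (e n) = c n"
proof -
  have "(\<lambda>k. ip M (psum c k) (e n)) \<longlonglongrightarrow> ip M w (e n)"
    using assms by (intro ip_tendsto_left) auto
  moreover have "(\<lambda>k. ip M (psum c k) (e n)) \<longlonglongrightarrow> c n"
    by (rule tendsto_eventually) (auto simp: ip_psum_e eventually_sequentially intro!: exI[of _ "Suc n"])
  ultimately show ?thesis by (rule LIMSEQ_unique)
qed

lemma series_L2:
  assumes "summable (\<lambda>n. (c n)\<^sup>2)"
  obtains w where "w \<in> Lp M 2" "(\<lambda>k. nrm M (\<lambda>x. w x - psum c k x)) \<longlonglongrightarrow> 0" "\<And>n. ip M w (e n) = c n"
proof -
  have "\<exists>K. \<forall>m\<ge>K. \<forall>n\<ge>K. nrm M (\<lambda>x. psum c m x - psum c n x) < \<epsilon>" if "\<epsilon> > 0" for \<epsilon>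
  proof -
    have "\<epsilon>\<^sup>2 > 0" using that by simp
    then obtain K where K: "\<And>m n. m \<ge> K \<Longrightarrow> norm (\<Sum>i=m..<n. (c i)\<^sup>2) < \<epsilon>\<^sup>2"
      using assms unfolding summable_Cauchy by blast
    have le: "nrm M (\<lambda>x. psum c n x - psum c m x) < \<epsilon>" if "m \<ge> K" "m \<le> n" for m n
    proof -
      have "(nrm M (\<lambda>x. psum c n x - psum c m x))\<^sup>2 < \<epsilon>\<^sup>2"
        using K[OF that(1), of n] that(2) by (simp add: nrm_psum_diff)
      then show ?thesis using \<open>\<epsilon> > 0\<close> by (simp add: power_less_imp_less_base)
    qed
    show ?thesis
    proof (intro exI[of _ K] allI impI)
      fix m n assume "m \<ge> K" "n \<ge> K"
      then show "nrm M (\<lambda>x. psum c m x - psum c n x) < \<epsilon>"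
        using le[of m n] le[of n m] nrm_minus_commute[of M "psum c m" "psum c n"] by (cases "m \<le> n") auto
    qed
  qed
  from Riesz_Fischer[OF psum_L2 this] obtain w
    where w: "w \<in> Lp M 2" "(\<lambda>k. nrm M (\<lambda>x. w x - psum c k x)) \<longlonglongrightarrow> 0"
    by blast
  have "ip M w (e n) = c n" for n
    using w by (rule coef_limit)
  with w that show ?thesis by blast
qed

lemma Bessel:
  assumes "u \<in> Lp M 2"
  shows "summable (\<lambda>n. (ip M u (e n))\<^sup>2)"
proof (rule bounded_imp_summable)
  fix k
  let ?c = "\<lambda>n. ip M u (e n)"
  have "0 \<le> ip M (\<lambda>x. u x - psum ?c (Suc k) x) (\<lambda>x. u x - psum ?c (Suc k) x)" by simp
  also have "\<dots> = ip M u u - (\<Sum>n<Suc k. (?c n)\<^sup>2)"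
  proof -
    have "ip M u (psum ?c (Suc k)) = (\<Sum>n<Suc k. (?c n)\<^sup>2)"
      unfolding ip_commute[of M u "psum ?c (Suc k)"] ip_psum_left[OF assms]
      by (simp only: ip_commute[of M "e _" u] power2_eq_square)
    then show ?thesis
      unfolding ip_diff_diff[OF assms psum_L2] ip_psum_psum by linarith
  qed
  finally show "(\<Sum>n\<le>k. (?c n)\<^sup>2) \<le> ip M u u" by (simp add: lessThan_Suc_atMost)
qed simp

text \<open>By Bessel the series converges in L^2 to some \<open>w\<close>. All coefficients of
  \<open>u - w\<close> vanish, so \<open>complete\<close> identifies the two functions almost
  everywhere.\<close>

lemma expansion:
  assumes "u \<in> Lp M 2"
  shows "(\<lambda>k. nrm M (\<lambda>x. u x - psum (\<lambda>n. ip M u (e n)) k x)) \<longlonglongrightarrow> 0"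
proof -
  obtain w where w: "w \<in> Lp M 2" "(\<lambda>k. nrm M (\<lambda>x. w x - psum (\<lambda>n. ip M u (e n)) k x)) \<longlonglongrightarrow> 0"
      "\<And>n. ip M w (e n) = ip M u (e n)"
    using series_L2[OF Bessel[OF assms]] by metis
  have ae: "AE x in M. u x - w x = 0"
    using assms w by (intro complete) (auto intro: L2_diff simp: ip_diff_left)
  have [measurable]: "u \<in> borel_measurable M" "w \<in> borel_measurable M" "psum c k \<in> borel_measurable M" for c k
    using assms w L2_measurable[OF psum_L2] by (auto simp: Lp2_iff)
  have "nrm M (\<lambda>x. u x - psum c k x) = nrm M (\<lambda>x. w x - psum c k x)" for c k
    unfolding Lp2_norm ip_def
    by (intro arg_cong[of _ _ sqrt] integral_cong_AE) (use ae in auto)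
  then show ?thesis using w(2) by simp
qed

lemma Parseval:
  assumes "u \<in> Lp M 2" "v \<in> Lp M 2"
  shows "(\<lambda>n. ip M u (e n) * ip M v (e n)) sums ip M u v"
proof -
  have "(\<lambda>k. ip M (psum (\<lambda>n. ip M u (e n)) k) v) \<longlonglongrightarrow> ip M u v"
    using assms by (intro ip_tendsto_left expansion) auto
  then show ?thesis
    unfolding sums_def using assms by (simp add: ip_psum_left ip_commute[of M v])
qed

end

section \<open>Gradients of test functions\<close>

definition grad :: "('a::euclidean_space \<Rightarrow> real) \<Rightarrow> 'a \<Rightarrow> 'a" where
  "grad \<psi> x = (\<Sum>b\<in>Basis. frechet_derivative \<psi> (at x) b *\<^sub>R b)"

lemma test_frechet_derivative:
  assumes "\<psi> \<in> test_functions \<Omega>"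
  shows "frechet_derivative \<psi> (at x) y = grad \<psi> x \<bullet> y"
proof -
  interpret linear "frechet_derivative \<psi> (at x)"
    using test_functionsD(6)[OF assms] by (rule has_derivative_linear)
  have "frechet_derivative \<psi> (at x) y = frechet_derivative \<psi> (at x) (\<Sum>b\<in>Basis. (y \<bullet> b) *\<^sub>R b)"
    by (simp add: euclidean_representation)
  also have "\<dots> = grad \<psi> x \<bullet> y"
    by (simp add: sum scale grad_def inner_sum_left inner_commute[of y] mult.commute)
  finally show ?thesis .
qed

lemma test_has_derivative:
  assumes "\<psi> \<in> test_functions \<Omega>"
  shows "(\<psi> has_derivative (\<lambda>y. grad \<psi> x \<bullet> y)) (at x)"
  using test_functionsD(6)[OF assms, of x] by (rule has_derivative_eq_rhs) (simp add: fun_eq_iff test_frechet_derivative[OF assms])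

lemma gradI:
  assumes "(\<psi> has_derivative (\<lambda>y. g \<bullet> y)) (at x)"
  shows "grad \<psi> x = g"
  unfolding grad_def frechet_derivative_eqI[OF assms] by (rule euclidean_representation)

lemma test_continuous_grad:
  assumes "\<psi> \<in> test_functions \<Omega>"
  shows "continuous_on UNIV (grad \<psi>)"
proof -
  have "continuous_on UNIV (\<lambda>x. frechet_derivative \<psi> (at x) b)" if "b \<in> Basis" for b
    using C_k_Suc_E(2)[OF test_functionsD(1)[OF assms, of "Suc 0"] that] by simp
  then show ?thesis
    unfolding grad_def by (intro continuous_intros)
qed

text \<open>Off the closed support the function vanishes near every point, hence so does its
  gradient; on the support compactness and continuity give the bounds.\<close>

lemma test_bounds:
  assumes "\<psi> \<in> test_functions \<Omega>"
  obtains B R where "B \<ge> 0" "R \<ge> 0" "\<And>x. \<bar>\<psi> x\<bar> \<le> B" "\<And>x. norm (grad \<psi> x) \<le> B"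
    "\<And>x. norm x > R \<Longrightarrow> \<psi> x = 0 \<and> grad \<psi> x = 0" "\<And>x. x \<notin> \<Omega> \<Longrightarrow> \<psi> x = 0 \<and> grad \<psi> x = 0"
proof -
  define K where "K = closure {x. \<psi> x \<noteq> 0}"
  have K: "compact K" "K \<subseteq> \<Omega>" using test_functionsD[OF assms] by (auto simp: K_def)
  have zero: "\<psi> x = 0 \<and> grad \<psi> x = 0" if "x \<notin> K" for x
  proof -
    have *: "\<psi> y = 0" if "y \<in> - K" for y
      using that closure_subset[of "{x. \<psi> x \<noteq> 0}"] unfolding K_def by auto
    have "open (- K)" using K(1) by (simp add: compact_imp_closed open_Compl)
    then have "(\<psi> has_derivative (\<lambda>y. 0)) (at x)"
      by (rule has_derivative_transform_within_open[OF has_derivative_const[of 0]])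
        (use that * in auto)
    then have "grad \<psi> x = 0" by (intro gradI) simp
    then show ?thesis using * that by simp
  qed
  have "bounded (\<psi> ` K)"
    by (intro compact_imp_bounded compact_continuous_image K(1) continuous_on_subset[OF test_functionsD(4)[OF assms]]) simp
  then obtain B1 where B1: "\<And>x. x \<in> K \<Longrightarrow> \<bar>\<psi> x\<bar> \<le> B1"
    unfolding bounded_iff by auto
  have "bounded (grad \<psi> ` K)"
    by (intro compact_imp_bounded compact_continuous_image K(1) continuous_on_subset[OF test_continuous_grad[OF assms]]) simp
  then obtain B2 where B2: "\<And>x. x \<in> K \<Longrightarrow> norm (grad \<psi> x) \<le> B2"
    unfolding bounded_iff by auto
  obtain R where R: "\<And>x. x \<in> K \<Longrightarrow> norm x \<le> R"
    using compact_imp_bounded[OF K(1)] unfolding bounded_iff by auto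
  show ?thesis
  proof (rule that[of "max 0 (max B1 B2)" "max 0 R"])
    show "\<bar>\<psi> x\<bar> \<le> max 0 (max B1 B2)" for x
      using zero[of x] B1[of x] by (cases "x \<in> K") auto
    show "norm (grad \<psi> x) \<le> max 0 (max B1 B2)" for x
      using zero[of x] B2[of x] by (cases "x \<in> K") auto
    show "\<psi> x = 0 \<and> grad \<psi> x = 0" if "norm x > max 0 R" for x
      using zero[of x] R[of x] that by fastforce
    show "\<psi> x = 0 \<and> grad \<psi> x = 0" if "x \<notin> \<Omega>" for x
      using zero[of x] K(2) that by blast
  qed auto
qed

lemma test_grad_outside: "\<psi> \<in> test_functions \<Omega> \<Longrightarrow> x \<notin> \<Omega> \<Longrightarrow> grad \<psi> x = 0"
  by (rule test_bounds) auto

lemma continuous_imp_lebesgue_measurable: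
  fixes f :: "'a::euclidean_space \<Rightarrow> 'b::euclidean_space"
  shows "continuous_on UNIV f \<Longrightarrow> f \<in> borel_measurable lebesgue"
  by (intro measurable_completion) (simp add: borel_measurable_continuous_onI)

lemma integrable_bounded_support:
  fixes f :: "'a::euclidean_space \<Rightarrow> 'b::euclidean_space"
  assumes "f \<in> borel_measurable lebesgue" "\<And>x. norm (f x) \<le> B" "\<And>x. norm x > R \<Longrightarrow> f x = 0"
  shows "integrable lebesgue f"
proof (rule Bochner_Integration.integrable_bound)
  have "emeasure lborel (cball 0 R :: 'a set) < \<infinity>"
    by (rule emeasure_bounded_finite) simp
  then show "integrable lebesgue (\<lambda>x. B * indicat_real (cball 0 R :: 'a set) x)"
    by (intro integrable_mult_right integrable_real_indicator) auto
  show "AE x in lebesgue. norm (f x) \<le> norm (B * indicator (cball 0 R) x)"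
  proof (rule AE_I2)
    fix x
    show "norm (f x) \<le> norm (B * indicator (cball 0 R) x)"
      using assms(2)[of x] assms(3)[of x] by (cases "norm x > R") auto
  qed
qed (use assms in auto)

lemma L2_bounded_support:
  fixes f :: "'a::euclidean_space \<Rightarrow> 'b::euclidean_space"
  assumes "f \<in> borel_measurable lebesgue" "\<And>x. norm (f x) \<le> B" "\<And>x. norm x > R \<Longrightarrow> f x = 0"
  shows "f \<in> Lp lebesgue 2"
proof -
  have "integrable lebesgue (\<lambda>x. f x \<bullet> f x)"
  proof (rule integrable_bounded_support)
    show "norm (f x \<bullet> f x) \<le> B\<^sup>2" for x
      using assms(2)[of x] by (simp add: dot_square_norm power_mono)
  qed (use assms in auto)
  then show ?thesis using assms(1) by (simp add: Lp2_iff)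
qed

lemma lborel_translation_integral:
  fixes f :: "'a::euclidean_space \<Rightarrow> 'b::euclidean_space"
  assumes "f \<in> borel_measurable borel"
  shows "(LINT x|lborel. f (x + c)) = (LINT x|lborel. f x)"
proof -
  have "(LINT x|lborel. f x) = (LINT x|distr lborel borel ((+) c). f x)"
    by (simp add: lborel_distr_plus)
  also have "\<dots> = (LINT x|lborel. f (c + x))"
    using assms by (intro integral_distr) auto
  finally show ?thesis by (simp add: add.commute)
qed

lemma lebesgue_translation_continuous:
  fixes f :: "'a::euclidean_space \<Rightarrow> 'b::euclidean_space"
  assumes "continuous_on UNIV f"
  shows "(LINT x|lebesgue. f (x + c)) = (LINT x|lebesgue. f x)"
proof -
  have [measurable]: "f \<in> borel_measurable borel" using assms by (rule borel_measurable_continuous_onI)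
  show ?thesis
    by (subst (1 2) integral_completion) (auto intro: lborel_translation_integral)
qed

text \<open>Differentiation under the integral, by dominated convergence along sequences: the mean
  value bound keeps all difference quotients below one constant on a fixed ball. The derivative
  falls on \<open>\<psi>\<close>, so no smoothness of \<open>v\<close> enters.\<close>

lemma derivative_translation_integral:
  fixes \<psi> :: "'a::euclidean_space \<Rightarrow> real"
  assumes \<psi>: "\<psi> \<in> test_functions \<Omega>"
    and v: "v \<in> borel_measurable lebesgue" "\<And>x. \<bar>v x\<bar> \<le> V"
  shows "((\<lambda>t. LINT x|lebesgue. v x * \<psi> (x + t *\<^sub>R y)) has_real_derivative
    (LINT x|lebesgue. v x * (grad \<psi> (x + t *\<^sub>R y) \<bullet> y))) (at t)"
proof -
  obtain B R where B: "B \<ge> 0" "R \<ge> 0" "\<And>x. \<bar>\<psi> x\<bar> \<le> B" "\<And>x. norm (grad \<psi> x) \<le> B"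
    "\<And>x. norm x > R \<Longrightarrow> \<psi> x = 0 \<and> grad \<psi> x = 0"
    using test_bounds[OF \<psi>] by metis
  have V: "V \<ge> 0" using v(2)[of 0] by linarith
  have cont[continuous_intros]: "continuous_on S (\<lambda>x. \<psi> (x + c))" "continuous_on S (\<lambda>x. grad \<psi> (x + c))" for S c
    by (rule continuous_on_compose2[OF test_functionsD(4)[OF \<psi>]] continuous_on_compose2[OF test_continuous_grad[OF \<psi>]];
        auto intro!: continuous_intros)+
  have [measurable]: "(\<lambda>x. \<psi> (x + c)) \<in> borel_measurable lebesgue" "(\<lambda>x. grad \<psi> (x + c)) \<in> borel_measurable lebesgue" for c
    by (intro continuous_imp_lebesgue_measurable cont)+
  note v(1)[measurable]
  have der: "((\<lambda>t. \<psi> (x + t *\<^sub>R y)) has_real_derivative grad \<psi> (x + t *\<^sub>R y) \<bullet> y) (at t)" for x t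
  proof -
    have "((\<lambda>t. x + t *\<^sub>R y) has_derivative (\<lambda>h. h *\<^sub>R y)) (at t)"
      by (auto intro!: derivative_eq_intros)
    from has_derivative_compose[OF this test_has_derivative[OF \<psi>]]
    show ?thesis by (simp add: has_field_derivative_def mult.commute[of _ "_ \<bullet> y"] o_def)
  qed
  have gy: "\<bar>grad \<psi> x \<bullet> y\<bar> \<le> B * norm y" for x
    using Cauchy_Schwarz_ineq2[of "grad \<psi> x" y] mult_right_mono[OF B(4)[of x] norm_ge_zero[of y]] by linarith
  have lip: "\<bar>\<psi> (x + t *\<^sub>R y) - \<psi> (x + t' *\<^sub>R y)\<bar> \<le> (B * norm y) * \<bar>t - t'\<bar>" for x t t'
    using field_differentiable_bound[of UNIV "\<lambda>t. \<psi> (x + t *\<^sub>R y)" "\<lambda>t. grad \<psi> (x + t *\<^sub>R y) \<bullet> y" "B * norm y" t t']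
      der gy by auto
  let ?J = "\<lambda>t. LINT x|lebesgue. v x * \<psi> (x + t *\<^sub>R y)"
  have int: "integrable lebesgue (\<lambda>x. v x * \<psi> (x + t *\<^sub>R y))" for t
  proof (rule integrable_bounded_support)
    show "norm (v x * \<psi> (x + t *\<^sub>R y)) \<le> V * B" for x
      using v(2)[of x] B(3)[of "x + t *\<^sub>R y"] V by (simp add: abs_mult mult_mono)
    show "v x * \<psi> (x + t *\<^sub>R y) = 0" if "norm x > R + norm (t *\<^sub>R y)" for x
      using B(5)[of "x + t *\<^sub>R y"] that norm_diff_ineq[of x "t *\<^sub>R y"] by simp
  qed measurable
  have "(\<lambda>n. (?J (t + X n) - ?J t) / X n) \<longlonglongrightarrow> (LINT x|lebesgue. v x * (grad \<psi> (x + t *\<^sub>R y) \<bullet> y))"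
    if X: "\<And>n. X n \<noteq> 0" "X \<longlonglongrightarrow> 0" for X
  proof -
    obtain C where C: "\<And>n. \<bar>X n\<bar> \<le> C"
      using convergent_imp_Bseq[OF convergentI[OF X(2)]] by (auto simp: Bseq_def)
    let ?q = "\<lambda>n x. v x * ((\<psi> (x + (t + X n) *\<^sub>R y) - \<psi> (x + t *\<^sub>R y)) / X n)"
    have eq: "(?J (t + X n) - ?J t) / X n = (LINT x|lebesgue. ?q n x)" for n
    proof -
      have "(LINT x|lebesgue. ?q n x) = (LINT x|lebesgue. (v x * \<psi> (x + (t + X n) *\<^sub>R y) - v x * \<psi> (x + t *\<^sub>R y)) / X n)"
        by (intro Bochner_Integration.integral_cong) (auto simp: field_simps)
      also have "\<dots> = (?J (t + X n) - ?J t) / X n"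
        using int by simp
      finally show ?thesis ..
    qed
    \<comment> \<open>All shifts \<open>t\<close> and \<open>t + X n\<close> are at most
      \<open>\<bar>t\<bar> + C\<close> in absolute value, so every quotient vanishes outside the
      ball of radius \<open>R'\<close>.\<close>
    define R' where "R' = R + (\<bar>t\<bar> + C) * norm y"
    have "(\<lambda>n. LINT x|lebesgue. ?q n x) \<longlonglongrightarrow> (LINT x|lebesgue. v x * (grad \<psi> (x + t *\<^sub>R y) \<bullet> y))"
    proof (rule integral_dominated_convergence)
      show "integrable lebesgue (\<lambda>x::'a. (V * (B * norm y)) * indicat_real (cball 0 R') x)"
        by (rule integrable_bounded_support[where B = "V * (B * norm y)" and R = R'])
          (use V B in \<open>auto intro!: borel_measurable_times borel_measurable_indicator mult_left_le
            simp: abs_mult indicator_le_1\<close>)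
      show "AE x in lebesgue. (\<lambda>n. ?q n x) \<longlonglongrightarrow> v x * (grad \<psi> (x + t *\<^sub>R y) \<bullet> y)"
      proof (rule AE_I2)
        fix x
        have "((\<lambda>h. (\<psi> (x + (t + h) *\<^sub>R y) - \<psi> (x + t *\<^sub>R y)) / h) \<longlongrightarrow> grad \<psi> (x + t *\<^sub>R y) \<bullet> y) (at 0)"
          using der[of x t] by (simp add: DERIV_def)
        then have "(\<lambda>n. (\<psi> (x + (t + X n) *\<^sub>R y) - \<psi> (x + t *\<^sub>R y)) / X n) \<longlonglongrightarrow> grad \<psi> (x + t *\<^sub>R y) \<bullet> y"
          by (rule filterlim_compose) (use X in \<open>auto simp: filterlim_at\<close>)
        then show "(\<lambda>n. ?q n x) \<longlonglongrightarrow> v x * (grad \<psi> (x + t *\<^sub>R y) \<bullet> y)"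
          by (intro tendsto_intros)
      qed
      show "AE x in lebesgue. norm (?q n x) \<le> (V * (B * norm y)) * indicat_real (cball 0 R') x" for n
      proof (rule AE_I2)
        fix x
        show "norm (?q n x) \<le> (V * (B * norm y)) * indicat_real (cball 0 R') x"
        proof (cases "norm x > R'")
          case True
          have *: "norm (x + t' *\<^sub>R y) > R" if "\<bar>t'\<bar> \<le> \<bar>t\<bar> + C" for t'
          proof -
            have "norm (t' *\<^sub>R y) \<le> (\<bar>t\<bar> + C) * norm y" using that by (simp add: mult_right_mono)
            then show ?thesis using True norm_diff_ineq[of x "t' *\<^sub>R y"] unfolding R'_def by linarith
          qed
          have "\<psi> (x + (t + X n) *\<^sub>R y) = 0" "\<psi> (x + t *\<^sub>R y) = 0"
            using B(5)[OF *[of "t + X n"]] B(5)[OF *[of t]] C[of n] by auto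
          then show ?thesis using V B by simp
        next
          case False
          have "\<bar>(\<psi> (x + (t + X n) *\<^sub>R y) - \<psi> (x + t *\<^sub>R y)) / X n\<bar> \<le> B * norm y"
            using lip[of x "t + X n" t] X(1)[of n] by (simp add: abs_divide divide_le_eq)
          then have "\<bar>v x\<bar> * \<bar>(\<psi> (x + (t + X n) *\<^sub>R y) - \<psi> (x + t *\<^sub>R y)) / X n\<bar> \<le> V * (B * norm y)"
            using v(2)[of x] V by (intro mult_mono) auto
          then show ?thesis using False by (simp add: abs_mult)
        qed
      qed
    qed measurable
    then show ?thesis unfolding eq .
  qed
  then have "((\<lambda>h. (?J (t + h) - ?J t) / h) \<longlongrightarrow> (LINT x|lebesgue. v x * (grad \<psi> (x + t *\<^sub>R y) \<bullet> y))) (at 0)"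
    unfolding tendsto_at_iff_sequentially by (auto simp: o_def)
  then show ?thesis by (simp add: DERIV_def)
qed

text \<open>The case \<open>v = 1\<close> of the preceding derivative: the integral of a translate
  does not depend on \<open>t\<close>. Applied to a product of test functions, this yields
  integration by parts.\<close>

lemma integral_grad_eq_0:
  assumes \<psi>: "\<psi> \<in> test_functions \<Omega>"
  shows "(LINT x|lebesgue. grad \<psi> x \<bullet> y) = 0"
proof -
  have "((\<lambda>t. LINT x|lebesgue. 1 * \<psi> (x + t *\<^sub>R y)) has_real_derivative
    (LINT x|lebesgue. 1 * (grad \<psi> (x + 0 *\<^sub>R y) \<bullet> y))) (at 0)"
    using \<psi> by (rule derivative_translation_integral[where V = 1]) auto
  moreover have "((\<lambda>t. LINT x|lebesgue. 1 * \<psi> (x + t *\<^sub>R y)) has_real_derivative 0) (at 0)"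
    using lebesgue_translation_continuous[OF test_functionsD(4)[OF \<psi>]] by simp
  ultimately show ?thesis using DERIV_unique by fastforce
qed

lemma test_functions_mult:
  "\<psi> \<in> test_functions \<Omega> \<Longrightarrow> \<zeta> \<in> test_functions \<Omega> \<Longrightarrow> (\<lambda>x. \<psi> x * \<zeta> x) \<in> test_functions \<Omega>"
  by (rule test_functions_mult_left) (auto dest: test_functionsD(1))

lemma grad_mult:
  assumes "\<psi> \<in> test_functions \<Omega>" "\<zeta> \<in> test_functions \<Omega>"
  shows "grad (\<lambda>x. \<psi> x * \<zeta> x) x = \<psi> x *\<^sub>R grad \<zeta> x + \<zeta> x *\<^sub>R grad \<psi> x"
proof (rule gradI)
  show "((\<lambda>x. \<psi> x * \<zeta> x) has_derivative (\<bullet>) (\<psi> x *\<^sub>R grad \<zeta> x + \<zeta> x *\<^sub>R grad \<psi> x)) (at x)"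
    using has_derivative_mult[OF test_has_derivative[OF assms(1)] test_has_derivative[OF assms(2)], of x]
    by (rule has_derivative_eq_rhs) (simp add: fun_eq_iff inner_add_left mult.commute[of _ "\<zeta> x"])
qed

lemma grad_sum:
  assumes "\<And>i. i \<in> I \<Longrightarrow> \<psi> i \<in> test_functions \<Omega>"
  shows "grad (\<lambda>x. \<Sum>i\<in>I. c i * \<psi> i x) x = (\<Sum>i\<in>I. c i *\<^sub>R grad (\<psi> i) x)"
proof (rule gradI)
  show "((\<lambda>x. \<Sum>i\<in>I. c i * \<psi> i x) has_derivative (\<bullet>) (\<Sum>i\<in>I. c i *\<^sub>R grad (\<psi> i) x)) (at x)"
    unfolding inner_sum_left inner_scaleR_left
    by (intro has_derivative_sum has_derivative_mult_right test_has_derivative[of _ \<Omega>] assms)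
qed

lemma grad_compose:
  assumes "\<psi> \<in> test_functions \<Omega>" "(\<phi> has_real_derivative \<phi>') (at (\<psi> x))"
  shows "grad (\<lambda>x. \<phi> (\<psi> x)) x = \<phi>' *\<^sub>R grad \<psi> x"
proof (rule gradI)
  show "((\<lambda>x. \<phi> (\<psi> x)) has_derivative (\<bullet>) (\<phi>' *\<^sub>R grad \<psi> x)) (at x)"
    using has_derivative_compose[OF test_has_derivative[OF assms(1)] assms(2)[unfolded has_field_derivative_def]]
    by (rule has_derivative_eq_rhs) (simp add: fun_eq_iff)
qed

section \<open>Uniqueness of weak gradients\<close>

text \<open>Approximating indicators by test functions gives vanishing integrals over all open sets.
  These form an intersection-stable generator of the Borel sets, so the integral vanishes over every
  Borel set and the density is zero.\<close>

lemma fundamental_lemma_variations: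
  fixes u :: "'a::euclidean_space \<Rightarrow> real"
  assumes \<Omega>: "open \<Omega>" and u: "integrable (lebesgue_on \<Omega>) u"
    and orth: "\<And>\<psi>. \<psi> \<in> test_functions \<Omega> \<Longrightarrow> (LINT x|lebesgue_on \<Omega>. u x * \<psi> x) = 0"
  shows "AE x in lebesgue_on \<Omega>. u x = 0"
proof -
  have [measurable]: "\<Omega> \<in> sets lebesgue" "\<Omega> \<in> sets borel" using \<Omega> by auto
  define w where "w x = indicat_real \<Omega> x * u x" for x
  have w: "integrable lebesgue w"
    using u unfolding w_def by (simp add: integrable_restrict_space)
  have op: "(LINT x|lebesgue. indicat_real U x * w x) = 0" if "open U" for U
  proof -
    have op_int: "open (U \<inter> \<Omega>)" using that \<Omega> by (rule open_Int)
    obtain \<psi> where \<psi>: "\<And>j::nat. \<psi> j \<in> test_functions \<Omega>" "\<And>j x. 0 \<le> \<psi> j x \<and> \<psi> j x \<le> 1"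
      "\<And>x. (\<lambda>j. \<psi> j x) \<longlonglongrightarrow> indicat_real (U \<inter> \<Omega>) x"
      using open_indicator_approx[OF op_int Int_lower2] by metis
    have [measurable]: "\<psi> j \<in> borel_measurable lebesgue" for j
      by (intro continuous_imp_lebesgue_measurable test_functionsD(4)[OF \<psi>(1)])
    have [measurable]: "U \<in> sets lebesgue" using that by auto
    note borel_measurable_integrable[OF w, measurable]
    have "(\<lambda>j. LINT x|lebesgue. \<psi> j x * w x) \<longlonglongrightarrow> (LINT x|lebesgue. indicat_real (U \<inter> \<Omega>) x * w x)"
    proof (rule integral_dominated_convergence)
      show "integrable lebesgue (\<lambda>x. \<bar>w x\<bar>)" using w by simp
      show "AE x in lebesgue. (\<lambda>j. \<psi> j x * w x) \<longlonglongrightarrow> indicat_real (U \<inter> \<Omega>) x * w x"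
        using \<psi>(3) by (intro AE_I2 tendsto_intros)
      show "AE x in lebesgue. norm (\<psi> j x * w x) \<le> \<bar>w x\<bar>" for j
        using \<psi>(2) by (intro AE_I2) (simp add: abs_mult mult_left_le_one_le)
    qed simp_all
    moreover have "(LINT x|lebesgue. \<psi> j x * w x) = 0" for j
    proof -
      have "(LINT x|lebesgue. \<psi> j x * w x) = (LINT x|lebesgue_on \<Omega>. u x * \<psi> j x)"
        by (subst integral_restrict_space) (auto simp: w_def intro!: Bochner_Integration.integral_cong)
      then show ?thesis using orth[OF \<psi>(1)] by simp
    qed
    ultimately have "(LINT x|lebesgue. indicat_real (U \<inter> \<Omega>) x * w x) = 0"
      by (simp add: LIMSEQ_const_iff)
    moreover have "indicat_real (U \<inter> \<Omega>) x * w x = indicat_real U x * w x" for x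
      by (simp add: w_def indicator_def)
    ultimately show ?thesis by simp
  qed
  \<comment> \<open>Open sets generate the Borel sets but not their completion, so the induction
    runs for a Borel version of \<open>w\<close>.\<close>
  obtain w' where w': "w' \<in> borel_measurable lborel" "AE x in lborel. w x = w' x"
    using completion_ex_borel_measurable_real[of w lborel] borel_measurable_integrable[OF w] by auto
  note w'(1)[measurable]
  have ae: "AE x in lebesgue. w x = w' x" using w'(2) by (rule AE_completion)
  have "integrable lebesgue w'"
    using w ae by (subst integrable_cong_AE[of _ _ w]) (auto intro: measurable_completion w'(1))
  then have iw': "integrable lborel w'" by (simp add: integrable_completion)
  have mw: "w \<in> borel_measurable lebesgue" using w by (rule borel_measurable_integrable)
  have mw': "w' \<in> borel_measurable lebesgue" using w'(1) by (rule measurable_completion)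
  have iB: "integrable lborel (\<lambda>x. indicat_real B x * w' x)" if "B \<in> sets borel" for B
    using integrable_mult_indicator[OF _ iw', of B] that by simp
  have "AE x in lborel. w' x = 0"
  proof (rule sigma_finite_measure.density_zero[OF sigma_finite_lborel iw'])
    fix A assume "A \<in> sets (lborel :: 'a measure)"
    then have A: "A \<in> sigma_sets UNIV {S :: 'a set. open S}" by (simp add: borel_def)
    have "Int_stable {S :: 'a set. open S}" "{S :: 'a set. open S} \<subseteq> Pow UNIV"
      by (auto simp: Int_stable_def)
    from this A show "set_lebesgue_integral lborel A w' = 0"
    proof (induction rule: sigma_sets_induct_disjoint)
      case (basic A)
      then have [measurable]: "A \<in> sets borel" by auto
      have "set_lebesgue_integral lborel A w' = (LINT x|lebesgue. indicat_real A x * w' x)"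
        unfolding set_lebesgue_integral_def by (subst integral_completion) auto
      also have "\<dots> = (LINT x|lebesgue. indicat_real A x * w x)"
        using ae by (intro integral_cong_AE) (auto intro!: borel_measurable_times mw mw' borel_measurable_indicator)
      also have "\<dots> = 0" using basic op by simp
      finally show ?case .
    next
      case (compl A)
      then have [measurable]: "A \<in> sets borel" by (simp add: borel_def)
      have "set_lebesgue_integral lborel UNIV w' = 0"
      proof -
        have "set_lebesgue_integral lborel UNIV w' = (LINT x|lebesgue. w' x)"
          unfolding set_lebesgue_integral_def by (subst integral_completion) auto
        also have "\<dots> = (LINT x|lebesgue. indicat_real UNIV x * w x)"
          using ae w by (intro integral_cong_AE) (auto intro!: measurable_completion)
        finally show ?thesis using op[of UNIV] by simp
      qed
      moreover have "set_lebesgue_integral lborel UNIV w' = set_lebesgue_integral lborel (UNIV - A) w' + set_lebesgue_integral lborel A w'"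
      proof -
        have "(LINT x|lborel. indicat_real (UNIV - A) x * w' x + indicat_real A x * w' x)
            = (LINT x|lborel. indicat_real (UNIV - A) x * w' x) + (LINT x|lborel. indicat_real A x * w' x)"
          by (intro Bochner_Integration.integral_add iB) auto
        moreover have "indicat_real (UNIV - A) x * w' x + indicat_real A x * w' x = indicat_real UNIV x *\<^sub>R w' x" for x
          by (simp add: indicator_def)
        ultimately show ?thesis unfolding set_lebesgue_integral_def by simp
      qed
      ultimately show ?case using compl by simp
    next
      case (union A)
      have [measurable]: "A i \<in> sets borel" for i using union(2) by (auto simp: borel_def)
      have "set_lebesgue_integral lborel (\<Union>i. A i) w' = (\<Sum>i. set_lebesgue_integral lborel (A i) w')"
        using union(1)
        by (intro lebesgue_integral_countable_add)
          (auto simp: disjoint_family_on_def set_integrable_def intro!: iB)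
      then show ?case using union by simp
    qed (simp add: set_lebesgue_integral_def)
  qed
  then have "AE x in lebesgue. w' x = 0" by (rule AE_completion)
  with ae have "AE x in lebesgue. w x = 0" by eventually_elim simp
  then show ?thesis by (auto simp: AE_restrict_space_iff w_def)
qed

section \<open>Weak gradients and \<open>H10\<close> on a bounded open set\<close>

locale bounded_open_set =
  fixes \<Omega> :: "'a::euclidean_space set"
  assumes open_\<Omega>: "open \<Omega>" and bounded_\<Omega>: "bounded \<Omega>"
begin

abbreviation "M \<equiv> lebesgue_on \<Omega>"

lemma sets_\<Omega> [measurable, simp]: "\<Omega> \<in> sets lebesgue" "\<Omega> \<in> sets borel"
  using open_\<Omega> by auto

sublocale finite_measure M
proof
  have "emeasure M (space M) = emeasure lebesgue \<Omega>"
    by (simp add: emeasure_restrict_space)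
  also have "\<dots> < \<infinity>"
    using emeasure_bounded_finite[OF bounded_\<Omega>] by simp
  finally show "emeasure M (space M) \<noteq> \<infinity>" by simp
qed

lemma restrict_L2: "u \<in> Lp lebesgue 2 \<Longrightarrow> u \<in> Lp M 2"
  for u :: "'a \<Rightarrow> 'b::euclidean_space"
proof -
  assume u: "u \<in> Lp lebesgue 2"
  then have "integrable M (\<lambda>x. u x \<bullet> u x)"
    using integrable_mult_indicator[of \<Omega> lebesgue "\<lambda>x. u x \<bullet> u x"]
    by (simp add: Lp2_iff integrable_restrict_space)
  then show ?thesis
    using u by (auto simp: Lp2_iff intro: measurable_restrict_space1)
qed

lemma integral_M_support:
  fixes u :: "'a \<Rightarrow> 'b::euclidean_space"
  assumes "\<And>x. x \<notin> \<Omega> \<Longrightarrow> u x = 0"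
  shows "(LINT x|M. u x) = (LINT x|lebesgue. u x)"
  using assms by (subst integral_restrict_space)
    (auto intro!: Bochner_Integration.integral_cong simp: indicator_def)

lemma test_L2:
  assumes "\<psi> \<in> test_functions \<Omega>"
  shows "\<psi> \<in> Lp lebesgue 2" "grad \<psi> \<in> Lp lebesgue 2" "\<psi> \<in> Lp M 2" "grad \<psi> \<in> Lp M 2"
proof -
  obtain B R where B: "\<And>x. \<bar>\<psi> x\<bar> \<le> B" "\<And>x. norm (grad \<psi> x) \<le> B"
    "\<And>x. norm x > R \<Longrightarrow> \<psi> x = 0 \<and> grad \<psi> x = 0"
    using test_bounds[OF assms] by metis
  show "\<psi> \<in> Lp lebesgue 2" "grad \<psi> \<in> Lp lebesgue 2"
    using B test_functionsD(4)[OF assms] test_continuous_grad[OF assms]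
    by (auto intro!: L2_bounded_support[where B = B and R = R] continuous_imp_lebesgue_measurable)
  then show "\<psi> \<in> Lp M 2" "grad \<psi> \<in> Lp M 2" by (auto intro: restrict_L2)
qed

lemma L2_inner_const: "G \<in> Lp M 2 \<Longrightarrow> (\<lambda>x. G x \<bullet> b) \<in> Lp M 2"
  for G :: "'a \<Rightarrow> 'a"
proof -
  assume G: "G \<in> Lp M 2"
  have "integrable M (\<lambda>x. (G x \<bullet> b) * (G x \<bullet> b))"
  proof (rule Bochner_Integration.integrable_bound)
    show "integrable M (\<lambda>x. (norm b)\<^sup>2 * (G x \<bullet> G x))" using G by (simp add: Lp2_iff)
    show "AE x in M. norm ((G x \<bullet> b) * (G x \<bullet> b)) \<le> norm ((norm b)\<^sup>2 * (G x \<bullet> G x))"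
    proof (rule AE_I2)
      fix x
      show "norm ((G x \<bullet> b) * (G x \<bullet> b)) \<le> norm ((norm b)\<^sup>2 * (G x \<bullet> G x))"
        using Cauchy_Schwarz_ineq[of "G x" b] by (simp add: power2_eq_square dot_square_norm mult_ac)
    qed
  qed (use L2_measurable[OF G] in measurable)
  then show ?thesis using L2_measurable[OF G] by (simp add: Lp2_iff)
qed

text \<open>The product of two test functions is again one, and the integral of its gradient is
  zero.\<close>

lemma test_is_weak_gradient:
  assumes \<psi>: "\<psi> \<in> test_functions \<Omega>"
  shows "is_weak_gradient \<Omega> \<psi> (grad \<psi>)"
  unfolding is_weak_gradient_def
proof (intro conjI ballI)
  show "grad \<psi> \<in> Lp M 2" using test_L2[OF \<psi>] by simp
  fix \<zeta> b assume \<zeta>: "\<zeta> \<in> test_functions \<Omega>" and b: "b \<in> (Basis :: 'a set)"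
  have "(LINT x|lebesgue. grad (\<lambda>x. \<psi> x * \<zeta> x) x \<bullet> b) = 0"
    by (rule integral_grad_eq_0[OF test_functions_mult[OF \<psi> \<zeta>]])
  then have "(LINT x|M. grad (\<lambda>x. \<psi> x * \<zeta> x) x \<bullet> b) = 0"
    using test_grad_outside[OF test_functions_mult[OF \<psi> \<zeta>]]
    by (subst integral_M_support) auto
  then have "(LINT x|M. \<psi> x * (grad \<zeta> x \<bullet> b) + (grad \<psi> x \<bullet> b) * \<zeta> x) = 0"
    by (simp add: grad_mult[OF \<psi> \<zeta>] inner_add_left mult.commute[of "\<zeta> _"])
  moreover have "integrable M (\<lambda>x. \<psi> x * (grad \<zeta> x \<bullet> b))" "integrable M (\<lambda>x. (grad \<psi> x \<bullet> b) * \<zeta> x)"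
    using L2_inner_integrable[of \<psi> M "\<lambda>x. grad \<zeta> x \<bullet> b"] L2_inner_integrable[of "\<lambda>x. grad \<psi> x \<bullet> b" M \<zeta>]
      test_L2[OF \<psi>] test_L2[OF \<zeta>] L2_inner_const by auto
  ultimately show "(LINT x|M. \<psi> x * frechet_derivative \<zeta> (at x) b) = - (LINT x|M. grad \<psi> x \<bullet> b * \<zeta> x)"
    using b by (simp add: test_frechet_derivative[OF \<zeta>])
qed

text \<open>The fundamental lemma applies to each component of the difference. Uniqueness is what
  makes the arbitrary choice in \<open>weak_gradient\<close> harmless.\<close>

lemma weak_gradient_unique:
  assumes "is_weak_gradient \<Omega> u G" "is_weak_gradient \<Omega> u H"
  shows "AE x in M. G x = H x"
proof -
  have GH: "G \<in> Lp M 2" "H \<in> Lp M 2" using assms by (auto simp: is_weak_gradient_def)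
  have "AE x in M. (G x - H x) \<bullet> b = 0" if b: "b \<in> Basis" for b
  proof (rule fundamental_lemma_variations[OF open_\<Omega>])
    have L: "(\<lambda>x. (G x - H x) \<bullet> b) \<in> Lp M 2" using GH L2_inner_const[OF L2_diff[of G M H]] by auto
    then show "integrable M (\<lambda>x. (G x - H x) \<bullet> b)" by (rule L2_integrable)
    fix \<psi> assume \<psi>: "\<psi> \<in> test_functions \<Omega>"
    have "integrable M (\<lambda>x. (G x \<bullet> b) * \<psi> x)" "integrable M (\<lambda>x. (H x \<bullet> b) * \<psi> x)"
      using L2_inner_integrable[OF L2_inner_const[OF GH(1), of b] test_L2(3)[OF \<psi>]]
        L2_inner_integrable[OF L2_inner_const[OF GH(2), of b] test_L2(3)[OF \<psi>]] by auto
    moreover have "(LINT x|M. (G x \<bullet> b) * \<psi> x) = (LINT x|M. (H x \<bullet> b) * \<psi> x)"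
      using assms \<psi> b unfolding is_weak_gradient_def by force
    ultimately show "(LINT x|M. (G x - H x) \<bullet> b * \<psi> x) = 0"
      by (simp add: inner_diff_left left_diff_distrib)
  qed
  then have "AE x in M. \<forall>b\<in>Basis. (G x - H x) \<bullet> b = 0"
    by (intro AE_finite_allI) auto
  then show ?thesis
    by eventually_elim (simp add: euclidean_eq_iff[of "G _"] inner_diff_left)
qed

lemma weak_gradient_works: "is_weak_gradient \<Omega> u G \<Longrightarrow> is_weak_gradient \<Omega> u (weak_gradient \<Omega> u)"
  unfolding weak_gradient_def by (rule someI[of "is_weak_gradient \<Omega> u"])

lemma weak_gradient_AE_eq:
  "is_weak_gradient \<Omega> u G \<Longrightarrow> AE x in M. weak_gradient \<Omega> u x = G x"
  using weak_gradient_unique weak_gradient_works by blast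

lemma is_weak_gradient_diff:
  assumes "is_weak_gradient \<Omega> u G" "u \<in> Lp M 2" "is_weak_gradient \<Omega> v H" "v \<in> Lp M 2"
  shows "is_weak_gradient \<Omega> (\<lambda>x. u x - v x) (\<lambda>x. G x - H x)"
  unfolding is_weak_gradient_def
proof (intro conjI ballI)
  have GH: "G \<in> Lp M 2" "H \<in> Lp M 2" using assms by (auto simp: is_weak_gradient_def)
  then show "(\<lambda>x. G x - H x) \<in> Lp M 2" by (rule L2_diff)
  fix \<psi> b assume \<psi>: "\<psi> \<in> test_functions \<Omega>" and b: "b \<in> (Basis :: 'a set)"
  have i: "integrable M (\<lambda>x. (G x \<bullet> b) * \<psi> x)" "integrable M (\<lambda>x. (H x \<bullet> b) * \<psi> x)"
      "integrable M (\<lambda>x. u x * (grad \<psi> x \<bullet> b))" "integrable M (\<lambda>x. v x * (grad \<psi> x \<bullet> b))"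
    using L2_inner_integrable[OF L2_inner_const[OF GH(1), of b] test_L2(3)[OF \<psi>]]
      L2_inner_integrable[OF L2_inner_const[OF GH(2), of b] test_L2(3)[OF \<psi>]]
      L2_inner_integrable[OF assms(2) L2_inner_const[OF test_L2(4)[OF \<psi>], of b]]
      L2_inner_integrable[OF assms(4) L2_inner_const[OF test_L2(4)[OF \<psi>], of b]] by auto
  have "(LINT x|M. u x * (grad \<psi> x \<bullet> b)) = - (LINT x|M. G x \<bullet> b * \<psi> x)"
    "(LINT x|M. v x * (grad \<psi> x \<bullet> b)) = - (LINT x|M. H x \<bullet> b * \<psi> x)"
    using assms \<psi> b unfolding is_weak_gradient_def by (auto simp: test_frechet_derivative[OF \<psi>])
  then show "(LINT x|M. (u x - v x) * frechet_derivative \<psi> (at x) b) = - (LINT x|M. (G x - H x) \<bullet> b * \<psi> x)"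
    using i by (simp add: test_frechet_derivative[OF \<psi>] left_diff_distrib inner_diff_left)
qed

lemma nrm_cong_AE:
  fixes u v :: "'a \<Rightarrow> 'b::euclidean_space"
  assumes "u \<in> Lp M 2" "v \<in> Lp M 2" "AE x in M. u x = v x"
  shows "nrm M u = nrm M v"
  using ip_cong_AE[OF assms(1,2,1,3)] ip_cong_AE[OF assms(1,2,2,3)]
  by (simp add: Lp2_norm ip_commute[of M v u])

text \<open>\<open>H1_norm\<close> involves the representative chosen for the gradient of the
  difference \<open>u - \<psi>\<close>; by uniqueness it agrees almost everywhere with the
  difference of the two gradients, so both norms can be controlled separately.\<close>

lemma H10_approx:
  assumes "u \<in> H10 \<Omega>"
  obtains \<psi> where "\<And>j. \<psi> j \<in> test_functions \<Omega>" "(\<lambda>j. nrm M (\<lambda>x. u x - \<psi> j x)) \<longlonglongrightarrow> 0"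
    "(\<lambda>j. nrm M (\<lambda>x. weak_gradient \<Omega> u x - grad (\<psi> j) x)) \<longlonglongrightarrow> 0"
proof -
  have u: "u \<in> Lp M 2" "is_weak_gradient \<Omega> u (weak_gradient \<Omega> u)"
    using assms weak_gradient_works unfolding H10_def H1_def by auto
  have "\<forall>j. \<exists>\<psi>\<in>test_functions \<Omega>. H1_norm \<Omega> (\<lambda>x. u x - \<psi> x) < inverse (real (Suc j))"
    using assms unfolding H10_def by simp
  then obtain \<psi> where \<psi>: "\<And>j. \<psi> j \<in> test_functions \<Omega>"
    "\<And>j. H1_norm \<Omega> (\<lambda>x. u x - \<psi> j x) < inverse (real (Suc j))" by metis
  have le: "nrm M (\<lambda>x. u x - \<psi> j x) \<le> inverse (real (Suc j))"
    "nrm M (\<lambda>x. weak_gradient \<Omega> u x - grad (\<psi> j) x) \<le> inverse (real (Suc j))" for j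
  proof -
    have w: "is_weak_gradient \<Omega> (\<lambda>x. u x - \<psi> j x) (\<lambda>x. weak_gradient \<Omega> u x - grad (\<psi> j) x)"
      using u \<psi>(1) test_is_weak_gradient test_L2 by (intro is_weak_gradient_diff) auto
    have "nrm M (weak_gradient \<Omega> (\<lambda>x. u x - \<psi> j x)) = nrm M (\<lambda>x. weak_gradient \<Omega> u x - grad (\<psi> j) x)"
      using w weak_gradient_works[OF w] weak_gradient_AE_eq[OF w]
      by (intro nrm_cong_AE) (auto simp: is_weak_gradient_def)
    then have "sqrt ((nrm M (\<lambda>x. u x - \<psi> j x))\<^sup>2 + (nrm M (\<lambda>x. weak_gradient \<Omega> u x - grad (\<psi> j) x))\<^sup>2) < inverse (real (Suc j))"
      using \<psi>(2)[of j] by (simp add: H1_norm_def)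
    moreover have "nrm M (\<lambda>x. u x - \<psi> j x) \<le> sqrt ((nrm M (\<lambda>x. u x - \<psi> j x))\<^sup>2 + (nrm M (\<lambda>x. weak_gradient \<Omega> u x - grad (\<psi> j) x))\<^sup>2)"
      "nrm M (\<lambda>x. weak_gradient \<Omega> u x - grad (\<psi> j) x) \<le> sqrt ((nrm M (\<lambda>x. u x - \<psi> j x))\<^sup>2 + (nrm M (\<lambda>x. weak_gradient \<Omega> u x - grad (\<psi> j) x))\<^sup>2)"
      by (rule real_sqrt_sum_squares_ge1 real_sqrt_sum_squares_ge2)+
    ultimately show "nrm M (\<lambda>x. u x - \<psi> j x) \<le> inverse (real (Suc j))"
      "nrm M (\<lambda>x. weak_gradient \<Omega> u x - grad (\<psi> j) x) \<le> inverse (real (Suc j))" by linarith+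
  qed
  show ?thesis
  proof (rule that[of \<psi>])
    show "\<psi> j \<in> test_functions \<Omega>" for j by (rule \<psi>)
    show "(\<lambda>j. nrm M (\<lambda>x. u x - \<psi> j x)) \<longlonglongrightarrow> 0"
      by (rule tendsto_sandwich[OF _ _ tendsto_const LIMSEQ_inverse_real_of_nat]; rule always_eventually; rule allI)
        (rule nrm_nonneg, rule le)
    show "(\<lambda>j. nrm M (\<lambda>x. weak_gradient \<Omega> u x - grad (\<psi> j) x)) \<longlonglongrightarrow> 0"
      by (rule tendsto_sandwich[OF _ _ tendsto_const LIMSEQ_inverse_real_of_nat]; rule always_eventually; rule allI)
        (rule nrm_nonneg, rule le)
  qed
qed

lemma test_in_H10:
  assumes \<psi>: "\<psi> \<in> test_functions \<Omega>"
  shows "\<psi> \<in> H10 \<Omega>"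
proof -
  have 0: "is_weak_gradient \<Omega> (\<lambda>x. 0) (\<lambda>x. 0)"
    using test_is_weak_gradient[OF test_functions_zero] gradI[OF has_derivative_eq_rhs[OF has_derivative_const], of 0 0]
    by (simp add: fun_eq_iff is_weak_gradient_def)
  have "nrm M (weak_gradient \<Omega> (\<lambda>x. 0)) = nrm M (\<lambda>x. 0 :: 'a)"
    using 0 weak_gradient_works[OF 0] weak_gradient_AE_eq[OF 0]
    by (intro nrm_cong_AE) (auto simp: is_weak_gradient_def)
  then have "H1_norm \<Omega> (\<lambda>x. \<psi> x - \<psi> x) = 0"
    by (simp add: H1_norm_def Lp2_norm ip_def)
  then show ?thesis
    unfolding H10_def H1_def using test_L2[OF \<psi>] test_is_weak_gradient[OF \<psi>]
    by (auto intro: bexI[OF _ \<psi>])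
qed

end

section \<open>A Nash-type inequality\<close>

context bounded_open_set
begin

lemma lebesgue_lborel_L2:
  fixes f :: "'a \<Rightarrow> real"
  assumes "f \<in> borel_measurable borel"
  shows "f \<in> Lp lborel 2 \<longleftrightarrow> f \<in> Lp lebesgue 2" "nrm lborel f = nrm lebesgue f"
  using assms by (auto simp: Lp2_iff Lp2_norm ip_def integrable_completion integral_completion
      intro: measurable_completion)

text \<open>Cauchy--Schwarz against the indicator of the ball. Translation invariance of the L^2
  norm makes the bound independent of \<open>x\<close>, so it leaves the outer integral in
  \<open>Nash_lebesgue\<close>.\<close>

lemma ball_average_le:
  assumes \<psi>: "\<psi> \<in> test_functions \<Omega>"
  shows "(\<integral>\<^sup>+y. ennreal (indicat_real (ball 0 r) y * \<bar>\<psi> (x + y)\<bar>) \<partial>lborel)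
    \<le> ennreal (sqrt (measure lebesgue (ball 0 r :: 'a set)) * nrm lebesgue \<psi>)"
proof -
  note cont = test_functionsD(4)[OF \<psi>]
  have c[continuous_intros]: "continuous_on UNIV (\<lambda>y. \<psi> (x + y))"
    by (rule continuous_on_compose2[OF cont]) (auto intro!: continuous_intros)
  have [measurable]: "(\<lambda>y. \<psi> (x + y)) \<in> borel_measurable borel"
    using c by (rule borel_measurable_continuous_onI)
  obtain B R where B: "\<And>x. \<bar>\<psi> x\<bar> \<le> B" "\<And>x. norm x > R \<Longrightarrow> \<psi> x = 0"
    using test_bounds[OF \<psi>] by metis
  have "(\<lambda>y. \<psi> (x + y)) \<in> Lp lebesgue 2"
  proof (rule L2_bounded_support)
    show "\<psi> (x + y) = 0" if "norm y > R + norm x" for y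
      using B(2)[of "x + y"] that norm_diff_ineq[of y x] by (simp add: add.commute)
  qed (use B c in \<open>auto intro: continuous_imp_lebesgue_measurable\<close>)
  then have L: "(\<lambda>y. \<bar>\<psi> (x + y)\<bar>) \<in> Lp lborel 2"
    using lebesgue_lborel_L2(1)[of "\<lambda>y. \<psi> (x + y)"] by (auto simp: Lp2_iff)
  have I: "indicat_real (ball 0 r :: 'a set) \<in> Lp lborel 2"
    using emeasure_bounded_finite[of "ball 0 r :: 'a set"]
    by (simp add: Lp2_iff indicator_inter_arith[symmetric] integrable_real_indicator borel_measurable_indicator)
  have "nrm lborel (\<lambda>y. \<bar>\<psi> (x + y)\<bar>) = nrm lborel (\<lambda>y. \<psi> (x + y))"
    by (simp add: Lp2_norm ip_def)
  also have "\<dots> = nrm lebesgue (\<lambda>y. \<psi> (x + y))"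
    by (rule lebesgue_lborel_L2) simp
  also have "\<dots> = nrm lebesgue \<psi>"
    using lebesgue_translation_continuous[of "\<lambda>y. \<psi> y * \<psi> y" x] cont
    by (simp add: Lp2_norm ip_def add.commute[of x] continuous_on_mult)
  finally have n\<psi>: "nrm lborel (\<lambda>y. \<bar>\<psi> (x + y)\<bar>) = nrm lebesgue \<psi>" .
  have nI: "nrm lborel (indicat_real (ball 0 r :: 'a set)) = sqrt (measure lebesgue (ball 0 r :: 'a set))"
    by (simp add: Lp2_norm ip_def indicator_inter_arith[symmetric])
  have "(\<integral>\<^sup>+y. ennreal (indicat_real (ball 0 r) y * \<bar>\<psi> (x + y)\<bar>) \<partial>lborel)
      = ennreal (ip lborel (indicat_real (ball 0 r)) (\<lambda>y. \<bar>\<psi> (x + y)\<bar>))"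
    using L2_inner_integrable[OF I L] unfolding ip_def
    by (subst nn_integral_eq_integral) auto
  also have "\<dots> \<le> ennreal (sqrt (measure lebesgue (ball 0 r :: 'a set)) * nrm lebesgue \<psi>)"
    using Cauchy_Schwarz_ip[OF I L] unfolding n\<psi> nI by (intro ennreal_leI) linarith
  finally show ?thesis .
qed

text \<open>Along the segment from 0 to \<open>y\<close> the pairing has derivative equal to the
  pairing of \<open>w\<close> with a directional derivative of a translate of \<open>\<psi>\<close>,
  which Cauchy--Schwarz bounds uniformly; the mean value inequality concludes.\<close>

lemma translation_estimate:
  assumes \<psi>: "\<psi> \<in> test_functions \<Omega>"
    and w: "w \<in> Lp lebesgue 2" "\<And>x. \<bar>w x\<bar> \<le> V"
  shows "\<bar>(LINT x|lebesgue. w x * \<psi> x) - (LINT x|lebesgue. w x * \<psi> (x + y))\<bar>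
    \<le> norm y * (nrm lebesgue w * nrm lebesgue (grad \<psi>))"
proof -
  let ?J = "\<lambda>t. LINT x|lebesgue. w x * \<psi> (x + t *\<^sub>R y)"
  note contg = test_continuous_grad[OF \<psi>]
  obtain B R where B: "\<And>x. norm (grad \<psi> x) \<le> B" "\<And>x. norm x > R \<Longrightarrow> grad \<psi> x = 0"
    using test_bounds[OF \<psi>] by metis
  have d: "(?J has_real_derivative (LINT x|lebesgue. w x * (grad \<psi> (x + t *\<^sub>R y) \<bullet> y))) (at t)" for t
    using w by (intro derivative_translation_integral[OF \<psi>]) (auto simp: Lp2_iff)
  have b: "\<bar>LINT x|lebesgue. w x * (grad \<psi> (x + t *\<^sub>R y) \<bullet> y)\<bar> \<le> norm y * (nrm lebesgue w * nrm lebesgue (grad \<psi>))" for t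
  proof -
    let ?g = "\<lambda>x. grad \<psi> (x + t *\<^sub>R y) \<bullet> y"
    have c: "continuous_on UNIV (\<lambda>x. grad \<psi> (x + t *\<^sub>R y))"
      by (rule continuous_on_compose2[OF contg]) (auto intro!: continuous_intros)
    have b: "\<bar>grad \<psi> x \<bullet> y\<bar> \<le> norm (grad \<psi> x) * norm y" for x
      by (rule Cauchy_Schwarz_ineq2)
    have g: "?g \<in> Lp lebesgue 2"
    proof (rule L2_bounded_support)
      show "?g x = 0" if "norm x > R + norm (t *\<^sub>R y)" for x
        using B(2)[of "x + t *\<^sub>R y"] that norm_diff_ineq[of x "t *\<^sub>R y"] by simp
      show "norm (?g x) \<le> B * norm y" for x
        using b[of "x + t *\<^sub>R y"] mult_right_mono[OF B(1)[of "x + t *\<^sub>R y"] norm_ge_zero[of y]] by simp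
      show "?g \<in> borel_measurable lebesgue"
        using c by (intro continuous_imp_lebesgue_measurable continuous_intros)
    qed
    have "(nrm lebesgue ?g)\<^sup>2 = (LINT x|lebesgue. (grad \<psi> x \<bullet> y) * (grad \<psi> x \<bullet> y))"
      using lebesgue_translation_continuous[of "\<lambda>x. (grad \<psi> x \<bullet> y) * (grad \<psi> x \<bullet> y)" "t *\<^sub>R y"] contg
      by (simp add: nrm_square ip_def continuous_on_mult continuous_on_inner)
    also have "\<dots> \<le> (LINT x|lebesgue. (norm y)\<^sup>2 * (grad \<psi> x \<bullet> grad \<psi> x))"
    proof (rule integral_mono')
      show "integrable lebesgue (\<lambda>x. (norm y)\<^sup>2 * (grad \<psi> x \<bullet> grad \<psi> x))"
        using test_L2(2)[OF \<psi>] by (simp add: Lp2_iff)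
      show "(grad \<psi> x \<bullet> y) * (grad \<psi> x \<bullet> y) \<le> (norm y)\<^sup>2 * (grad \<psi> x \<bullet> grad \<psi> x)" for x
        using Cauchy_Schwarz_ineq[of "grad \<psi> x" y] by (simp add: power2_eq_square dot_square_norm mult_ac)
    qed simp
    also have "\<dots> = (norm y * nrm lebesgue (grad \<psi>))\<^sup>2"
      by (simp add: power_mult_distrib nrm_square ip_def)
    finally have "nrm lebesgue ?g \<le> norm y * nrm lebesgue (grad \<psi>)"
      by (rule power2_le_imp_le) simp
    then have "nrm lebesgue w * nrm lebesgue ?g \<le> nrm lebesgue w * (norm y * nrm lebesgue (grad \<psi>))"
      by (rule mult_left_mono) simp
    then show ?thesis
      using Cauchy_Schwarz_ip[OF w(1) g] by (simp add: ip_def mult_ac)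
  qed
  have "norm (?J 0 - ?J 1) \<le> norm y * (nrm lebesgue w * nrm lebesgue (grad \<psi>)) * norm (0 - 1 :: real)"
  proof (rule field_differentiable_bound[OF convex_UNIV])
    show "(?J has_real_derivative (LINT x|lebesgue. w x * (grad \<psi> (x + t *\<^sub>R y) \<bullet> y))) (at t within UNIV)" for t
      using d by simp
    show "norm (LINT x|lebesgue. w x * (grad \<psi> (x + t *\<^sub>R y) \<bullet> y)) \<le> norm y * (nrm lebesgue w * nrm lebesgue (grad \<psi>))" for t
      using b by simp
  qed auto
  then show ?thesis by simp
qed

text \<open>Replacing \<open>\<psi>\<close> by a translate by at most \<open>r\<close> costs the
  gradient term. Averaging the translated pairing over the ball and exchanging integrals leaves the
  L^1 norm of \<open>w\<close> times a local mean of \<open>\<psi>\<close>, estimated by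
  \<open>ball_average_le\<close>.\<close>

lemma Nash_lebesgue:
  assumes \<psi>: "\<psi> \<in> test_functions \<Omega>" and "r > 0"
    and w: "w \<in> Lp lebesgue 2" "\<And>x. \<bar>w x\<bar> \<le> V" "integrable lebesgue w"
  shows "(LINT x|lebesgue. w x * \<psi> x) \<le> r * (nrm lebesgue w * nrm lebesgue (grad \<psi>))
    + (LINT x|lebesgue. \<bar>w x\<bar>) * nrm lebesgue \<psi> / sqrt (measure lebesgue (ball 0 r :: 'a set))"
proof -
  define \<beta> where "\<beta> = measure lebesgue (ball 0 r :: 'a set)"
  have \<beta>: "\<beta> > 0"
    unfolding \<beta>_def using \<open>r > 0\<close> content_ball_pos[of r 0] by simp
  \<comment> \<open>What remains of the pairing after the translation error: a lower bound for the
    pairing with every translate by less than \<open>r\<close>.\<close>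
  define a where "a = (LINT x|lebesgue. w x * \<psi> x) - r * (nrm lebesgue w * nrm lebesgue (grad \<psi>))"
  note cont = test_functionsD(4)[OF \<psi>]
  have c[continuous_intros]: "continuous_on UNIV (\<lambda>x. \<psi> (x + y))" for y
    by (rule continuous_on_compose2[OF cont]) (auto intro!: continuous_intros)
  have [measurable]: "\<psi> \<in> borel_measurable borel"
    using cont by (rule borel_measurable_continuous_onI)
  have [measurable]: "(\<lambda>x. \<psi> (x + y)) \<in> borel_measurable lebesgue" for y
    using c by (rule continuous_imp_lebesgue_measurable)
  obtain B R where B: "\<And>x. \<bar>\<psi> x\<bar> \<le> B" "\<And>x. norm x > R \<Longrightarrow> \<psi> x = 0"
    using test_bounds[OF \<psi>] by metis
  have [measurable]: "w \<in> borel_measurable lebesgue" using w(1) by (simp add: Lp2_iff)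
  \<comment> \<open>The exchange of integrals takes place in a product of Borel measures and so
    needs a Borel version of \<open>w\<close>.\<close>
  obtain w' where w': "w' \<in> borel_measurable lborel" "AE x in lborel. w x = w' x"
    using completion_ex_borel_measurable_real[of w lborel] by auto
  have [measurable]: "w' \<in> borel_measurable borel" using w'(1) by simp
  have [measurable]: "ball 0 r \<in> sets (borel :: 'a measure)" by simp
  have ae: "AE x in lebesgue. w x = w' x" using w'(2) by (rule AE_completion)
  have le: "ennreal a \<le> (\<integral>\<^sup>+x. ennreal (\<bar>w' x\<bar> * \<bar>\<psi> (x + y)\<bar>) \<partial>lborel)" if "y \<in> ball 0 r" for y
  proof -
    have int: "integrable lebesgue (\<lambda>x. \<bar>w x\<bar> * \<bar>\<psi> (x + y)\<bar>)"
    proof (rule Bochner_Integration.integrable_bound)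
      show "integrable lebesgue (\<lambda>x. B * w x)" using w(3) by simp
      show "AE x in lebesgue. norm (\<bar>w x\<bar> * \<bar>\<psi> (x + y)\<bar>) \<le> norm (B * w x)"
      proof (rule AE_I2)
        fix x
        have "\<bar>\<psi> (x + y)\<bar> \<le> \<bar>B\<bar>" using B(1)[of "x + y"] by linarith
        then show "norm (\<bar>w x\<bar> * \<bar>\<psi> (x + y)\<bar>) \<le> norm (B * w x)"
          by (simp add: abs_mult mult.commute[of "\<bar>B\<bar>"] mult_left_mono)
      qed
    qed measurable
    have "norm y * (nrm lebesgue w * nrm lebesgue (grad \<psi>)) \<le> r * (nrm lebesgue w * nrm lebesgue (grad \<psi>))"
      using that by (intro mult_right_mono) auto
    then have "a \<le> (LINT x|lebesgue. w x * \<psi> (x + y))"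
      using translation_estimate[OF \<psi> w(1,2), of y] unfolding a_def by linarith
    also have "\<dots> \<le> (LINT x|lebesgue. \<bar>w x\<bar> * \<bar>\<psi> (x + y)\<bar>)"
      using integral_abs_bound[of lebesgue "\<lambda>x. w x * \<psi> (x + y)"] by (simp add: abs_mult)
    finally have "ennreal a \<le> ennreal (LINT x|lebesgue. \<bar>w x\<bar> * \<bar>\<psi> (x + y)\<bar>)" by (rule ennreal_leI)
    also have "\<dots> = (\<integral>\<^sup>+x. ennreal (\<bar>w x\<bar> * \<bar>\<psi> (x + y)\<bar>) \<partial>lebesgue)"
      using int by (subst nn_integral_eq_integral) auto
    also have "\<dots> = (\<integral>\<^sup>+x. ennreal (\<bar>w' x\<bar> * \<bar>\<psi> (x + y)\<bar>) \<partial>lebesgue)"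
      by (rule nn_integral_cong_AE) (use ae in eventually_elim, simp)
    also have "\<dots> = (\<integral>\<^sup>+x. ennreal (\<bar>w' x\<bar> * \<bar>\<psi> (x + y)\<bar>) \<partial>lborel)"
      by (rule nn_integral_completion)
    finally show ?thesis .
  qed
  \<comment> \<open>An inequality suffices, and for negative \<open>a\<close> both sides are
    0.\<close>
  have "ennreal (a * \<beta>) \<le> ennreal a * ennreal \<beta>"
    using \<beta> by (cases "a \<ge> 0") (auto simp: ennreal_mult ennreal_neg mult_nonpos_nonneg)
  also have "ennreal a * ennreal \<beta> = (\<integral>\<^sup>+y. ennreal a * indicator (ball 0 r) y \<partial>(lborel :: 'a measure))"
    using emeasure_eq_ennreal_measure[of lborel "ball 0 r :: 'a set"] emeasure_bounded_finite[of "ball 0 r :: 'a set"]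
    by (simp add: nn_integral_cmult_indicator \<beta>_def)
  also have "\<dots> \<le> (\<integral>\<^sup>+y. (\<integral>\<^sup>+x. indicator (ball 0 r) y * ennreal (\<bar>w' x\<bar> * \<bar>\<psi> (x + y)\<bar>) \<partial>lborel) \<partial>lborel)"
    using le by (intro nn_integral_mono) (auto simp: nn_integral_cmult indicator_def)
  also have "\<dots> = (\<integral>\<^sup>+x. (\<integral>\<^sup>+y. indicator (ball 0 r) y * ennreal (\<bar>w' x\<bar> * \<bar>\<psi> (x + y)\<bar>) \<partial>lborel) \<partial>lborel)"
    by (rule lborel_pair.Fubini') measurable
  also have "\<dots> = (\<integral>\<^sup>+x. ennreal \<bar>w' x\<bar> * (\<integral>\<^sup>+y. ennreal (indicat_real (ball 0 r) y * \<bar>\<psi> (x + y)\<bar>) \<partial>lborel) \<partial>lborel)"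
    by (intro nn_integral_cong, subst nn_integral_cmult[symmetric])
      (auto intro!: nn_integral_cong simp: ennreal_mult indicator_def)
  also have "\<dots> \<le> (\<integral>\<^sup>+x. ennreal \<bar>w' x\<bar> * ennreal (sqrt \<beta> * nrm lebesgue \<psi>) \<partial>lborel)"
    unfolding \<beta>_def by (intro nn_integral_mono mult_left_mono ball_average_le[OF \<psi>]) auto
  also have "\<dots> = (\<integral>\<^sup>+x. ennreal \<bar>w' x\<bar> \<partial>lebesgue) * ennreal (sqrt \<beta> * nrm lebesgue \<psi>)"
    by (subst nn_integral_multc) (auto simp: nn_integral_completion)
  also have "(\<integral>\<^sup>+x. ennreal \<bar>w' x\<bar> \<partial>lebesgue) = (\<integral>\<^sup>+x. ennreal \<bar>w x\<bar> \<partial>lebesgue)"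
    by (rule nn_integral_cong_AE) (use ae in eventually_elim, simp)
  also have "\<dots> = ennreal (LINT x|lebesgue. \<bar>w x\<bar>)"
    using w(3) by (subst nn_integral_eq_integral) auto
  also have "\<dots> * ennreal (sqrt \<beta> * nrm lebesgue \<psi>) = ennreal ((LINT x|lebesgue. \<bar>w x\<bar>) * (sqrt \<beta> * nrm lebesgue \<psi>))"
    using \<beta> by (subst ennreal_mult) auto
  finally have "a * \<beta> \<le> (LINT x|lebesgue. \<bar>w x\<bar>) * (sqrt \<beta> * nrm lebesgue \<psi>)"
    using \<beta> by (subst (asm) ennreal_le_iff) auto
  also have "\<dots> = ((LINT x|lebesgue. \<bar>w x\<bar>) * nrm lebesgue \<psi> / sqrt \<beta>) * \<beta>"
    using \<beta> by (simp add: field_simps)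
  finally have "a \<le> (LINT x|lebesgue. \<bar>w x\<bar>) * nrm lebesgue \<psi> / sqrt \<beta>"
    unfolding mult_le_cancel_right_pos[OF \<beta>] .
  then show ?thesis unfolding a_def \<beta>_def by linarith
qed

text \<open>Extending \<open>v\<close> by zero gives a bounded function with bounded support on the
  whole space. Since \<open>\<psi>\<close> and its gradient vanish off \<open>\<Omega>\<close>, all
  pairings and norms are unchanged.\<close>

lemma Nash_test:
  assumes \<psi>: "\<psi> \<in> test_functions \<Omega>" and "r > 0"
    and v: "v \<in> borel_measurable M" "\<And>x. x \<in> \<Omega> \<Longrightarrow> \<bar>v x\<bar> \<le> V"
  shows "ip M \<psi> v \<le> r * (nrm M v * nrm M (grad \<psi>))
    + (LINT x|M. \<bar>v x\<bar>) * nrm M \<psi> / sqrt (measure lebesgue (ball 0 r :: 'a set))"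
proof -
  define w where "w x = indicat_real \<Omega> x * v x" for x
  obtain R where R: "\<And>x. x \<in> \<Omega> \<Longrightarrow> norm x \<le> R" using bounded_\<Omega> by (auto simp: bounded_iff)
  have m: "w \<in> borel_measurable lebesgue"
    using v(1) unfolding w_def by (simp add: borel_measurable_restrict_space_iff)
  have b: "\<bar>w x\<bar> \<le> max 0 V" for x using v(2)[of x] by (auto simp: w_def indicator_def)
  have z: "w x = 0" if "norm x > R" for x using R[of x] that by (auto simp: w_def indicator_def)
  have L: "w \<in> Lp lebesgue 2" "integrable lebesgue w"
    by (rule L2_bounded_support[OF m, of "max 0 V" R] integrable_bounded_support[OF m, of "max 0 V" R];
        use b z in simp)+
  have M: "(LINT x|M. f x) = (LINT x|lebesgue. indicat_real \<Omega> x * f x)" for f :: "'a \<Rightarrow> real"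
    by (simp add: integral_restrict_space)
  have e1: "(LINT x|lebesgue. w x * \<psi> x) = ip M \<psi> v"
    unfolding ip_def M w_def by (simp add: mult_ac)
  have "(LINT x|lebesgue. w x * w x) = (LINT x|M. v x * v x)"
    unfolding M w_def by (rule Bochner_Integration.integral_cong) (auto simp: indicator_def)
  then have e2: "nrm lebesgue w = nrm M v" by (simp add: Lp2_norm ip_def)
  have e3: "(LINT x|lebesgue. \<bar>w x\<bar>) = (LINT x|M. \<bar>v x\<bar>)"
    unfolding M w_def by (rule Bochner_Integration.integral_cong) (auto simp: indicator_def)
  have e4: "nrm M \<psi> = nrm lebesgue \<psi>" "nrm M (grad \<psi>) = nrm lebesgue (grad \<psi>)"
    unfolding Lp2_norm ip_def using test_functionsD(5)[OF \<psi>] test_grad_outside[OF \<psi>]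
    by (subst integral_M_support; simp)+
  show ?thesis
    using Nash_lebesgue[OF \<psi> \<open>r > 0\<close> L(1) b L(2)] unfolding e1 e2 e3 e4 .
qed

end

section \<open>Dirichlet eigenfunctions\<close>

locale dirichlet_system = bounded_open_set \<Omega> for \<Omega> :: "'a::euclidean_space set" +
  fixes lam :: "nat \<Rightarrow> real" and e :: "nat \<Rightarrow> 'a \<Rightarrow> real"
  assumes eigensystem: "dirichlet_eigensystem \<Omega> lam e"
begin

lemma lam_pos: "lam n > 0"
proof -
  have "0 < lam 0" "mono lam" using eigensystem by (auto simp: dirichlet_eigensystem_def)
  then show ?thesis using monoD[of lam 0 n] by simp
qed

lemma e_H10: "e n \<in> H10 \<Omega>"
  using eigensystem by (simp add: dirichlet_eigensystem_def dirichlet_laplacian_def)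

sublocale orthonormal_basis M e
proof
  show "e n \<in> Lp M 2" for n using e_H10[of n] by (simp add: H10_def H1_def)
  show "ip M (e m) (e n) = (if m = n then 1 else 0)" for m n
    using eigensystem by (simp add: dirichlet_eigensystem_def ip_def)
  show "AE x in M. u x = 0" if "u \<in> Lp M 2" "\<And>n. ip M u (e n) = 0" for u
    using eigensystem that by (simp add: dirichlet_eigensystem_def ip_def)
qed

abbreviation "G n \<equiv> weak_gradient \<Omega> (e n)"

lemma G_L2 [simp]: "G n \<in> Lp M 2"
  using e_H10[of n] weak_gradient_works by (auto simp: H10_def H1_def is_weak_gradient_def)

text \<open>The weak eigenvalue equation tested with \<open>\<psi>\<close>; the representative
  chosen by \<open>weak_gradient \<Omega> \<psi>\<close> is exchanged for the classical gradient by
  uniqueness.\<close>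

lemma ip_G_grad:
  assumes \<psi>: "\<psi> \<in> test_functions \<Omega>"
  shows "ip M (G n) (grad \<psi>) = lam n * ip M (e n) \<psi>"
proof -
  have w: "is_weak_gradient \<Omega> \<psi> (grad \<psi>)" using \<psi> by (rule test_is_weak_gradient)
  have "dirichlet_form \<Omega> (e n) \<psi> = (LINT x|M. lam n * e n x * \<psi> x)"
    using eigensystem test_in_H10[OF \<psi>]
    by (simp add: dirichlet_eigensystem_def dirichlet_laplacian_def)
  moreover have "dirichlet_form \<Omega> (e n) \<psi> = ip M (weak_gradient \<Omega> \<psi>) (G n)"
    by (simp add: dirichlet_form_def ip_def inner_commute)
  moreover have "\<dots> = ip M (grad \<psi>) (G n)"
    using weak_gradient_works[OF w] test_L2(4)[OF \<psi>] weak_gradient_AE_eq[OF w]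
    by (intro ip_cong_AE) (auto simp: is_weak_gradient_def)
  moreover have "(LINT x|M. lam n * e n x * \<psi> x) = lam n * ip M (e n) \<psi>"
    by (simp add: ip_def mult.assoc)
  ultimately show ?thesis using ip_commute[of M "grad \<psi>" "G n"] by simp
qed

text \<open>Serves as the gradient of \<open>psum c k\<close>. The link between the two is not a
  weak-gradient statement but the simultaneous approximation in \<open>psum_approx\<close>.\<close>

definition gsum :: "(nat \<Rightarrow> real) \<Rightarrow> nat \<Rightarrow> 'a \<Rightarrow> 'a" where
  "gsum c k x = (\<Sum>n<k. c n *\<^sub>R G n x)"

lemma gsum_L2 [simp]: "gsum c k \<in> Lp M 2"
  unfolding gsum_def by (intro L2_sum L2_scale) simp

lemma ip_gsum_left: "w \<in> Lp M 2 \<Longrightarrow> ip M (gsum c k) w = (\<Sum>n<k. c n * ip M (G n) w)"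
  unfolding gsum_def by (subst ip_sum_left) (auto intro: L2_scale simp: ip_scale_left)

lemma psum_approx:
  obtains \<psi> where "\<And>j. \<psi> j \<in> test_functions \<Omega>" "(\<lambda>j. nrm M (\<lambda>x. psum c k x - \<psi> j x)) \<longlonglongrightarrow> 0"
    "(\<lambda>j. nrm M (\<lambda>x. gsum c k x - grad (\<psi> j) x)) \<longlonglongrightarrow> 0"
proof -
  have "\<exists>\<zeta>. (\<forall>j. \<zeta> j \<in> test_functions \<Omega>) \<and> (\<lambda>j. nrm M (\<lambda>x. e n x - \<zeta> j x)) \<longlonglongrightarrow> 0
    \<and> (\<lambda>j. nrm M (\<lambda>x. G n x - grad (\<zeta> j) x)) \<longlonglongrightarrow> 0" for n
    by (rule H10_approx[OF e_H10[of n]]) blast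
  then have "\<exists>\<zeta>. \<forall>n. (\<forall>j. \<zeta> n j \<in> test_functions \<Omega>) \<and> (\<lambda>j. nrm M (\<lambda>x. e n x - \<zeta> n j x)) \<longlonglongrightarrow> 0
    \<and> (\<lambda>j. nrm M (\<lambda>x. G n x - grad (\<zeta> n j) x)) \<longlonglongrightarrow> 0"
    by (intro choice allI)
  then obtain \<zeta> where \<zeta>: "\<And>n j. \<zeta> n j \<in> test_functions \<Omega>" "\<And>n. (\<lambda>j. nrm M (\<lambda>x. e n x - \<zeta> n j x)) \<longlonglongrightarrow> 0"
    "\<And>n. (\<lambda>j. nrm M (\<lambda>x. G n x - grad (\<zeta> n j) x)) \<longlonglongrightarrow> 0" by blast
  show ?thesis
  proof (rule that[of "\<lambda>j x. \<Sum>n<k. c n * \<zeta> n j x"])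
    show "(\<lambda>x. \<Sum>n<k. c n * \<zeta> n j x) \<in> test_functions \<Omega>" for j
      using \<zeta>(1) by (rule test_functions_sum)
    have "(\<lambda>j. nrm M (\<lambda>x. \<Sum>n<k. c n *\<^sub>R (e n x - \<zeta> n j x))) \<longlonglongrightarrow> 0"
      using \<zeta> test_L2(3) by (intro nrm_sum_tendsto_0 L2_diff) auto
    then show "(\<lambda>j. nrm M (\<lambda>x. psum c k x - (\<Sum>n<k. c n * \<zeta> n j x))) \<longlonglongrightarrow> 0"
      by (simp add: psum_def sum_subtractf right_diff_distrib)
    have "(\<lambda>j. nrm M (\<lambda>x. \<Sum>n<k. c n *\<^sub>R (G n x - grad (\<zeta> n j) x))) \<longlonglongrightarrow> 0"
      using \<zeta> test_L2(4) by (intro nrm_sum_tendsto_0 L2_diff) auto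
    then show "(\<lambda>j. nrm M (\<lambda>x. gsum c k x - grad (\<lambda>x. \<Sum>n<k. c n * \<zeta> n j x) x)) \<longlonglongrightarrow> 0"
      using \<zeta>(1) by (simp add: gsum_def sum_subtractf scaleR_right_diff_distrib grad_sum[of _ _ \<Omega>])
  qed
qed

lemma ip_gsum_grad:
  assumes \<psi>: "\<psi> \<in> test_functions \<Omega>"
  shows "ip M (gsum c k) (grad \<psi>) = (\<Sum>n<k. c n * (lam n * ip M (e n) \<psi>))"
  using test_L2[OF \<psi>] by (simp add: ip_gsum_left ip_G_grad[OF \<psi>])

text \<open>Since \<open>ip_G_grad\<close> speaks of test functions, one factor is replaced by
  gradients of approximants; in the limit their coefficients become \<open>c n\<close>, and the
  Dirichlet energy is diagonal.\<close>

lemma ip_gsum_gsum: "ip M (gsum c k) (gsum c k) = (\<Sum>n<k. lam n * (c n)\<^sup>2)"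
proof -
  obtain \<psi> where \<psi>: "\<And>j. \<psi> j \<in> test_functions \<Omega>" "(\<lambda>j. nrm M (\<lambda>x. psum c k x - \<psi> j x)) \<longlonglongrightarrow> 0"
    "(\<lambda>j. nrm M (\<lambda>x. gsum c k x - grad (\<psi> j) x)) \<longlonglongrightarrow> 0" by (rule psum_approx[of c k]) blast
  have "(\<lambda>j. ip M (grad (\<psi> j)) (gsum c k)) \<longlonglongrightarrow> ip M (gsum c k) (gsum c k)"
    using \<psi> test_L2 by (intro ip_tendsto_left) auto
  moreover have "(\<lambda>j. \<Sum>n<k. c n * (lam n * ip M (\<psi> j) (e n))) \<longlonglongrightarrow> (\<Sum>n<k. c n * (lam n * ip M (psum c k) (e n)))"
    using \<psi> test_L2 by (intro tendsto_intros ip_tendsto_left) auto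
  moreover have "ip M (grad (\<psi> j)) (gsum c k) = (\<Sum>n<k. c n * (lam n * ip M (\<psi> j) (e n)))" for j
    using ip_gsum_grad[OF \<psi>(1)] by (simp add: ip_commute[of M "grad _"] ip_commute[of M "\<psi> _"])
  ultimately have "ip M (gsum c k) (gsum c k) = (\<Sum>n<k. c n * (lam n * ip M (psum c k) (e n)))"
    using LIMSEQ_unique by fastforce
  then show ?thesis by (simp add: ip_psum_e power2_eq_square mult_ac)
qed

text \<open>The limit of \<open>Nash_test\<close> along \<open>psum_approx\<close>; the gradient
  norm turns into a spectral sum.\<close>

lemma Nash_psum:
  assumes "r > 0" and v: "v \<in> Lp M 2" "\<And>x. x \<in> \<Omega> \<Longrightarrow> \<bar>v x\<bar> \<le> V"
  shows "ip M (psum c k) v \<le> r * (nrm M v * sqrt (\<Sum>n<k. lam n * (c n)\<^sup>2))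
    + (LINT x|M. \<bar>v x\<bar>) * nrm M (psum c k) / sqrt (measure lebesgue (ball 0 r :: 'a set))"
proof -
  obtain \<psi> where \<psi>: "\<And>j. \<psi> j \<in> test_functions \<Omega>" "(\<lambda>j. nrm M (\<lambda>x. psum c k x - \<psi> j x)) \<longlonglongrightarrow> 0"
    "(\<lambda>j. nrm M (\<lambda>x. gsum c k x - grad (\<psi> j) x)) \<longlonglongrightarrow> 0" by (rule psum_approx[of c k]) blast
  have 1: "(\<lambda>j. ip M (\<psi> j) v) \<longlonglongrightarrow> ip M (psum c k) v"
    using \<psi> v test_L2 by (intro ip_tendsto_left) auto
  have n: "(\<lambda>j. nrm M (\<psi> j)) \<longlonglongrightarrow> nrm M (psum c k)" "(\<lambda>j. nrm M (grad (\<psi> j))) \<longlonglongrightarrow> nrm M (gsum c k)"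
    using \<psi> test_L2 by (auto intro!: nrm_tendsto)
  let ?\<beta> = "sqrt (measure lebesgue (ball 0 r :: 'a set))"
  have 2: "(\<lambda>j. r * (nrm M v * nrm M (grad (\<psi> j))) + (LINT x|M. \<bar>v x\<bar>) * nrm M (\<psi> j) / ?\<beta>)
    \<longlonglongrightarrow> r * (nrm M v * nrm M (gsum c k)) + (LINT x|M. \<bar>v x\<bar>) * nrm M (psum c k) / ?\<beta>"
    unfolding divide_inverse by (intro tendsto_intros n)
  have "ip M (psum c k) v \<le> r * (nrm M v * nrm M (gsum c k)) + (LINT x|M. \<bar>v x\<bar>) * nrm M (psum c k) / ?\<beta>"
    using Nash_test[OF \<psi>(1) \<open>r > 0\<close> L2_measurable[OF v(1)] v(2)]
    by (intro LIMSEQ_le[OF 1 2]) auto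
  then show ?thesis by (simp only: Lp2_norm[of M "gsum c k"] ip_gsum_gsum)
qed

lemma L2_contraction:
  fixes \<phi> :: "real \<Rightarrow> real"
  assumes "u \<in> Lp M 2" and "continuous_on UNIV \<phi>" "\<And>s t. \<bar>\<phi> s - \<phi> t\<bar> \<le> \<bar>s - t\<bar>" "\<phi> 0 = 0"
  shows "(\<lambda>x. \<phi> (u x)) \<in> Lp M 2"
proof (rule L2_bound[OF _ assms(1)])
  show "(\<lambda>x. \<phi> (u x)) \<in> borel_measurable M"
    using assms(2) L2_measurable[OF assms(1)] by (rule borel_measurable_continuous_on)
  show "\<bar>\<phi> (u x)\<bar> \<le> \<bar>u x\<bar>" for x using assms(3)[of "u x" 0] assms(4) by simp
qed

lemma nrm_contraction:
  fixes \<phi> :: "real \<Rightarrow> real"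
  assumes "u \<in> Lp M 2" "w \<in> Lp M 2" "\<And>s t. \<bar>\<phi> s - \<phi> t\<bar> \<le> \<bar>s - t\<bar>"
  shows "nrm M (\<lambda>x. \<phi> (u x) - \<phi> (w x)) \<le> nrm M (\<lambda>x. u x - w x)"
proof -
  have "(LINT x|M. (\<phi> (u x) - \<phi> (w x)) * (\<phi> (u x) - \<phi> (w x))) \<le> (LINT x|M. (u x - w x) * (u x - w x))"
  proof (rule integral_mono')
    show "integrable M (\<lambda>x. (u x - w x) * (u x - w x))"
      using L2_diff[OF assms(1,2)] by (simp add: Lp2_iff)
    show "(\<phi> (u x) - \<phi> (w x)) * (\<phi> (u x) - \<phi> (w x)) \<le> (u x - w x) * (u x - w x)" for x
      using assms(3)[of "u x" "w x"] by (simp flip: power2_eq_square abs_le_square_iff)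
  qed simp
  then show ?thesis by (simp add: Lp2_norm ip_def)
qed

text \<open>Formally the sum is the Dirichlet pairing of w = \<open>psum c k\<close> with \<phi>(w),
  that is the integral of \<sigma>(w) times the squared gradient of w. The computation is legitimate
  for the test functions approximating w, and the hypothesis \<open>C\<close> makes \<phi> of a test
  function smooth.\<close>

lemma energy_monotone:
  fixes \<phi> \<sigma> :: "real \<Rightarrow> real"
  assumes \<phi>: "\<And>t. (\<phi> has_real_derivative \<sigma> t) (at t)" "\<And>t. 0 \<le> \<sigma> t" "\<And>t. \<sigma> t \<le> 1" "\<phi> 0 = 0"
    and C: "\<And>h k. (\<And>k. C_k k h) \<Longrightarrow> C_k k (\<lambda>x::'a. \<phi> (h x))"
  shows "0 \<le> (\<Sum>n<k. c n * (lam n * ip M (e n) (\<lambda>x. \<phi> (psum c k x))))"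
proof -
  obtain \<psi> where \<psi>: "\<And>j. \<psi> j \<in> test_functions \<Omega>" "(\<lambda>j. nrm M (\<lambda>x. psum c k x - \<psi> j x)) \<longlonglongrightarrow> 0"
    "(\<lambda>j. nrm M (\<lambda>x. gsum c k x - grad (\<psi> j) x)) \<longlonglongrightarrow> 0" by (rule psum_approx[of c k]) blast
  have lip: "\<bar>\<phi> s - \<phi> t\<bar> \<le> \<bar>s - t\<bar>" for s t
    using field_differentiable_bound[of UNIV \<phi> \<sigma> 1 s t] \<phi> by auto
  have cont: "continuous_on UNIV \<phi>"
    using \<phi>(1) by (meson DERIV_isCont continuous_at_imp_continuous_on)
  define f where "f j x = \<phi> (\<psi> j x)" for j x
  have f: "f j \<in> test_functions \<Omega>" for j
    unfolding f_def
    by (rule test_functions_compose[where \<phi> = \<phi> and \<psi> = "\<psi> j", OF \<psi>(1) C[OF test_functionsD(1)[OF \<psi>(1)]] \<phi>(4)])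
  have gf: "grad (f j) x = \<sigma> (\<psi> j x) *\<^sub>R grad (\<psi> j) x" for j x
    unfolding f_def by (rule grad_compose[OF \<psi>(1) \<phi>(1)])
  have fL: "(\<lambda>x. \<phi> (psum c k x)) \<in> Lp M 2" by (rule L2_contraction[OF psum_L2 cont lip \<phi>(4)])
  have "(\<lambda>j. nrm M (\<lambda>x. \<phi> (psum c k x) - f j x)) \<longlonglongrightarrow> 0"
    unfolding f_def
    by (rule tendsto_sandwich[OF _ _ tendsto_const \<psi>(2)]; rule always_eventually; rule allI)
      (rule nrm_nonneg, rule nrm_contraction[OF psum_L2 test_L2(3)[OF \<psi>(1)] lip])
  then have "(\<lambda>j. \<Sum>n<k. c n * (lam n * ip M (f j) (e n))) \<longlonglongrightarrow> (\<Sum>n<k. c n * (lam n * ip M (\<lambda>x. \<phi> (psum c k x)) (e n)))"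
    using fL test_L2[OF f] by (intro tendsto_intros ip_tendsto_left) auto
  then have lim: "(\<lambda>j. ip M (gsum c k) (grad (f j))) \<longlonglongrightarrow> (\<Sum>n<k. c n * (lam n * ip M (e n) (\<lambda>x. \<phi> (psum c k x))))"
    by (simp add: ip_gsum_grad[OF f] ip_commute[of M _ "e _"])
  \<comment> \<open>Splitting off the gradient of the approximant leaves a nonnegative main term.
    The error is controlled because \<sigma> \<le> 1 bounds the gradients of \<open>f j\<close> by
    those of \<open>\<psi> j\<close>, so convergence of the gradients of \<open>f j\<close> is not
    at issue.\<close>
  have ge: "- (nrm M (\<lambda>x. gsum c k x - grad (\<psi> j) x) * nrm M (grad (\<psi> j))) \<le> ip M (gsum c k) (grad (f j))" for j
  proof -
    have L: "grad (\<psi> j) \<in> Lp M 2" "grad (f j) \<in> Lp M 2" using test_L2[OF f] test_L2[OF \<psi>(1)] by auto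
    have "ip M (gsum c k) (grad (f j)) = ip M (\<lambda>x. gsum c k x - grad (\<psi> j) x) (grad (f j)) + ip M (grad (\<psi> j)) (grad (f j))"
      using L by (simp add: ip_diff_left)
    moreover have "0 \<le> ip M (grad (\<psi> j)) (grad (f j))"
      by (rule ip_nonneg_of_AE) (simp add: gf \<phi>)
    moreover have "\<bar>ip M (\<lambda>x. gsum c k x - grad (\<psi> j) x) (grad (f j))\<bar> \<le> nrm M (\<lambda>x. gsum c k x - grad (\<psi> j) x) * nrm M (grad (f j))"
      using L by (intro Cauchy_Schwarz_ip L2_diff) auto
    moreover have "nrm M (grad (f j)) \<le> nrm M (grad (\<psi> j))"
    proof -
      have "(LINT x|M. grad (f j) x \<bullet> grad (f j) x) \<le> (LINT x|M. grad (\<psi> j) x \<bullet> grad (\<psi> j) x)"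
      proof (rule integral_mono')
        show "integrable M (\<lambda>x. grad (\<psi> j) x \<bullet> grad (\<psi> j) x)" using L by (simp add: Lp2_iff)
        fix x
        have "\<sigma> (\<psi> j x) * \<sigma> (\<psi> j x) \<le> 1" using \<phi>(2,3)[of "\<psi> j x"] by (simp add: mult_le_one)
        then have "(\<sigma> (\<psi> j x) * \<sigma> (\<psi> j x)) * (grad (\<psi> j) x \<bullet> grad (\<psi> j) x) \<le> 1 * (grad (\<psi> j) x \<bullet> grad (\<psi> j) x)"
          by (rule mult_right_mono) simp
        then show "grad (f j) x \<bullet> grad (f j) x \<le> grad (\<psi> j) x \<bullet> grad (\<psi> j) x"
          by (simp add: gf mult.assoc)
      qed simp
      then show ?thesis by (simp add: Lp2_norm ip_def)
    qed
    then have "nrm M (\<lambda>x. gsum c k x - grad (\<psi> j) x) * nrm M (grad (f j)) \<le> nrm M (\<lambda>x. gsum c k x - grad (\<psi> j) x) * nrm M (grad (\<psi> j))"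
      by (rule mult_left_mono) simp
    ultimately show ?thesis by linarith
  qed
  have "(\<lambda>j. nrm M (grad (\<psi> j))) \<longlonglongrightarrow> nrm M (gsum c k)"
    using \<psi> test_L2 by (intro nrm_tendsto) auto
  then have "(\<lambda>j. - (nrm M (\<lambda>x. gsum c k x - grad (\<psi> j) x) * nrm M (grad (\<psi> j)))) \<longlonglongrightarrow> - (0 * nrm M (gsum c k))"
    using \<psi>(3) by (intro tendsto_intros)
  from LIMSEQ_le[OF this lim] ge show ?thesis by auto
qed

end

section \<open>Truncations and their smooth approximations\<close>

lemma nonneg_if_ge_neg_mult:
  assumes "\<And>\<epsilon>. \<epsilon> > 0 \<Longrightarrow> - \<epsilon> * C \<le> (a::real)"
  shows "0 \<le> a"
proof (rule field_le_epsilon)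
  fix y :: real assume y: "y > 0"
  \<comment> \<open>The sign of \<open>C\<close> is unknown, hence \<epsilon> = y / (\<bar>C\<bar> +
    1); the summand 1 covers C = 0.\<close>
  have "0 < \<bar>C\<bar> + 1" "C \<le> \<bar>C\<bar> + 1" by linarith+
  then have "C / (\<bar>C\<bar> + 1) \<le> 1" by (simp add: pos_divide_le_eq)
  then have "y * (C / (\<bar>C\<bar> + 1)) \<le> y * 1" using y by (intro mult_left_mono) auto
  moreover have "- (y / (\<bar>C\<bar> + 1)) * C \<le> a" using y by (intro assms) (simp add: add_nonneg_pos)
  ultimately show "0 \<le> a + y" by simp
qed

text \<open>The cap at \<open>l\<close> serves twice: it keeps the test function bounded, and it
  makes it equal to \<open>l - k\<close> on the set where \<open>t > l\<close>, which yields the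
  measure of the next level set.\<close>

definition trunc :: "real \<Rightarrow> real \<Rightarrow> real \<Rightarrow> real" where
  "trunc k l t = max 0 (min t l - k)"

text \<open>A smooth substitute for \<open>\<lambda>t. max 0 (t - c)\<close> that maps test functions to test functions, so that no
  chain rule for truncations of Sobolev functions is needed.\<close>

definition softplus :: "real \<Rightarrow> real \<Rightarrow> real \<Rightarrow> real" where
  "softplus c \<epsilon> t = \<epsilon> * (ln (1 + exp ((t - c) / \<epsilon>)) - ln (1 + exp (- c / \<epsilon>)))"

text \<open>The derivative of \<open>softplus c \<epsilon>\<close>. It solves \<sigma>' = \<sigma>
  (1 - \<sigma>) / \<epsilon>, the kind of equation that \<open>C_k_compose_ode\<close> asks
  for.\<close>

definition logistic :: "real \<Rightarrow> real \<Rightarrow> real \<Rightarrow> real" where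
  "logistic c \<epsilon> t = 1 - 1 / (1 + exp ((t - c) / \<epsilon>))"

lemma one_plus_exp_pos: "1 + exp x > (0::real)"
  using exp_gt_zero[of x] by linarith

lemma softplus_deriv:
  assumes "\<epsilon> > 0"
  shows "(softplus c \<epsilon> has_real_derivative logistic c \<epsilon> t) (at t)"
proof -
  define E where "E = exp ((t - c) / \<epsilon>)"
  have E: "E > 0" by (simp add: E_def)
  have "((\<lambda>t. exp ((t - c) / \<epsilon>)) has_real_derivative E * (1 / \<epsilon>)) (at t)"
    using assms unfolding E_def by (auto intro!: derivative_eq_intros)
  then have "((\<lambda>t. ln (1 + exp ((t - c) / \<epsilon>))) has_real_derivative E * (1 / \<epsilon>) / (1 + E)) (at t)"
    using assms E unfolding E_def by (auto intro!: derivative_eq_intros simp: one_plus_exp_pos)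
  then have "(softplus c \<epsilon> has_real_derivative \<epsilon> * (E * (1 / \<epsilon>) / (1 + E) - 0)) (at t)"
    unfolding softplus_def by (intro DERIV_cmult DERIV_diff DERIV_const)
  moreover have "\<epsilon> * (E * (1 / \<epsilon>) / (1 + E) - 0) = E / (1 + E)" using assms by simp
  moreover have "logistic c \<epsilon> t = E / (1 + E)"
    using E by (simp add: logistic_def E_def[symmetric] field_simps)
  ultimately show ?thesis by (metis DERIV_cong)
qed

lemma logistic_deriv:
  assumes "\<epsilon> > 0"
  shows "(logistic c \<epsilon> has_real_derivative poly [:0, 1 / \<epsilon>, - 1 / \<epsilon>:] (logistic c \<epsilon> t)) (at t)"
proof -
  define E where "E = exp ((t - c) / \<epsilon>)"
  have E: "E > 0" by (simp add: E_def)
  have "((\<lambda>t. 1 + exp ((t - c) / \<epsilon>)) has_real_derivative E * (1 / \<epsilon>)) (at t)"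
    using assms unfolding E_def by (auto intro!: derivative_eq_intros)
  moreover have "1 + exp ((t - c) / \<epsilon>) \<noteq> 0" using E unfolding E_def by linarith
  ultimately have "((\<lambda>t. inverse (1 + exp ((t - c) / \<epsilon>))) has_real_derivative - (E * (1 / \<epsilon>) * inverse ((1 + E) ^ Suc (Suc 0)))) (at t)"
    unfolding E_def by (rule DERIV_inverse_fun)
  then have "(logistic c \<epsilon> has_real_derivative 0 - - (E * (1 / \<epsilon>) * inverse ((1 + E) ^ Suc (Suc 0)))) (at t)"
    unfolding logistic_def divide_inverse mult_1_left by (intro DERIV_diff DERIV_const)
  moreover have "0 - - (E * (1 / \<epsilon>) * inverse ((1 + E) ^ Suc (Suc 0))) = poly [:0, 1 / \<epsilon>, - 1 / \<epsilon>:] (logistic c \<epsilon> t)"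
  proof -
    have l: "logistic c \<epsilon> t = E / (1 + E)"
      using E by (simp add: logistic_def E_def[symmetric] field_simps)
    have "1 - E / (1 + E) = 1 / (1 + E)" using E by (simp add: field_simps)
    then have A: "E / (1 + E) * (1 - E / (1 + E)) / \<epsilon> = E * (1 / \<epsilon>) * inverse ((1 + E) ^ Suc (Suc 0))"
      by (simp add: divide_inverse mult_ac)
    have P: "poly [:0, 1 / \<epsilon>, - 1 / \<epsilon>:] y = y * (1 - y) / \<epsilon>" for y
      by (simp add: algebra_simps diff_divide_distrib)
    show ?thesis unfolding l P A by simp
  qed
  ultimately show ?thesis by (rule DERIV_cong)
qed

lemma logistic_bounds: "0 \<le> logistic c \<epsilon> t" "logistic c \<epsilon> t \<le> 1"
  using one_plus_exp_pos[of "(t - c) / \<epsilon>"] unfolding logistic_def by (auto simp: field_simps)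

text \<open>The gap to the positive part is at most ln 2; the cruder constant 1 follows from 2 \<le>
  exp 1.\<close>

lemma ln_one_plus_exp: "max 0 x \<le> ln (1 + exp x)" "ln (1 + exp x) \<le> max 0 x + 1" for x :: real
proof -
  have "ln (exp (max 0 x)) \<le> ln (1 + exp x)"
    using exp_gt_zero[of x] by (subst ln_le_cancel_iff) (auto simp: max_def one_plus_exp_pos)
  then show "max 0 x \<le> ln (1 + exp x)" by simp
  have "1 \<le> exp (max 0 x)" and "exp x \<le> exp (max 0 x)" by simp_all
  from add_mono[OF this] have "1 + exp x \<le> 2 * exp (max 0 x)" by linarith
  also have "\<dots> \<le> exp 1 * exp (max 0 x)"
    using exp_ge_add_one_self[of 1] by (intro mult_right_mono) auto
  finally have "1 + exp x \<le> exp (max 0 x + 1)" by (simp add: exp_add mult.commute)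
  then have "ln (1 + exp x) \<le> ln (exp (max 0 x + 1))"
    using one_plus_exp_pos[of x] by (subst ln_le_cancel_iff) auto
  then show "ln (1 + exp x) \<le> max 0 x + 1" by simp
qed

text \<open>Each logarithm exceeds its positive part by an amount between 0 and 1, and
  \<open>c \<ge> 0\<close> makes the positive part of the subtracted one vanish; the two errors
  partly cancel and are scaled by \<epsilon>.\<close>

lemma softplus_approx:
  assumes "\<epsilon> > 0" "c \<ge> 0"
  shows "\<bar>softplus c \<epsilon> t - max 0 (t - c)\<bar> \<le> \<epsilon>"
proof -
  let ?x = "(t - c) / \<epsilon>" and ?y = "- c / \<epsilon>"
  have "max 0 ?y = 0" using assms by (simp add: max_def divide_le_0_iff)
  then have "\<bar>ln (1 + exp ?x) - ln (1 + exp ?y) - max 0 ?x\<bar> \<le> 1"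
    using ln_one_plus_exp[of ?x] ln_one_plus_exp[of ?y] by linarith
  then have "\<epsilon> * \<bar>ln (1 + exp ?x) - ln (1 + exp ?y) - max 0 ?x\<bar> \<le> \<epsilon> * 1"
    using assms(1) by (intro mult_left_mono) auto
  moreover have "\<epsilon> * max 0 ?x = max 0 (t - c)"
    using assms(1) by (auto simp: max_def field_simps)
  then have "softplus c \<epsilon> t - max 0 (t - c) = \<epsilon> * (ln (1 + exp ?x) - ln (1 + exp ?y) - max 0 ?x)"
    unfolding softplus_def by (simp add: right_diff_distrib)
  ultimately show ?thesis using assms(1) by (simp add: abs_mult)
qed

section \<open>The sub-Markov property of the resolvents\<close>

context dirichlet_system
begin

abbreviation "cf u n \<equiv> ip M u (e n)"

text \<open>Here \<open>z\<close> is the resolvent of \<open>h\<close>, so \<alpha> (h - z) is the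
  Dirichlet Laplacian of z. Testing with p = (z - c)^+ gives a nonnegative pairing of h - z with p,
  while h - z \<le> -p wherever p > 0; both together force p = 0.\<close>

lemma submarkov:
  assumes h: "h \<in> Lp M 2" "AE x in M. h x \<le> c" "c \<ge> 0" and \<alpha>: "\<alpha> > 0"
    and z: "z \<in> Lp M 2" "\<And>n. cf z n = \<alpha> / (\<alpha> + lam n) * cf h n"
  shows "AE x in M. z x \<le> c"
proof -
  define d where "d x = h x - z x" for x
  have d: "d \<in> Lp M 2" unfolding d_def using h(1) z(1) by (rule L2_diff)
  have cfd: "cf d n = cf h n - cf z n" for n
    unfolding d_def using h z by (intro ip_diff_left) auto
  \<comment> \<open>The resolvent equation, read off in coefficients.\<close>
  have lamd: "cf z n * lam n = \<alpha> * cf d n" for n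
  proof -
    have "cf z n * (\<alpha> + lam n) = \<alpha> * cf h n"
      using lam_pos[of n] \<alpha> by (simp add: z(2))
    then show ?thesis unfolding cfd by (simp add: algebra_simps)
  qed
  define p where "p x = max 0 (z x - c)" for x
  have [measurable]: "z \<in> borel_measurable M" using L2_measurable[OF z(1)] .
  have "p \<in> borel_measurable M" unfolding p_def by measurable
  then have p: "p \<in> Lp M 2"
    by (rule L2_bound[OF _ z(1)]) (use \<open>c \<ge> 0\<close> in \<open>auto simp: p_def\<close>)
  \<comment> \<open>\<open>energy_monotone\<close> handles \<open>softplus\<close> of partial sums.
    After the limit in \<open>k\<close>, passing from \<open>softplus\<close> to the positive part
    costs \<epsilon> times the L^1 norm of \<open>d\<close>.\<close>
  have key: "- \<epsilon> * (LINT x|M. \<bar>d x\<bar>) \<le> ip M d p" if "\<epsilon> > 0" for \<epsilon>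
  proof -
    let ?\<phi> = "softplus c \<epsilon>"
    note der = softplus_deriv[OF that, of c]
    have lip: "\<bar>?\<phi> s - ?\<phi> t\<bar> \<le> \<bar>s - t\<bar>" for s t
      using field_differentiable_bound[of UNIV ?\<phi> "logistic c \<epsilon>" 1 s t] der logistic_bounds by auto
    have cont: "continuous_on UNIV ?\<phi>"
      using der by (meson DERIV_isCont continuous_at_imp_continuous_on)
    have \<phi>0: "?\<phi> 0 = 0" by (simp add: softplus_def)
    have L: "(\<lambda>x. ?\<phi> (u x)) \<in> Lp M 2" if "u \<in> Lp M 2" for u
      by (rule L2_contraction[OF that cont lip \<phi>0])
    have pos: "0 \<le> ip M (psum (cf d) k) (\<lambda>x. ?\<phi> (psum (cf z) k x))" for k
    proof -
      have "0 \<le> (\<Sum>n<k. cf z n * (lam n * ip M (e n) (\<lambda>x. ?\<phi> (psum (cf z) k x))))"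
        by (rule energy_monotone[OF der logistic_bounds \<phi>0 C_k_compose_ode[OF der logistic_deriv[OF that]]])
      also have "\<dots> = \<alpha> * ip M (psum (cf d) k) (\<lambda>x. ?\<phi> (psum (cf z) k x))"
        by (simp add: ip_psum_left[OF L[OF psum_L2]] sum_distrib_left mult.assoc[symmetric] lamd)
      finally show ?thesis using \<alpha> by (simp add: zero_le_mult_iff)
    qed
    have "(\<lambda>k. nrm M (\<lambda>x. ?\<phi> (z x) - ?\<phi> (psum (cf z) k x))) \<longlonglongrightarrow> 0"
      by (rule tendsto_sandwich[OF _ _ tendsto_const expansion[OF z(1)]]; rule always_eventually; rule allI)
        (rule nrm_nonneg, rule nrm_contraction[OF z(1) psum_L2 lip])
    then have "(\<lambda>k. ip M (psum (cf d) k) (\<lambda>x. ?\<phi> (psum (cf z) k x))) \<longlonglongrightarrow> ip M d (\<lambda>x. ?\<phi> (z x))"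
      by (intro ip_tendsto d L z(1) psum_L2 expansion)
    then have "0 \<le> ip M d (\<lambda>x. ?\<phi> (z x))"
      using pos by (intro LIMSEQ_le_const) auto
    also have "\<dots> \<le> (LINT x|M. d x * p x + \<epsilon> * \<bar>d x\<bar>)"
      unfolding ip_def
    proof (rule integral_mono)
      show "integrable M (\<lambda>x. d x \<bullet> ?\<phi> (z x))" by (rule L2_inner_integrable[OF d L[OF z(1)]])
      show "integrable M (\<lambda>x. d x * p x + \<epsilon> * \<bar>d x\<bar>)"
        using L2_inner_integrable[OF d p] L2_integrable(1)[OF d] by simp
      fix x
      have "d x * (?\<phi> (z x) - p x) \<le> \<bar>d x\<bar> * \<bar>?\<phi> (z x) - p x\<bar>"
        using abs_ge_self[of "d x * (?\<phi> (z x) - p x)"] by (simp add: abs_mult)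
      also have "\<dots> \<le> \<bar>d x\<bar> * \<epsilon>"
        unfolding p_def using softplus_approx[OF that \<open>c \<ge> 0\<close>] by (intro mult_left_mono) auto
      finally show "d x \<bullet> ?\<phi> (z x) \<le> d x * p x + \<epsilon> * \<bar>d x\<bar>" by (simp add: algebra_simps)
    qed
    also have "\<dots> = ip M d p + \<epsilon> * (LINT x|M. \<bar>d x\<bar>)"
      using L2_inner_integrable[OF d p] L2_integrable(1)[OF d] by (simp add: ip_def)
    finally show ?thesis by simp
  qed
  have "0 \<le> ip M d p" by (rule nonneg_if_ge_neg_mult[OF key])
  moreover have "ip M p p + ip M d p \<le> 0"
  proof -
    have "ip M p p + ip M d p = (LINT x|M. p x * p x + d x * p x)"
      using L2_inner_integrable[OF p p] L2_inner_integrable[OF d p] by (simp add: ip_def)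
    also have "\<dots> \<le> (LINT x|M. 0)"
    proof (rule integral_mono_AE)
      show "integrable M (\<lambda>x. p x * p x + d x * p x)"
        using L2_inner_integrable[OF p p] L2_inner_integrable[OF d p] by simp
      show "AE x in M. p x * p x + d x * p x \<le> 0"
        using h(2)
      proof eventually_elim
        case (elim x)
        \<comment> \<open>Where \<open>z x > c\<close>, the bound \<open>h x \<le> c\<close> gives
          \<open>d x \<le> c - z x = - p x\<close>.\<close>
        have "p x * (p x + d x) \<le> 0"
          using elim by (auto simp: p_def d_def max_def mult_nonneg_nonpos)
        then show ?case by (simp add: algebra_simps)
      qed
    qed simp
    finally show ?thesis by simp
  qed
  ultimately have "ip M p p = 0" using ip_nonneg[of M p] by linarith
  then have "AE x in M. p x = 0" by (rule L2_eq_0[OF p])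
  then show ?thesis by eventually_elim (auto simp: p_def max_def split: if_splits)
qed

section \<open>Truncation lowers the fractional energy\<close>

text \<open>The multipliers lie between 0 and 1, so square summability of the coefficients is
  preserved and the spectral series defines the resolvent.\<close>

lemma resolvent_exists:
  assumes "h \<in> Lp M 2" "\<alpha> > 0"
  obtains z where "z \<in> Lp M 2" "\<And>n. cf z n = \<alpha> / (\<alpha> + lam n) * cf h n"
proof -
  have "summable (\<lambda>n. (\<alpha> / (\<alpha> + lam n) * cf h n)\<^sup>2)"
  proof (rule summable_comparison_test'[OF Bessel[OF assms(1)]])
    fix n
    have "\<alpha> / (\<alpha> + lam n) \<le> 1" "0 \<le> \<alpha> / (\<alpha> + lam n)" using assms(2) lam_pos[of n] by auto
    then have "(\<alpha> / (\<alpha> + lam n))\<^sup>2 \<le> 1" by (rule power_le_one[rotated])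
    then have "(\<alpha> / (\<alpha> + lam n))\<^sup>2 * (cf h n)\<^sup>2 \<le> 1 * (cf h n)\<^sup>2" by (rule mult_right_mono) simp
    then show "norm ((\<alpha> / (\<alpha> + lam n) * cf h n)\<^sup>2) \<le> (cf h n)\<^sup>2" by (simp only: power_mult_distrib) simp
  qed
  from series_L2[OF this] show ?thesis using that by blast
qed

lemma trunc_L2:
  assumes "u \<in> Lp M 2" "0 \<le> k"
  shows "(\<lambda>x. trunc k l (u x)) \<in> Lp M 2"
  by (rule L2_bound[OF _ assms(1)]) (use assms L2_measurable[OF assms(1)] in \<open>auto simp: trunc_def\<close>)

text \<open>Write R for the resolvent and d = a + y with a = min u k, y = (u - l)^+. Where v > 0 one
  has a = k, and where y > 0 one has v = l - k, so the pairing of d with v is k times the integral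
  of v plus l - k times that of y. The sub-Markov bounds R a \<le> k and R v \<le> l - k show that
  the pairing of R d with v is no larger.\<close>

lemma truncation_resolvent:
  assumes u: "u \<in> Lp M 2" and k: "0 \<le> k" "k < l" and \<alpha>: "\<alpha> > 0"
    and v: "v = (\<lambda>x. trunc k l (u x))" and d: "d = (\<lambda>x. u x - v x)"
  shows "0 \<le> (\<Sum>n. lam n / (\<alpha> + lam n) * (cf d n * cf v n))"
    "summable (\<lambda>n. lam n / (\<alpha> + lam n) * (cf d n * cf v n))"
proof -
  have [measurable]: "u \<in> borel_measurable M" using L2_measurable[OF u] .
  define a where "a x = min (u x) k" for x
  define y where "y x = max 0 (u x - l)" for x
  have vL: "v \<in> Lp M 2" unfolding v by (rule trunc_L2[OF u k(1)])
  have "a \<in> borel_measurable M" "y \<in> borel_measurable M" unfolding a_def y_def by measurable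
  then have aL: "a \<in> Lp M 2" and yL: "y \<in> Lp M 2"
    using L2_bound[OF _ u, of a] L2_bound[OF _ u, of y] k by (auto simp: a_def y_def)
  have day: "d = (\<lambda>x. a x + y x)"
    using k by (auto simp: d v a_def y_def trunc_def fun_eq_iff max_def min_def)
  have dL: "d \<in> Lp M 2" unfolding day using aL yL by (rule L2_add)
  obtain za where za: "za \<in> Lp M 2" "\<And>n. cf za n = \<alpha> / (\<alpha> + lam n) * cf a n"
    using resolvent_exists[OF aL \<alpha>] by blast
  obtain zv where zv: "zv \<in> Lp M 2" "\<And>n. cf zv n = \<alpha> / (\<alpha> + lam n) * cf v n"
    using resolvent_exists[OF vL \<alpha>] by blast
  have za_le: "AE x in M. za x \<le> k"
    by (rule submarkov[OF aL _ k(1) \<alpha> za]) (simp add: a_def)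
  have zv_le: "AE x in M. zv x \<le> l - k"
    by (rule submarkov[OF vL _ _ \<alpha> zv]) (use k in \<open>auto simp: v trunc_def\<close>)
  have "(\<lambda>n. cf d n * cf v n) sums ip M d v" by (rule Parseval[OF dL vL])
  moreover have "(\<lambda>n. cf za n * cf v n) sums ip M za v" by (rule Parseval[OF za(1) vL])
  moreover have "(\<lambda>n. cf zv n * cf y n) sums ip M zv y" by (rule Parseval[OF zv(1) yL])
  ultimately have "(\<lambda>n. cf d n * cf v n - cf za n * cf v n - cf zv n * cf y n) sums (ip M d v - ip M za v - ip M zv y)"
    by (intro sums_diff)
  \<comment> \<open>In the last product R acts on \<open>v\<close> instead of \<open>y\<close>: this
    is its self-adjointness, immediate in coefficients.\<close>
  moreover have "cf d n * cf v n - cf za n * cf v n - cf zv n * cf y n = lam n / (\<alpha> + lam n) * (cf d n * cf v n)" for n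
  proof -
    have "cf d n = cf a n + cf y n" unfolding day using aL yL by (intro ip_add_left) auto
    moreover have "lam n / (\<alpha> + lam n) = 1 - \<alpha> / (\<alpha> + lam n)"
      using lam_pos[of n] \<alpha> by (simp add: field_simps)
    ultimately show ?thesis by (simp only: za(2) zv(2)) (simp only: algebra_simps)
  qed
  ultimately have sums: "(\<lambda>n. lam n / (\<alpha> + lam n) * (cf d n * cf v n)) sums (ip M d v - ip M za v - ip M zv y)"
    by simp
  have "ip M d v = k * (LINT x|M. v x) + (l - k) * (LINT x|M. y x)"
  proof -
    have "d x * v x = k * v x + (l - k) * y x" for x
      using k by (auto simp: d v y_def trunc_def max_def min_def algebra_simps)
    then show ?thesis
      using L2_integrable(1)[OF vL] L2_integrable(1)[OF yL] by (simp add: ip_def)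
  qed
  moreover have "ip M za v \<le> k * (LINT x|M. v x)"
  proof -
    have "ip M za v \<le> (LINT x|M. k * v x)"
      unfolding ip_def
    proof (rule integral_mono_AE)
      show "integrable M (\<lambda>x. za x \<bullet> v x)" by (rule L2_inner_integrable[OF za(1) vL])
      show "integrable M (\<lambda>x. k * v x)" using L2_integrable(1)[OF vL] by simp
      show "AE x in M. za x \<bullet> v x \<le> k * v x"
        using za_le by eventually_elim (simp add: v trunc_def mult_right_mono)
    qed
    then show ?thesis by simp
  qed
  moreover have "ip M zv y \<le> (l - k) * (LINT x|M. y x)"
  proof -
    have "ip M zv y \<le> (LINT x|M. (l - k) * y x)"
      unfolding ip_def
    proof (rule integral_mono_AE)
      show "integrable M (\<lambda>x. zv x \<bullet> y x)" by (rule L2_inner_integrable[OF zv(1) yL])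
      show "integrable M (\<lambda>x. (l - k) * y x)" using L2_integrable(1)[OF yL] by simp
      show "AE x in M. zv x \<bullet> y x \<le> (l - k) * y x"
        using zv_le by eventually_elim (simp add: y_def mult_right_mono)
    qed
    then show ?thesis by simp
  qed
  ultimately have "0 \<le> ip M d v - ip M za v - ip M zv y" by linarith
  then show "0 \<le> (\<Sum>n. lam n / (\<alpha> + lam n) * (cf d n * cf v n))"
    using sums_unique[OF sums] by simp
  show "summable (\<lambda>n. lam n / (\<alpha> + lam n) * (cf d n * cf v n))"
    using sums by (rule sums_summable)
qed

end

section \<open>Fractional powers as integrals of resolvent multipliers\<close>

definition powr_kernel :: "real \<Rightarrow> real \<Rightarrow> real \<Rightarrow> real" where
  "powr_kernel s \<mu> \<alpha> = (if \<alpha> > 0 then \<alpha> powr (s - 1) * (\<mu> / (\<alpha> + \<mu>)) else 0)"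

lemma powr_kernel_measurable [measurable]: "powr_kernel s \<mu> \<in> borel_measurable borel"
  unfolding powr_kernel_def by measurable

text \<open>Substitution of \<mu> \<alpha> for \<alpha>. As the kernel is zero for \<alpha> \<le> 0,
  the affine change of variables on the whole line applies.\<close>

lemma powr_kernel_scale:
  assumes "\<mu> > 0"
  shows "(\<integral>\<^sup>+\<alpha>. ennreal (powr_kernel s \<mu> \<alpha>) \<partial>lborel)
    = ennreal (\<mu> powr s) * (\<integral>\<^sup>+\<alpha>. ennreal (powr_kernel s 1 \<alpha>) \<partial>lborel)"
proof -
  have "(\<integral>\<^sup>+\<alpha>. ennreal (powr_kernel s \<mu> \<alpha>) \<partial>lborel) = ennreal \<bar>\<mu>\<bar> * (\<integral>\<^sup>+\<alpha>. ennreal (powr_kernel s \<mu> (0 + \<mu> * \<alpha>)) \<partial>lborel)"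
    using assms by (intro nn_integral_real_affine) auto
  also have "\<dots> = (\<integral>\<^sup>+\<alpha>. ennreal \<bar>\<mu>\<bar> * ennreal (powr_kernel s \<mu> (0 + \<mu> * \<alpha>)) \<partial>lborel)"
    by (rule nn_integral_cmult[symmetric]) simp
  also have "\<dots> = (\<integral>\<^sup>+\<alpha>. ennreal (\<mu> powr s) * ennreal (powr_kernel s 1 \<alpha>) \<partial>lborel)"
  proof (rule nn_integral_cong)
    fix \<alpha> :: real
    have "\<mu> * powr_kernel s \<mu> (\<mu> * \<alpha>) = \<mu> powr s * powr_kernel s 1 \<alpha>"
    proof (cases "\<alpha> > 0")
      case True
      have "\<mu> * \<alpha> + \<mu> = \<mu> * (\<alpha> + 1)" by (simp add: distrib_left)
      then have "\<mu> / (\<mu> * \<alpha> + \<mu>) = 1 / (\<alpha> + 1)" using assms by simp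
      moreover have "\<mu> * (\<mu> * \<alpha>) powr (s - 1) = \<mu> powr s * \<alpha> powr (s - 1)"
        using assms True by (simp add: powr_mult powr_diff)
      ultimately show ?thesis using assms True by (simp add: powr_kernel_def zero_less_mult_iff)
    next
      case False
      then show ?thesis using assms by (simp add: powr_kernel_def zero_less_mult_iff)
    qed
    then show "ennreal \<bar>\<mu>\<bar> * ennreal (powr_kernel s \<mu> (0 + \<mu> * \<alpha>)) = ennreal (\<mu> powr s) * ennreal (powr_kernel s 1 \<alpha>)"
      using assms by (simp flip: ennreal_mult')
  qed
  also have "\<dots> = ennreal (\<mu> powr s) * (\<integral>\<^sup>+\<alpha>. ennreal (powr_kernel s 1 \<alpha>) \<partial>lborel)"
    by (rule nn_integral_cmult) simp
  finally show ?thesis .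
qed

text \<open>\<open>s > 0\<close> gives integrability at 0 through \<alpha> powr (s - 1), and
  \<open>s < 1\<close> gives it at infinity through \<alpha> powr (s - 2).\<close>

lemma powr_kernel_finite:
  assumes "0 < s" "s < 1"
  shows "(\<integral>\<^sup>+\<alpha>. ennreal (powr_kernel s 1 \<alpha>) \<partial>lborel) < \<infinity>"
proof -
  have "(\<integral>\<^sup>+\<alpha>. ennreal (powr_kernel s 1 \<alpha>) \<partial>lborel)
    \<le> (\<integral>\<^sup>+\<alpha>. ennreal (\<alpha> powr (s - 1)) * indicator {0..1} \<alpha> + ennreal (\<alpha> powr (s - 2)) * indicator {1..} \<alpha> \<partial>lborel)"
  proof (rule nn_integral_mono)
    fix \<alpha> :: real
    consider "\<alpha> \<le> 0" | "0 < \<alpha>" "\<alpha> \<le> 1" | "1 < \<alpha>" by linarith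
    then show "ennreal (powr_kernel s 1 \<alpha>) \<le> ennreal (\<alpha> powr (s - 1)) * indicator {0..1} \<alpha> + ennreal (\<alpha> powr (s - 2)) * indicator {1..} \<alpha>"
    proof cases
      case 1
      then show ?thesis by (simp add: powr_kernel_def)
    next
      case 2
      have "powr_kernel s 1 \<alpha> \<le> \<alpha> powr (s - 1)"
        using 2 by (simp add: powr_kernel_def divide_le_eq mult_left_le)
      then have "ennreal (powr_kernel s 1 \<alpha>) \<le> ennreal (\<alpha> powr (s - 1))" by (rule ennreal_leI)
      then show ?thesis using 2 by (simp add: add_increasing2)
    next
      case 3
      have "\<alpha> powr (s - 1) = \<alpha> powr (s - 2) * \<alpha>"
        using 3 by (simp add: powr_diff field_simps power2_eq_square)
      then have "powr_kernel s 1 \<alpha> \<le> \<alpha> powr (s - 2)"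
        using 3 by (simp add: powr_kernel_def divide_le_eq mult_left_le)
      then have "ennreal (powr_kernel s 1 \<alpha>) \<le> ennreal (\<alpha> powr (s - 2))" by (rule ennreal_leI)
      then show ?thesis using 3 by (simp add: add_increasing)
    qed
  qed
  also have "\<dots> = (\<integral>\<^sup>+\<alpha>. ennreal (\<alpha> powr (s - 1)) * indicator {0..1} \<alpha> \<partial>lborel) + (\<integral>\<^sup>+\<alpha>. ennreal (\<alpha> powr (s - 2)) * indicator {1..} \<alpha> \<partial>lborel)"
    by (rule nn_integral_add) auto
  also have "\<dots> < \<infinity>"
  proof -
    have "((\<lambda>\<alpha>. \<alpha> powr (s - 1)) has_integral (1 powr (s - 1 + 1) / (s - 1 + 1))) {0..1::real}"
      using assms by (intro has_integral_powr_from_0) auto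
    from nn_integral_has_integral_lebesgue'[OF _ this]
    have "(\<integral>\<^sup>+\<alpha>. ennreal (\<alpha> powr (s - 1)) * indicator {0..1} \<alpha> \<partial>lborel) < \<infinity>" by simp
    moreover have "((\<lambda>\<alpha>. \<alpha> powr (s - 2)) has_integral - (1 powr (s - 2 + 1)) / (s - 2 + 1)) {1::real..}"
      using assms by (intro has_integral_powr_to_inf) auto
    from nn_integral_has_integral_lebesgue'[OF _ this]
    have "(\<integral>\<^sup>+\<alpha>. ennreal (\<alpha> powr (s - 2)) * indicator {1..} \<alpha> \<partial>lborel) < \<infinity>" by simp
    ultimately show ?thesis by simp
  qed
  finally show ?thesis .
qed

text \<open>A lower bound on [1, 2] suffices. Positivity and finiteness of this integral are what
  allow it to be cancelled from an inequality.\<close>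

lemma powr_kernel_pos:
  assumes "0 < s" "s < 1"
  shows "0 < (\<integral>\<^sup>+\<alpha>. ennreal (powr_kernel s 1 \<alpha>) \<partial>lborel)"
proof -
  have "0 < ennreal (2 powr (s - 1) / 3)" by simp
  also have "\<dots> = (\<integral>\<^sup>+\<alpha>. ennreal (2 powr (s - 1) / 3) * indicator {1..2::real} \<alpha> \<partial>lborel)"
    by (subst nn_integral_cmult_indicator) auto
  also have "\<dots> \<le> (\<integral>\<^sup>+\<alpha>. ennreal (powr_kernel s 1 \<alpha>) \<partial>lborel)"
  proof (rule nn_integral_mono)
    fix \<alpha> :: real
    have "2 powr (s - 1) / 3 \<le> powr_kernel s 1 \<alpha>" if "1 \<le> \<alpha>" "\<alpha> \<le> 2"
    proof -
      have "2 powr (s - 1) \<le> \<alpha> powr (s - 1)" using that assms by (intro powr_mono2') auto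
      moreover have "1 / 3 \<le> 1 / (\<alpha> + 1)" using that by (simp add: field_simps)
      ultimately have "2 powr (s - 1) * (1 / 3) \<le> \<alpha> powr (s - 1) * (1 / (\<alpha> + 1))" by (intro mult_mono) auto
      then show ?thesis using that by (simp add: powr_kernel_def)
    qed
    then show "ennreal (2 powr (s - 1) / 3) * indicator {1..2::real} \<alpha> \<le> ennreal (powr_kernel s 1 \<alpha>)"
      by (auto simp: indicator_def intro: ennreal_leI)
  qed
  finally show ?thesis .
qed

text \<open>The identity \<open>\<mu> powr s = C * (\<integral>\<alpha>. \<alpha> powr (s - 1) * (\<mu> / (\<alpha> + \<mu>)))\<close> passes inequalities between
  the resolvent forms on to the fractional form.\<close>

lemma fractional_from_resolvent:
  fixes lam a b :: "nat \<Rightarrow> real"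
  assumes s: "0 < s" "s < 1" and lam: "\<And>n. lam n > 0" and ab: "\<And>n. 0 \<le> a n" "\<And>n. 0 \<le> b n"
    and le: "\<And>\<alpha>. \<alpha> > 0 \<Longrightarrow> (\<Sum>n. ennreal (lam n / (\<alpha> + lam n) * a n)) \<le> (\<Sum>n. ennreal (lam n / (\<alpha> + lam n) * b n))"
    and b: "summable (\<lambda>n. lam n powr s * b n)"
  shows "summable (\<lambda>n. lam n powr s * a n)" "(\<Sum>n. lam n powr s * a n) \<le> (\<Sum>n. lam n powr s * b n)"
proof -
  define K where "K = (\<integral>\<^sup>+\<alpha>. ennreal (powr_kernel s 1 \<alpha>) \<partial>lborel)"
  have K: "0 < K" "K < \<infinity>" unfolding K_def using powr_kernel_pos[OF s] powr_kernel_finite[OF s] by auto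
  \<comment> \<open>Sum and integral are exchanged among extended nonnegative numbers, so
    summability of the first series can be a conclusion.\<close>
  have int: "(\<integral>\<^sup>+\<alpha>. (\<Sum>n. ennreal (powr_kernel s (lam n) \<alpha>) * ennreal (c n)) \<partial>lborel) = (\<Sum>n. ennreal (lam n powr s * c n)) * K"
    if "\<And>n. 0 \<le> c n" for c
  proof -
    have "(\<integral>\<^sup>+\<alpha>. (\<Sum>n. ennreal (powr_kernel s (lam n) \<alpha>) * ennreal (c n)) \<partial>lborel)
        = (\<Sum>n. \<integral>\<^sup>+\<alpha>. ennreal (powr_kernel s (lam n) \<alpha>) * ennreal (c n) \<partial>lborel)"
      by (rule nn_integral_suminf) simp
    also have "\<dots> = (\<Sum>n. ennreal (lam n powr s * c n) * K)"
    proof (rule suminf_cong)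
      fix n
      show "(\<integral>\<^sup>+\<alpha>. ennreal (powr_kernel s (lam n) \<alpha>) * ennreal (c n) \<partial>lborel) = ennreal (lam n powr s * c n) * K"
        using that[of n]
        by (subst nn_integral_multc) (auto simp: powr_kernel_scale[OF lam] K_def[symmetric] ennreal_mult mult_ac)
    qed
    also have "\<dots> = (\<Sum>n. ennreal (lam n powr s * c n)) * K" by (rule ennreal_suminf_multc)
    finally show ?thesis .
  qed
  have "(\<integral>\<^sup>+\<alpha>. (\<Sum>n. ennreal (powr_kernel s (lam n) \<alpha>) * ennreal (a n)) \<partial>lborel)
      \<le> (\<integral>\<^sup>+\<alpha>. (\<Sum>n. ennreal (powr_kernel s (lam n) \<alpha>) * ennreal (b n)) \<partial>lborel)"
  proof (rule nn_integral_mono)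
    fix \<alpha> :: real
    show "(\<Sum>n. ennreal (powr_kernel s (lam n) \<alpha>) * ennreal (a n)) \<le> (\<Sum>n. ennreal (powr_kernel s (lam n) \<alpha>) * ennreal (b n))"
    proof (cases "\<alpha> > 0")
      case True
      have eq: "ennreal (powr_kernel s (lam n) \<alpha>) * ennreal (c n) = ennreal (\<alpha> powr (s - 1)) * ennreal (lam n / (\<alpha> + lam n) * c n)"
        if "0 \<le> c n" for c n
        using True lam[of n] that by (simp add: powr_kernel_def mult.assoc flip: ennreal_mult)
      show ?thesis
        using ab le[OF True] by (simp add: eq ennreal_suminf_cmult mult_left_mono)
    qed (simp add: powr_kernel_def)
  qed
  then have "(\<Sum>n. ennreal (lam n powr s * a n)) * K \<le> (\<Sum>n. ennreal (lam n powr s * b n)) * K"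
    unfolding int[OF ab(1)] int[OF ab(2)] .
  then have *: "K * (\<Sum>n. ennreal (lam n powr s * a n)) \<le> K * (\<Sum>n. ennreal (lam n powr s * b n))"
    unfolding mult.commute[of K] .
  have "K \<noteq> 0" "K \<noteq> top" using K by auto
  then have le': "(\<Sum>n. ennreal (lam n powr s * a n)) \<le> (\<Sum>n. ennreal (lam n powr s * b n))"
    by (rule ennreal_mult_le_mult_iff[THEN iffD1]) (rule *)
  have bfin: "(\<Sum>n. ennreal (lam n powr s * b n)) = ennreal (\<Sum>n. lam n powr s * b n)"
    using b ab(2) by (intro suminf_ennreal2) auto
  show sa: "summable (\<lambda>n. lam n powr s * a n)"
    using le' unfolding bfin by (intro summable_suminf_not_top) (auto simp: ab(1) top_unique)
  have "(\<Sum>n. ennreal (lam n powr s * a n)) = ennreal (\<Sum>n. lam n powr s * a n)"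
    using sa ab(1) by (intro suminf_ennreal2) auto
  with le' show "(\<Sum>n. lam n powr s * a n) \<le> (\<Sum>n. lam n powr s * b n)"
    unfolding bfin using b ab(2) by (simp add: suminf_nonneg ennreal_le_iff)
qed

section \<open>The fractional form under truncation\<close>

context dirichlet_system
begin

lemma coef_eq: "coef \<Omega> e u n = cf u n"
  by (simp add: coef_def ip_def)

lemma Hr_iff: "u \<in> Hr \<Omega> lam e r \<longleftrightarrow> u \<in> Lp M 2 \<and> summable (\<lambda>n. lam n powr r * (cf u n)\<^sup>2)"
  by (simp add: Hr_def coef_eq)

text \<open>With d = u - v, a nonnegative mixed term amounts to E v v + E d d \<le> E u u. In this
  form the resolvent inequality passes to the power s; returning to the mixed term gives E u v = E v
  v + E d v \<ge> E v v.\<close>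

lemma truncation_energy:
  assumes s: "0 < s" "s < 1" and u: "u \<in> Hr \<Omega> lam e s" and k: "0 \<le> k" "k < l"
    and v: "v = (\<lambda>x. trunc k l (u x))"
  shows "v \<in> Hr \<Omega> lam e s"
    "summable (\<lambda>n. lam n powr s * (cf u n * cf v n))"
    "(\<Sum>n. lam n powr s * (cf v n)\<^sup>2) \<le> (\<Sum>n. lam n powr s * (cf u n * cf v n))"
proof -
  have uL: "u \<in> Lp M 2" and us: "summable (\<lambda>n. lam n powr s * (cf u n)\<^sup>2)" using u by (auto simp: Hr_iff)
  have vL: "v \<in> Lp M 2" unfolding v by (rule trunc_L2[OF uL k(1)])
  define d where "d = (\<lambda>x. u x - v x)"
  have dL: "d \<in> Lp M 2" unfolding d_def using uL vL by (rule L2_diff)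
  have cd: "cf d n = cf u n - cf v n" for n unfolding d_def using uL vL by (intro ip_diff_left) auto
  \<comment> \<open>Expanding the square of v + d and dropping the mixed term, which is nonnegative
    by \<open>truncation_resolvent\<close>.\<close>
  have le: "(\<Sum>n. ennreal (lam n / (\<alpha> + lam n) * ((cf v n)\<^sup>2 + (cf d n)\<^sup>2)))
      \<le> (\<Sum>n. ennreal (lam n / (\<alpha> + lam n) * (cf u n)\<^sup>2))" if \<alpha>: "\<alpha> > 0" for \<alpha>
  proof -
    let ?w = "\<lambda>n. lam n / (\<alpha> + lam n)"
    have w: "0 \<le> ?w n" "?w n \<le> 1" for n using lam_pos[of n] \<alpha> by auto
    have sm: "summable (\<lambda>n. ?w n * (cf g n)\<^sup>2)" if "g \<in> Lp M 2" for g
    proof (rule summable_comparison_test'[OF Bessel[OF that]])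
      show "norm (?w n * (cf g n)\<^sup>2) \<le> (cf g n)\<^sup>2" for n
      proof -
        have "0 \<le> ?w n * (cf g n)\<^sup>2" using w(1)[of n] by (intro mult_nonneg_nonneg) auto
        then show ?thesis
          using mult_right_mono[OF w(2)[of n] zero_le_power2[of "cf g n"]]
          by (simp only: real_norm_def abs_of_nonneg mult_1_left)
      qed
    qed
    have s1: "summable (\<lambda>n. ?w n * ((cf v n)\<^sup>2 + (cf d n)\<^sup>2))"
      using summable_add[OF sm[OF vL] sm[OF dL]] by (simp add: distrib_left)
    note t = truncation_resolvent[OF uL k \<alpha> v d_def]
    have "(\<Sum>n. ?w n * ((cf v n)\<^sup>2 + (cf d n)\<^sup>2)) \<le> (\<Sum>n. ?w n * ((cf v n)\<^sup>2 + (cf d n)\<^sup>2)) + 2 * (\<Sum>n. ?w n * (cf d n * cf v n))"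
      using t(1) by linarith
    also have "\<dots> = (\<Sum>n. ?w n * ((cf v n)\<^sup>2 + (cf d n)\<^sup>2) + 2 * (?w n * (cf d n * cf v n)))"
      unfolding suminf_add[OF s1 summable_mult[OF t(2)], symmetric] suminf_mult[OF t(2)] ..
    also have "\<dots> = (\<Sum>n. ?w n * (cf u n)\<^sup>2)"
      by (rule suminf_cong) (simp add: cd algebra_simps power2_eq_square)
    finally have "ennreal (\<Sum>n. ?w n * ((cf v n)\<^sup>2 + (cf d n)\<^sup>2)) \<le> ennreal (\<Sum>n. ?w n * (cf u n)\<^sup>2)"
      by (rule ennreal_leI)
    moreover have "(\<Sum>n. ennreal (?w n * ((cf v n)\<^sup>2 + (cf d n)\<^sup>2))) = ennreal (\<Sum>n. ?w n * ((cf v n)\<^sup>2 + (cf d n)\<^sup>2))"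
      by (intro suminf_ennreal2 s1 mult_nonneg_nonneg w) simp
    moreover have "(\<Sum>n. ennreal (?w n * (cf u n)\<^sup>2)) = ennreal (\<Sum>n. ?w n * (cf u n)\<^sup>2)"
      by (intro suminf_ennreal2 sm[OF uL] mult_nonneg_nonneg w) simp
    ultimately show ?thesis by (simp only:)
  qed
  note f = fractional_from_resolvent[OF s lam_pos _ _ le us]
  have sa: "summable (\<lambda>n. lam n powr s * ((cf v n)\<^sup>2 + (cf d n)\<^sup>2))"
    and le2: "(\<Sum>n. lam n powr s * ((cf v n)\<^sup>2 + (cf d n)\<^sup>2)) \<le> (\<Sum>n. lam n powr s * (cf u n)\<^sup>2)"
    using f by auto
  have sv: "summable (\<lambda>n. lam n powr s * (cf v n)\<^sup>2)"
    by (rule summable_comparison_test'[OF sa]) (simp add: mult_left_mono)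
  show "v \<in> Hr \<Omega> lam e s" using vL sv by (simp add: Hr_iff)
  \<comment> \<open>Polarisation: the bracket divided by 2 is the mixed term of v and d, and u = v +
    d.\<close>
  have eq: "lam n powr s * (cf u n * cf v n) = (lam n powr s * (cf u n)\<^sup>2 - lam n powr s * ((cf v n)\<^sup>2 + (cf d n)\<^sup>2)) / 2
      + lam n powr s * (cf v n)\<^sup>2" for n
    by (simp add: cd power2_eq_square field_simps)
  define U where "U = (\<Sum>n. lam n powr s * (cf u n)\<^sup>2)"
  define A where "A = (\<Sum>n. lam n powr s * ((cf v n)\<^sup>2 + (cf d n)\<^sup>2))"
  define W where "W = (\<Sum>n. lam n powr s * (cf v n)\<^sup>2)"
  have "(\<lambda>n. lam n powr s * (cf u n * cf v n)) sums ((U - A) / 2 + W)"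
    unfolding eq U_def A_def W_def
    by (intro sums_add sums_divide sums_diff summable_sums us sa sv)
  moreover from this show "summable (\<lambda>n. lam n powr s * (cf u n * cf v n))" by (rule sums_summable)
  ultimately have "(\<Sum>n. lam n powr s * (cf u n * cf v n)) = (U - A) / 2 + W"
    by (simp add: sums_iff)
  moreover have "A \<le> U" using le2 unfolding A_def U_def .
  ultimately show "(\<Sum>n. lam n powr s * (cf v n)\<^sup>2) \<le> (\<Sum>n. lam n powr s * (cf u n * cf v n))"
    unfolding W_def[symmetric] by simp
qed

text \<open>The series converges for \<open>u\<close> in this space, so the \<open>SOME\<close> in
  the definition has a witness; any witness has the prescribed coefficients.\<close>

lemma frac_laplacian_works:
  assumes "u \<in> Hr \<Omega> lam e s"
  shows "frac_laplacian \<Omega> lam e (s / 2) u \<in> Lp M 2"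
    "cf (frac_laplacian \<Omega> lam e (s / 2) u) n = lam n powr (s / 2) * cf u n"
proof -
  let ?c = "\<lambda>n. lam n powr (s / 2) * cf u n"
  have "summable (\<lambda>n. (?c n)\<^sup>2)"
  proof -
    have "lam n powr s = (lam n powr (s / 2))\<^sup>2" for n
      by (simp add: power2_eq_square flip: powr_add)
    then show ?thesis using assms by (simp add: Hr_iff power_mult_distrib)
  qed
  then obtain w where "w \<in> Lp M 2" "(\<lambda>k. nrm M (\<lambda>x. w x - psum ?c k x)) \<longlonglongrightarrow> 0"
    by (rule series_L2) blast
  then have "\<exists>w. w \<in> Lp M 2 \<and> (\<lambda>k. nrm M (\<lambda>x. w x - psum ?c k x)) \<longlonglongrightarrow> 0" by blast
  then have "frac_laplacian \<Omega> lam e (s / 2) u \<in> Lp M 2 \<and>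
      (\<lambda>k. nrm M (\<lambda>x. frac_laplacian \<Omega> lam e (s / 2) u x - psum ?c k x)) \<longlonglongrightarrow> 0"
    unfolding frac_laplacian_def coef_eq psum_def by (rule someI_ex)
  then show "frac_laplacian \<Omega> lam e (s / 2) u \<in> Lp M 2"
    "cf (frac_laplacian \<Omega> lam e (s / 2) u) n = lam n powr (s / 2) * cf u n"
    using coef_limit by blast+
qed

lemma frac_laplacian_form:
  assumes "u \<in> Hr \<Omega> lam e s" "v \<in> Hr \<Omega> lam e s"
  shows "(LINT x|M. frac_laplacian \<Omega> lam e (s / 2) u x * frac_laplacian \<Omega> lam e (s / 2) v x)
    = (\<Sum>n. lam n powr s * (cf u n * cf v n))"
proof -
  have "(\<lambda>n. (lam n powr (s / 2) * cf u n) * (lam n powr (s / 2) * cf v n)) sums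
      ip M (frac_laplacian \<Omega> lam e (s / 2) u) (frac_laplacian \<Omega> lam e (s / 2) v)"
    using Parseval[OF frac_laplacian_works(1)[OF assms(1)] frac_laplacian_works(1)[OF assms(2)]]
    by (simp add: frac_laplacian_works(2)[OF assms(1)] frac_laplacian_works(2)[OF assms(2)])
  moreover have "(lam n powr (s / 2) * cf u n) * (lam n powr (s / 2) * cf v n) = lam n powr s * (cf u n * cf v n)" for n
  proof -
    have "lam n powr s = lam n powr (s / 2) * lam n powr (s / 2)" by (simp flip: powr_add)
    then show ?thesis by simp
  qed
  ultimately have "(\<lambda>n. lam n powr s * (cf u n * cf v n)) sums
      ip M (frac_laplacian \<Omega> lam e (s / 2) u) (frac_laplacian \<Omega> lam e (s / 2) v)" by simp
  from sums_unique[OF this] show ?thesis unfolding ip_def by simp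
qed

section \<open>A fractional Faber--Krahn inequality\<close>

text \<open>The splitting 1 = \<alpha> / (\<alpha> + \<lambda>) + \<lambda> / (\<alpha> + \<lambda>)
  separates low from high frequencies. The low part pairs v with its resolvent and is at most half
  the squared norm by the Nash inequality; the high part is controlled by the fractional
  energy.\<close>

lemma Faber_Krahn:
  assumes s: "0 < s" "s < 1" and v: "v \<in> Hr \<Omega> lam e s" "\<And>x. x \<in> \<Omega> \<Longrightarrow> \<bar>v x\<bar> \<le> V"
    and m: "measure M {x \<in> \<Omega>. v x \<noteq> 0} \<le> m" "m > 0"
    and r: "r > 0" "measure lebesgue (ball 0 r :: 'a set) = 16 * m"
  shows "ip M v v \<le> 2 * (4 * r) powr (2 * s) * (\<Sum>n. lam n powr s * (cf v n)\<^sup>2)"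
proof -
  \<comment> \<open>Chosen so that r sqrt \<alpha> = 1/4, which makes the gradient term of the Nash
    inequality a quarter of the squared norm.\<close>
  define \<alpha> where "\<alpha> = 1 / (4 * r)\<^sup>2"
  have \<alpha>: "\<alpha> > 0" using r by (simp add: \<alpha>_def)
  have vL: "v \<in> Lp M 2" and vs: "summable (\<lambda>n. lam n powr s * (cf v n)\<^sup>2)" using v by (auto simp: Hr_iff)
  have [measurable]: "v \<in> borel_measurable M" using L2_measurable[OF vL] .
  have parseval: "(\<lambda>n. (cf v n)\<^sup>2) sums ip M v v"
    using Parseval[OF vL vL] by (simp add: power2_eq_square)
  have part: "(\<Sum>n<k. (cf v n)\<^sup>2) \<le> ip M v v" for k
    using sum_le_suminf[OF sums_summable[OF parseval], of "{..<k}"] sums_unique[OF parseval] by simp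
  \<comment> \<open>Smallness of the support enters here. Against sqrt (16 m) in the Nash inequality
    this leaves the second quarter.\<close>
  have L1: "(LINT x|M. \<bar>v x\<bar>) \<le> sqrt m * nrm M v"
  proof -
    let ?S = "{x \<in> \<Omega>. v x \<noteq> 0}"
    have S: "?S \<in> sets M"
    proof -
      have "{x \<in> space M. v x \<noteq> 0} \<in> sets M" by measurable
      then show ?thesis by simp
    qed
    have IL: "indicat_real ?S \<in> Lp M 2"
      using S by (simp add: Lp2_iff indicator_inter_arith[symmetric] integrable_real_indicator emeasure_eq_measure)
    have aL: "(\<lambda>x. \<bar>v x\<bar>) \<in> Lp M 2" using vL by (simp add: Lp2_iff)
    have "(LINT x|M. \<bar>v x\<bar>) = ip M (indicat_real ?S) (\<lambda>x. \<bar>v x\<bar>)"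
      unfolding ip_def by (intro Bochner_Integration.integral_cong) (auto simp: indicator_def)
    also have "\<dots> \<le> nrm M (indicat_real ?S) * nrm M (\<lambda>x. \<bar>v x\<bar>)"
      using Cauchy_Schwarz_ip[OF IL aL] by linarith
    also have "nrm M (indicat_real ?S) = sqrt (measure M ?S)"
    proof -
      have "?S \<inter> \<Omega> = ?S" by blast
      then show ?thesis using S by (simp add: Lp2_norm ip_def indicator_inter_arith[symmetric])
    qed
    also have "nrm M (\<lambda>x. \<bar>v x\<bar>) = nrm M v" by (simp add: Lp2_norm ip_def)
    also have "sqrt (measure M ?S) * nrm M v \<le> sqrt m * nrm M v"
      using m(1) by (intro mult_right_mono) auto
    finally show ?thesis .
  qed
  have half: "(\<Sum>n<k. \<alpha> / (\<alpha> + lam n) * (cf v n)\<^sup>2) \<le> ip M v v / 2" for k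
  proof -
    let ?c = "\<lambda>n. \<alpha> / (\<alpha> + lam n) * cf v n"
    have pos: "\<alpha> + lam n > 0" for n using \<alpha> lam_pos[of n] by linarith
    have "(\<Sum>n<k. (?c n)\<^sup>2) \<le> (\<Sum>n<k. (cf v n)\<^sup>2)"
    proof (rule sum_mono)
      fix n
      have "\<alpha> / (\<alpha> + lam n) \<le> 1" "0 \<le> \<alpha> / (\<alpha> + lam n)" using \<alpha> lam_pos[of n] by auto
      then have "(\<alpha> / (\<alpha> + lam n))\<^sup>2 * (cf v n)\<^sup>2 \<le> 1 * (cf v n)\<^sup>2"
        by (intro mult_right_mono power_le_one) auto
      then show "(?c n)\<^sup>2 \<le> (cf v n)\<^sup>2" by (simp only: power_mult_distrib mult_1_left)
    qed
    then have nz: "nrm M (psum ?c k) \<le> nrm M v"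
      unfolding Lp2_norm ip_psum_psum using part[of k] by (intro real_sqrt_le_mono) linarith
    have "(\<Sum>n<k. lam n * (?c n)\<^sup>2) \<le> (\<Sum>n<k. \<alpha> * (cf v n)\<^sup>2)"
    proof (rule sum_mono)
      fix n
      \<comment> \<open>Consequently the resolvent has Dirichlet energy at most \<alpha> times the
        squared norm of \<open>v\<close>.\<close>
      have "lam n * \<alpha> \<le> (\<alpha> + lam n)\<^sup>2"
        using \<alpha> lam_pos[of n] by (simp add: power2_sum)
      then have "lam n * (\<alpha> / (\<alpha> + lam n))\<^sup>2 \<le> \<alpha>"
        using pos[of n] \<alpha> by (simp add: power_divide divide_le_eq power2_eq_square mult_ac)
      then have "(lam n * (\<alpha> / (\<alpha> + lam n))\<^sup>2) * (cf v n)\<^sup>2 \<le> \<alpha> * (cf v n)\<^sup>2" by (rule mult_right_mono) simp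
      then show "lam n * (?c n)\<^sup>2 \<le> \<alpha> * (cf v n)\<^sup>2" by (simp only: power_mult_distrib mult.assoc)
    qed
    also have "\<dots> \<le> \<alpha> * ip M v v"
      unfolding sum_distrib_left[symmetric] using part[of k] \<alpha> by (intro mult_left_mono) auto
    finally have "sqrt (\<Sum>n<k. lam n * (?c n)\<^sup>2) \<le> sqrt (\<alpha> * ip M v v)" by (rule real_sqrt_le_mono)
    also have "\<dots> = nrm M v / (4 * r)"
      using r by (simp add: \<alpha>_def real_sqrt_mult real_sqrt_divide Lp2_norm)
    finally have g: "sqrt (\<Sum>n<k. lam n * (?c n)\<^sup>2) \<le> nrm M v / (4 * r)" .
    have "(\<Sum>n<k. \<alpha> / (\<alpha> + lam n) * (cf v n)\<^sup>2) = ip M (psum ?c k) v"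
      by (simp add: ip_psum_left[OF vL] ip_commute[of M "e _"] power2_eq_square mult.assoc)
    also have "\<dots> \<le> r * (nrm M v * sqrt (\<Sum>n<k. lam n * (?c n)\<^sup>2)) + (LINT x|M. \<bar>v x\<bar>) * nrm M (psum ?c k) / sqrt (16 * m)"
      using Nash_psum[OF r(1) vL v(2), of ?c k] unfolding r(2) .
    also have "\<dots> \<le> r * (nrm M v * (nrm M v / (4 * r))) + (sqrt m * nrm M v) * nrm M v / sqrt (16 * m)"
      using r(1) m(2) g nz L1 by (intro add_mono mult_left_mono divide_right_mono mult_mono) auto
    also have "\<dots> = ip M v v / 2"
    proof -
      have "sqrt (16 * m) = 4 * sqrt m" by (simp add: real_sqrt_mult)
      then have "(sqrt m * nrm M v) * nrm M v / sqrt (16 * m) = (nrm M v)\<^sup>2 / 4"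
        using m(2) by (simp add: power2_eq_square)
      moreover have "r * (nrm M v * (nrm M v / (4 * r))) = (nrm M v)\<^sup>2 / 4"
        using r(1) by (simp add: power2_eq_square)
      ultimately show ?thesis by (simp add: nrm_square)
    qed
    finally show ?thesis .
  qed
  have powr\<alpha>: "\<alpha> powr (- s) = (4 * r) powr (2 * s)"
  proof -
    have "(4 * r) powr 2 = (4 * r)\<^sup>2" using powr_realpow[of "4 * r" 2] r(1) by simp
    then have "\<alpha> = (4 * r) powr (- 2)" unfolding \<alpha>_def powr_minus by (simp only: divide_inverse mult_1_left)
    then have "\<alpha> powr (- s) = (4 * r) powr (- 2 * - s)" by (simp only: powr_powr)
    then show ?thesis by simp
  qed
  have high: "(\<Sum>n<k. lam n / (\<alpha> + lam n) * (cf v n)\<^sup>2) \<le> (4 * r) powr (2 * s) * (\<Sum>n. lam n powr s * (cf v n)\<^sup>2)" for k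
  proof -
    \<comment> \<open>With t = \<lambda> / \<alpha> this is t / (1 + t) \<le> min 1 t \<le> t powr
      s, where 0 < s < 1 decides both cases.\<close>
    have w: "lam n / (\<alpha> + lam n) \<le> \<alpha> powr (- s) * lam n powr s" for n
    proof -
      define t where "t = lam n / \<alpha>"
      have t: "t > 0" using \<alpha> lam_pos[of n] by (simp add: t_def)
      have "lam n / (\<alpha> + lam n) = t / (1 + t)" using \<alpha> lam_pos[of n] by (simp add: t_def field_simps)
      also have "\<dots> \<le> t powr s"
      proof (cases "t \<le> 1")
        case True
        have "t / (1 + t) \<le> t powr 1" using t by (simp add: pos_divide_le_eq algebra_simps)
        also have "\<dots> \<le> t powr s" using t True s by (intro powr_mono') auto
        finally show ?thesis .
      next
        case False
        have "t / (1 + t) \<le> 1" using t by (simp add: pos_divide_le_eq)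
        also have "\<dots> \<le> t powr s" using False s by (intro ge_one_powr_ge_zero) auto
        finally show ?thesis .
      qed
      also have "\<dots> = \<alpha> powr (- s) * lam n powr s"
      proof -
        have "t powr s = lam n powr s / \<alpha> powr s"
          unfolding t_def by (rule powr_divide)
        then show ?thesis by (simp add: powr_minus divide_inverse)
      qed
      finally show ?thesis .
    qed
    have "(\<Sum>n<k. lam n / (\<alpha> + lam n) * (cf v n)\<^sup>2) \<le> (\<Sum>n<k. (\<alpha> powr (- s) * lam n powr s) * (cf v n)\<^sup>2)"
      using w by (intro sum_mono mult_right_mono) auto
    also have "\<dots> = \<alpha> powr (- s) * (\<Sum>n<k. lam n powr s * (cf v n)\<^sup>2)"
      by (simp add: sum_distrib_left mult.assoc)
    also have "\<dots> \<le> \<alpha> powr (- s) * (\<Sum>n. lam n powr s * (cf v n)\<^sup>2)"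
      using vs by (intro mult_left_mono sum_le_suminf) auto
    finally show ?thesis unfolding powr\<alpha> .
  qed
  have "(\<Sum>n<k. (cf v n)\<^sup>2) \<le> ip M v v / 2 + (4 * r) powr (2 * s) * (\<Sum>n. lam n powr s * (cf v n)\<^sup>2)" for k
  proof -
    have "(cf v n)\<^sup>2 = \<alpha> / (\<alpha> + lam n) * (cf v n)\<^sup>2 + lam n / (\<alpha> + lam n) * (cf v n)\<^sup>2" for n
    proof -
      have "\<alpha> / (\<alpha> + lam n) + lam n / (\<alpha> + lam n) = 1"
        using \<alpha> lam_pos[of n] by (simp flip: add_divide_distrib)
      then show ?thesis by (metis distrib_right mult_1)
    qed
    then have "(\<Sum>n<k. (cf v n)\<^sup>2) = (\<Sum>n<k. \<alpha> / (\<alpha> + lam n) * (cf v n)\<^sup>2) + (\<Sum>n<k. lam n / (\<alpha> + lam n) * (cf v n)\<^sup>2)"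
      by (simp only: sum.distrib[symmetric])
    then show ?thesis using half[of k] high[of k] by linarith
  qed
  then have "ip M v v \<le> ip M v v / 2 + (4 * r) powr (2 * s) * (\<Sum>n. lam n powr s * (cf v n)\<^sup>2)"
    using parseval unfolding sums_def by (intro LIMSEQ_le_const2) auto
  then show ?thesis by simp
qed

end

section \<open>Superposition operators\<close>

text \<open>Rounding \<open>w\<close> down to multiples of 1 / (n + 1) leaves countably many values,
  each handled by measurability in \<open>x\<close>; continuity in the second argument gives the
  limit.\<close>

lemma Caratheodory_measurable:
  fixes f :: "'a \<Rightarrow> real \<Rightarrow> real"
  assumes cont: "\<And>x. x \<in> space M \<Longrightarrow> continuous_on UNIV (f x)"
    and meas: "\<And>t. (\<lambda>x. f x t) \<in> borel_measurable M"
    and w[measurable]: "w \<in> borel_measurable M"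
  shows "(\<lambda>x. f x (w x)) \<in> borel_measurable M"
proof (rule borel_measurable_LIMSEQ_real)
  let ?q = "\<lambda>n x. real_of_int \<lfloor>real (Suc n) * w x\<rfloor> / real (Suc n)"
  show "(\<lambda>x. f x (?q n x)) \<in> borel_measurable M" for n
  proof (rule measurable_compose_countable[where f = "\<lambda>(i::int) x. f x (real_of_int i / real (Suc n))"])
    show "(\<lambda>x. \<lfloor>real (Suc n) * w x\<rfloor>) \<in> measurable M (count_space UNIV)" by measurable
  qed (rule meas)
  fix x assume x: "x \<in> space M"
  have "(\<lambda>n. ?q n x) \<longlonglongrightarrow> w x"
  proof (rule LIMSEQ_I)
    fix \<epsilon> :: real assume "\<epsilon> > 0"
    then obtain N where N: "inverse (real (Suc N)) < \<epsilon>" using reals_Archimedean by blast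
    have "\<bar>?q n x - w x\<bar> < \<epsilon>" if "n \<ge> N" for n
    proof -
      have "\<bar>?q n x - w x\<bar> = \<bar>real_of_int \<lfloor>real (Suc n) * w x\<rfloor> - real (Suc n) * w x\<bar> / real (Suc n)"
        by (simp add: field_simps abs_divide[symmetric] del: of_nat_Suc)
      also have "\<dots> \<le> 1 / real (Suc n)"
        by (intro divide_right_mono) linarith+
      also have "\<dots> \<le> inverse (real (Suc N))" using that by (simp add: field_simps)
      finally show ?thesis using N by linarith
    qed
    then show "\<exists>no. \<forall>n\<ge>no. norm (?q n x - w x) < \<epsilon>" by auto
  qed
  then show "(\<lambda>n. f x (?q n x)) \<longlonglongrightarrow> f x (w x)"
    by (rule continuous_on_tendsto_compose[OF cont[OF x]]) auto
qed

text \<open>Turns the gauge integral of the definition into a Lebesgue integral, for which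
  measurability in a parameter is available.\<close>

lemma primitive_eq_lborel:
  assumes "continuous_on UNIV (f x)"
  shows "primitive f x t = (LINT \<tau>|lborel. indicat_real {0..\<bar>t\<bar>} \<tau> * f x \<tau>)"
    and "integrable lborel (\<lambda>\<tau>. indicat_real {0..\<bar>t\<bar>} \<tau> * f x \<tau>)"
proof -
  have "set_integrable lborel {0..\<bar>t\<bar>} (f x)"
    using assms continuous_on_subset by (intro borel_integrable_atLeastAtMost') blast
  from this set_borel_integral_eq_integral(2)[OF this]
  show "primitive f x t = (LINT \<tau>|lborel. indicat_real {0..\<bar>t\<bar>} \<tau> * f x \<tau>)"
    "integrable lborel (\<lambda>\<tau>. indicat_real {0..\<bar>t\<bar>} \<tau> * f x \<tau>)"
    unfolding primitive_def set_lebesgue_integral_def set_integrable_def by auto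
qed

text \<open>Viewed as a Caratheodory function on the product space, \<open>f\<close> is jointly
  measurable; integrating out the second variable preserves measurability.\<close>

lemma primitive_measurable:
  fixes f :: "'a \<Rightarrow> real \<Rightarrow> real"
  assumes cont: "\<And>x. x \<in> space M \<Longrightarrow> continuous_on UNIV (f x)"
    and meas: "\<And>t. (\<lambda>x. f x t) \<in> borel_measurable M"
    and w[measurable]: "w \<in> borel_measurable M"
  shows "(\<lambda>x. primitive f x (w x)) \<in> borel_measurable M"
proof -
  have [measurable]: "(\<lambda>z. f (fst z) (snd z)) \<in> borel_measurable (M \<Otimes>\<^sub>M lborel)"
  proof (rule Caratheodory_measurable[where f = "\<lambda>z. f (fst z)" and w = snd])
    show "continuous_on UNIV (f (fst z))" if "z \<in> space (M \<Otimes>\<^sub>M lborel)" for z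
      using that by (intro cont) (auto simp: space_pair_measure)
    show "(\<lambda>z. f (fst z) t) \<in> borel_measurable (M \<Otimes>\<^sub>M lborel)" for t
      by (rule measurable_compose[OF measurable_fst meas])
  qed measurable
  have "(\<lambda>x. LINT \<tau>|lborel. indicat_real {0..\<bar>w x\<bar>} \<tau> * f x \<tau>) \<in> borel_measurable M"
  proof (rule sigma_finite_measure.borel_measurable_lebesgue_integral[OF sigma_finite_lborel])
    have "(\<lambda>z. (if 0 \<le> snd z \<and> snd z \<le> \<bar>w (fst z)\<bar> then f (fst z) (snd z) else 0)) \<in> borel_measurable (M \<Otimes>\<^sub>M lborel)"
      by measurable
    then show "(\<lambda>(x, \<tau>). indicat_real {0..\<bar>w x\<bar>} \<tau> * f x \<tau>) \<in> borel_measurable (M \<Otimes>\<^sub>M lborel)"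
      by (rule measurable_cong[THEN iffD1, rotated]) (auto simp: indicator_def)
  qed
  then show ?thesis
    by (rule measurable_cong[THEN iffD1, rotated]) (simp add: primitive_eq_lborel(1)[of f, OF cont])
qed

lemma primitive_mono:
  assumes cont: "continuous_on UNIV (f x)" and pos: "\<And>t. t \<ge> 0 \<Longrightarrow> f x t \<ge> 0" and "\<bar>t\<bar> \<le> \<bar>t'\<bar>"
  shows "0 \<le> primitive f x t" "primitive f x t \<le> primitive f x t'"
proof -
  show "0 \<le> primitive f x t"
    unfolding primitive_eq_lborel(1)[of f x, OF cont]
    by (intro Bochner_Integration.integral_nonneg) (auto simp: indicator_def pos)
  show "primitive f x t \<le> primitive f x t'"
    unfolding primitive_eq_lborel(1)[of f x, OF cont]
    using primitive_eq_lborel(2)[of f x, OF cont] assms(3)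
    by (intro integral_mono) (auto simp: indicator_def pos)
qed

text \<open>A property of a single section \<open>f x\<close>, so that sections lacking it, which
  occur only on a null set, can be replaced.\<close>

definition regular_nonlinearity :: "(real \<Rightarrow> real) \<Rightarrow> bool" where
  "regular_nonlinearity \<phi> \<longleftrightarrow> strict_mono \<phi> \<and> continuous_on UNIV \<phi> \<and> \<phi> 0 = 0"

lemma regular_sign:
  assumes "regular_nonlinearity \<phi>"
  shows "t \<ge> 0 \<Longrightarrow> \<phi> t \<ge> 0" "t \<le> 0 \<Longrightarrow> \<phi> t \<le> 0"
  using assms strict_mono_mono[of \<phi>] monoD[of \<phi> 0 t] monoD[of \<phi> t 0]
  by (auto simp: regular_nonlinearity_def)

context bounded_open_set
begin

text \<open>Rests on completeness of Lebesgue measure: preimages differ only inside a null set.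
  Extension by zero moves the question to the whole space.\<close>

lemma measurable_AE_eq:
  fixes h h' :: "'a \<Rightarrow> real"
  assumes h': "h' \<in> borel_measurable M" and ae: "AE x in M. h x = h' x"
  shows "h \<in> borel_measurable M"
proof -
  have "AE x in M. h' x = h x" using ae by eventually_elim simp
  then have "AE x in lebesgue. x \<in> \<Omega> \<longrightarrow> h' x = h x"
    by (simp add: AE_restrict_space_iff)
  then obtain N where N: "N \<in> null_sets lebesgue" "{x. \<not> (x \<in> \<Omega> \<longrightarrow> h' x = h x)} \<subseteq> N"
    unfolding eventually_ae_filter by auto
  let ?k = "\<lambda>x. indicat_real \<Omega> x * h x" and ?k' = "\<lambda>x. indicat_real \<Omega> x * h' x"
  have k': "?k' \<in> borel_measurable lebesgue"
    using h' by (simp add: borel_measurable_restrict_space_iff)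
  have "?k \<in> borel_measurable lebesgue"
  proof (rule measurableI)
    fix A :: "real set" assume A: "A \<in> sets borel"
    have eq: "?k' x = ?k x" if "x \<notin> N" for x
      using N(2) that by (cases "x \<in> \<Omega>") auto
    have "?k -` A = (?k' -` A - N) \<union> (?k -` A \<inter> N)"
    proof (rule set_eqI)
      fix x
      show "x \<in> ?k -` A \<longleftrightarrow> x \<in> (?k' -` A - N) \<union> (?k -` A \<inter> N)"
        unfolding Un_iff Diff_iff Int_iff vimage_eq using eq[of x] by metis
    qed
    moreover have "?k' -` A \<in> sets lebesgue"
      using measurable_sets[OF k' A] by simp
    moreover have "N \<in> sets lebesgue" using N(1) by auto
    moreover have "?k -` A \<inter> N \<in> sets lebesgue"
      using N(1) by (intro completion.complete[of _ N]) auto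
    ultimately have "?k -` A \<in> sets lebesgue"
      by (metis sets.Diff sets.Un)
    then show "?k -` A \<inter> space lebesgue \<in> sets lebesgue" by simp
  qed simp
  then show ?thesis by (simp add: borel_measurable_restrict_space_iff)
qed

lemma structural_AE:
  assumes "structural_condition \<Omega> f"
  shows "AE x in M. regular_nonlinearity (f x)" "(\<lambda>x. f x t) \<in> borel_measurable M"
  using assms by (auto simp: structural_condition_def regular_nonlinearity_def)

text \<open>The primitive is even in \<open>t\<close> and increasing in its absolute value. This is
  what places truncations of a solution in \<open>V_space\<close>.\<close>

lemma L_F_dominated:
  assumes f: "structural_condition \<Omega> f" and u: "u \<in> L_F \<Omega> f"
    and v: "v \<in> borel_measurable M" "\<And>x. \<bar>v x\<bar> \<le> \<bar>u x\<bar>"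
  shows "v \<in> L_F \<Omega> f"
proof -
  \<comment> \<open>With the identity on the exceptional sections, continuity holds at every point,
    as \<open>primitive_measurable\<close> demands.\<close>
  define f' where "f' x = (if regular_nonlinearity (f x) then f x else (\<lambda>t. t))" for x
  have reg: "regular_nonlinearity (f' x)" for x
    by (auto simp: f'_def regular_nonlinearity_def strict_mono_def)
  have ae: "AE x in M. f x = f' x"
    using structural_AE(1)[OF f] by eventually_elim (simp add: f'_def)
  have "(\<lambda>x. f' x t) \<in> borel_measurable M" for t
    by (rule measurable_AE_eq[OF structural_AE(2)[OF f, of t]]) (use ae in eventually_elim, simp)
  then have m': "(\<lambda>x. primitive f' x (v x)) \<in> borel_measurable M"
    using reg v(1) by (intro primitive_measurable) (auto simp: regular_nonlinearity_def)
  have m: "(\<lambda>x. primitive f x (v x)) \<in> borel_measurable M"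
    by (rule measurable_AE_eq[OF m']) (use ae in eventually_elim, simp add: primitive_def)
  have i: "integrable M (\<lambda>x. primitive f x (u x))" using u by (simp add: L_F_def)
  have b: "AE x in M. norm (primitive f x (v x)) \<le> norm (primitive f x (u x))"
    using structural_AE(1)[OF f]
  proof eventually_elim
    case (elim x)
    have c: "continuous_on UNIV (f x)" and p: "\<And>t. t \<ge> 0 \<Longrightarrow> f x t \<ge> 0"
      using elim regular_sign(1)[OF elim] by (auto simp: regular_nonlinearity_def)
    have "0 \<le> primitive f x (v x)" "primitive f x (v x) \<le> primitive f x (u x)"
      using primitive_mono[of f x "v x" "u x", OF c p v(2)] by auto
    then show ?case by simp
  qed
  have "integrable M (\<lambda>x. primitive f x (v x))"
    by (rule Bochner_Integration.integrable_bound[OF i m b])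
  then show ?thesis using v(1) by (simp add: L_F_def)
qed

end

section \<open>Hoelder's inequality on sets of finite measure\<close>

text \<open>The convention 1 / \<infinity> = 0 makes \<open>1 - recip p\<close> the right exponent
  of the measure in Hoelder's inequality for every p \<ge> 1.\<close>

definition recip :: "ennreal \<Rightarrow> real" where
  "recip p = (if p = \<infinity> then 0 else 1 / enn2real p)"

text \<open>Young's inequality with second factor 1; \<open>q = 1\<close> is separate because its
  conjugate exponent is infinite.\<close>

lemma Young_one:
  fixes q y :: real
  assumes "q \<ge> 1" "y \<ge> 0"
  shows "y \<le> y powr q / q + (1 - 1 / q)"
proof (cases "q = 1")
  case False
  then have "q > 1" using assms by simp
  then have "y * 1 \<le> y powr q / q + 1 powr (q / (q - 1)) / (q / (q - 1))"
    using assms by (intro Youngs_inequality) (auto simp: field_simps)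
  then show ?thesis using \<open>q > 1\<close> by (simp add: field_simps)
qed (use assms in auto)

context finite_measure
begin

text \<open>Young's inequality is applied to the quotient of \<bar>g\<bar> by a level \<tau> > 0 and
  integrated over \<open>S\<close>; optimising in \<tau> gives the product form.\<close>

lemma Hoelder_finite:
  fixes g :: "'a \<Rightarrow> real"
  assumes q: "q \<ge> 1" and g[measurable]: "g \<in> borel_measurable M" and int: "integrable M (\<lambda>x. \<bar>g x\<bar> powr q)"
  shows "integrable M g"
    and "S \<in> sets M \<Longrightarrow> measure M S > 0 \<Longrightarrow>
      (LINT x|M. \<bar>g x\<bar> * indicat_real S x) \<le> (LINT x|M. \<bar>g x\<bar> powr q) powr (1 / q) * measure M S powr (1 - 1 / q)"
proof -
  have young: "\<bar>g x\<bar> \<le> \<tau> powr (1 - q) * (\<bar>g x\<bar> powr q / q) + \<tau> * (1 - 1 / q)" if "\<tau> > 0" for \<tau> x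
  proof -
    have "\<bar>g x\<bar> / \<tau> \<le> (\<bar>g x\<bar> / \<tau>) powr q / q + (1 - 1 / q)"
      using that by (intro Young_one q) auto
    then have "\<tau> * (\<bar>g x\<bar> / \<tau>) \<le> \<tau> * ((\<bar>g x\<bar> / \<tau>) powr q / q + (1 - 1 / q))"
      using that by (intro mult_left_mono) auto
    also have "\<dots> = \<tau> powr (1 - q) * (\<bar>g x\<bar> powr q / q) + \<tau> * (1 - 1 / q)"
    proof -
      have "\<tau> * (\<bar>g x\<bar> / \<tau>) powr q = \<tau> powr (1 - q) * \<bar>g x\<bar> powr q"
        using that by (simp add: powr_divide powr_diff)
      then have "\<tau> * ((\<bar>g x\<bar> / \<tau>) powr q / q) = \<tau> powr (1 - q) * (\<bar>g x\<bar> powr q / q)"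
        by (metis times_divide_eq_right)
      then show ?thesis by (simp only: distrib_left)
    qed
    finally show ?thesis using that by simp
  qed
  show ig: "integrable M g"
  proof (rule Bochner_Integration.integrable_bound)
    show "integrable M (\<lambda>x. 1 powr (1 - q) * (\<bar>g x\<bar> powr q / q) + 1 * (1 - 1 / q))"
      using int by (intro Bochner_Integration.integrable_add integrable_mult_right) auto
    show "AE x in M. norm (g x) \<le> norm (1 powr (1 - q) * (\<bar>g x\<bar> powr q / q) + 1 * (1 - 1 / q))"
    proof (rule AE_I2)
      fix x
      show "norm (g x) \<le> norm (1 powr (1 - q) * (\<bar>g x\<bar> powr q / q) + 1 * (1 - 1 / q))"
        using young[of 1 x] unfolding real_norm_def by linarith
    qed
  qed simp
  assume S[measurable]: "S \<in> sets M" and a: "measure M S > 0"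
  define I where "I = (LINT x|M. \<bar>g x\<bar> powr q)"
  define J where "J = (LINT x|M. \<bar>g x\<bar> * indicat_real S x)"
  have I0: "I \<ge> 0" unfolding I_def by (rule Bochner_Integration.integral_nonneg) simp
  have J: "J \<le> \<tau> powr (1 - q) * (I / q) + \<tau> * (1 - 1 / q) * measure M S" if "\<tau> > 0" for \<tau>
  proof -
    have iS: "integrable M (indicat_real S)"
      by (intro integrable_real_indicator) (auto simp: emeasure_eq_measure)
    have "J \<le> (LINT x|M. \<tau> powr (1 - q) * (\<bar>g x\<bar> powr q / q) + \<tau> * (1 - 1 / q) * indicat_real S x)"
      unfolding J_def
    proof (rule integral_mono)
      show "integrable M (\<lambda>x. \<bar>g x\<bar> * indicat_real S x)"
        using integrable_mult_indicator[OF S, of "\<lambda>x. \<bar>g x\<bar>"] ig by (simp add: mult.commute)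
      show "integrable M (\<lambda>x. \<tau> powr (1 - q) * (\<bar>g x\<bar> powr q / q) + \<tau> * (1 - 1 / q) * indicat_real S x)"
        using int iS by (intro Bochner_Integration.integrable_add integrable_mult_right) auto
      fix x
      have "0 \<le> \<tau> powr (1 - q) * (\<bar>g x\<bar> powr q / q)" using q by simp
      then show "\<bar>g x\<bar> * indicat_real S x \<le> \<tau> powr (1 - q) * (\<bar>g x\<bar> powr q / q) + \<tau> * (1 - 1 / q) * indicat_real S x"
        using young[OF that, of x] by (auto simp: indicator_def)
    qed
    also have "\<dots> = \<tau> powr (1 - q) * (I / q) + \<tau> * (1 - 1 / q) * measure M S"
      using int iS S by (simp add: I_def Bochner_Integration.integral_add integrable_mult_right sets.Int_space_eq2)
    finally show ?thesis .
  qed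
  show "J \<le> I powr (1 / q) * measure M S powr (1 - 1 / q)"
  proof (cases "I = 0")
    case True
    \<comment> \<open>Without the first summand the bound is linear in \<tau>, and \<tau> = y /
      measure M S brings it below \<open>y\<close>.\<close>
    have "J \<le> 0 + y" if "y > 0" for y
    proof -
      have "J \<le> (y / measure M S) * (1 - 1 / q) * measure M S"
        using J[of "y / measure M S"] True a that by simp
      also have "\<dots> \<le> y" using q a that by (simp add: mult_left_le)
      finally show ?thesis by simp
    qed
    then have "J \<le> 0" by (rule field_le_epsilon)
    then show ?thesis using True by simp
  next
    case False
    then have I: "I > 0" using I0 by simp
    \<comment> \<open>The solution of \<tau> powr q = I / measure M S, which makes the two summands
      proportional to the same quantity with weights 1 / q and 1 - 1 / q.\<close>
    define \<tau> where "\<tau> = I powr (1 / q) * measure M S powr (- 1 / q)"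
    have \<tau>: "\<tau> > 0" using I a by (simp add: \<tau>_def)
    have "\<tau> powr q = I powr (1 / q * q) * measure M S powr (- 1 / q * q)"
      by (simp only: \<tau>_def powr_mult powr_powr)
    also have "\<dots> = I / measure M S"
      using I a q by (simp add: powr_minus divide_inverse)
    finally have "\<tau> powr q = I / measure M S" .
    then have "\<tau> powr (1 - q) * I = \<tau> * measure M S"
      using \<tau> I a by (simp add: powr_diff field_simps)
    then have "J \<le> \<tau> * measure M S / q + \<tau> * (1 - 1 / q) * measure M S"
      using J[OF \<tau>] by simp
    also have "\<dots> = \<tau> * measure M S" by (simp add: algebra_simps)
    also have "\<dots> = I powr (1 / q) * (measure M S powr (- 1 / q) * measure M S powr 1)"
      using a by (simp add: \<tau>_def)
    also have "\<dots> = I powr (1 / q) * measure M S powr (1 - 1 / q)"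
    proof -
      have "- 1 / q + 1 = 1 - 1 / q" by simp
      then show ?thesis by (simp only: powr_add[symmetric])
    qed
    finally show ?thesis .
  qed
qed

lemma Hoelder_indicator:
  fixes g :: "'a \<Rightarrow> real"
  assumes p: "p \<ge> 1" and g: "g \<in> Lp M p"
  shows "integrable M g"
    and "S \<in> sets M \<Longrightarrow> measure M S > 0 \<Longrightarrow>
      (LINT x|M. \<bar>g x\<bar> * indicat_real S x) \<le> Lp_norm M p g * measure M S powr (1 - recip p)"
proof -
  have gm[measurable]: "g \<in> borel_measurable M" using g by (simp add: Lp_def)
  have "integrable M g \<and> (S \<in> sets M \<longrightarrow> measure M S > 0 \<longrightarrow>
      (LINT x|M. \<bar>g x\<bar> * indicat_real S x) \<le> Lp_norm M p g * measure M S powr (1 - recip p))"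
  proof (cases "p = \<infinity>")
    case True
    let ?e = "esssup M (\<lambda>x. ennreal (norm (g x)))"
    have e: "?e < \<infinity>" and n: "Lp_norm M p g = enn2real ?e" using g True by (auto simp: Lp_def Lp_norm_def)
    have ae: "AE x in M. \<bar>g x\<bar> \<le> enn2real ?e"
      using esssup_AE[where M = M and f = "\<lambda>x. ennreal (norm (g x))"]
    proof eventually_elim
      case (elim x)
      then have "enn2real (ennreal (norm (g x))) \<le> enn2real ?e" using e by (intro enn2real_mono) auto
      then show ?case by simp
    qed
    have ig: "integrable M g"
      by (rule integrable_const_bound[where B = "enn2real ?e"]) (use ae in auto)
    moreover have "(LINT x|M. \<bar>g x\<bar> * indicat_real S x) \<le> Lp_norm M p g * measure M S powr (1 - recip p)"
      if S: "S \<in> sets M" and a: "measure M S > 0"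
    proof -
      have iS: "integrable M (indicat_real S)"
        using S by (intro integrable_real_indicator) (auto simp: emeasure_eq_measure)
      have "(LINT x|M. \<bar>g x\<bar> * indicat_real S x) \<le> (LINT x|M. enn2real ?e * indicat_real S x)"
      proof (rule integral_mono_AE)
        show "integrable M (\<lambda>x. \<bar>g x\<bar> * indicat_real S x)"
          using integrable_mult_indicator[OF S, of "\<lambda>x. \<bar>g x\<bar>"] ig by (simp add: mult.commute)
        show "integrable M (\<lambda>x. enn2real ?e * indicat_real S x)" using iS by simp
        show "AE x in M. \<bar>g x\<bar> * indicat_real S x \<le> enn2real ?e * indicat_real S x"
          using ae by eventually_elim (auto simp: indicator_def)
      qed
      also have "\<dots> = Lp_norm M p g * measure M S powr (1 - recip p)"
        using S a True n by (simp add: recip_def sets.Int_space_eq2)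
      finally show ?thesis .
    qed
    ultimately show ?thesis by blast
  next
    case False
    have "p \<noteq> top" using False by simp
    then have "enn2real p \<ge> 1" using enn2real_mono[OF p] by (simp add: top.not_eq_extremum)
    then show ?thesis
      using Hoelder_finite[of "enn2real p" g] g False by (auto simp: Lp_def Lp_norm_def recip_def)
  qed
  then show "integrable M g" "S \<in> sets M \<Longrightarrow> measure M S > 0 \<Longrightarrow>
      (LINT x|M. \<bar>g x\<bar> * indicat_real S x) \<le> Lp_norm M p g * measure M S powr (1 - recip p)" by auto
qed

end

section \<open>Level sets of weak solutions\<close>

text \<open>Along levels increasing to \<open>D\<close> with gaps halving at each step, the
  superlinear exponent \<delta> > 1 outweighs the factor 2^j lost by dividing by the gap, so the
  measures decay geometrically.\<close>

lemma Stampacchia: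
  fixes a :: "real \<Rightarrow> real"
  assumes a: "\<And>k. 0 \<le> a k" "\<And>k l. k \<le> l \<Longrightarrow> a l \<le> a k" "a 0 \<le> A" "A > 0"
    and decay: "\<And>k l. 0 \<le> k \<Longrightarrow> k < l \<Longrightarrow> (l - k) * a l \<le> K * a k powr \<delta>"
    and \<delta>: "\<delta> > 1" and "K \<ge> 0" and D: "D > 0" "K * A powr (\<delta> - 1) * 2 powr (\<delta> / (\<delta> - 1)) \<le> D"
  shows "a D = 0"
proof -
  \<comment> \<open>The decay rate for which the induction closes: \<mu> \<delta> = \<mu> + 1, the
    extra 1 paying for the halved gap.\<close>
  define \<mu> where "\<mu> = 1 / (\<delta> - 1)"
  have \<mu>: "\<mu> > 0" "\<mu> * (\<delta> - 1) = 1" using \<delta> by (auto simp: \<mu>_def)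
  define k where "k j = D * (1 - 2 powr (- real j))" for j
  have kD: "k j \<le> D" for j using D(1) by (simp add: k_def mult_left_le)
  have step: "a (k j) \<le> A * 2 powr (- \<mu> * real j)" for j
  proof (induction j)
    case 0
    then show ?case using a(3) by (simp add: k_def)
  next
    case (Suc j)
    have diff: "k (Suc j) - k j = D * 2 powr (- real (Suc j))"
    proof -
      have "2 powr (- real j) = 2 * 2 powr (- real (Suc j))"
        by (simp add: powr_diff powr_minus_divide powr_add)
      then show ?thesis by (simp add: k_def algebra_simps)
    qed
    have "0 \<le> k j" using D(1) powr_mono[of "- real j" 0 2] by (simp add: k_def)
    moreover have "k j < k (Suc j)"
    proof -
      have "0 < D * 2 powr (- real (Suc j))" using D(1) by simp
      then show ?thesis using diff by linarith
    qed
    ultimately have "D * 2 powr (- real (Suc j)) * a (k (Suc j)) \<le> K * a (k j) powr \<delta>"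
      using decay[of "k j" "k (Suc j)"] unfolding diff by simp
    also have "\<dots> \<le> K * (A * 2 powr (- \<mu> * real j)) powr \<delta>"
      using Suc a(1) \<delta> \<open>K \<ge> 0\<close> by (intro mult_left_mono powr_mono2) auto
    \<comment> \<open>Rewriting the exponent for \<open>Suc j\<close> instead of \<open>j\<close>
      releases the factor 2 powr (1 + \<mu>), and 1 + \<mu> = \<delta> / (\<delta> - 1); this is the
      constant in the hypothesis on \<open>D\<close>.\<close>
    also have "\<dots> = (K * A powr (\<delta> - 1) * 2 powr (\<delta> / (\<delta> - 1))) * (A * 2 powr (- \<mu> * real (Suc j)) * 2 powr (- real (Suc j)))"
    proof -
      have "A powr \<delta> = A powr (\<delta> - 1) * A"
        using a(4) by (simp add: powr_diff)
      moreover have "(2 powr (- \<mu> * real j)) powr \<delta> = 2 powr (\<delta> / (\<delta> - 1)) * (2 powr (- \<mu> * real (Suc j)) * 2 powr (- real (Suc j)))"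
      proof -
        have "\<delta> / (\<delta> - 1) = 1 + \<mu>" using \<delta> by (simp add: \<mu>_def field_simps)
        moreover have "\<mu> * \<delta> = 1 + \<mu>" using \<mu>(2) by (simp add: algebra_simps)
        then have "- \<mu> * real j * \<delta> = (1 + \<mu>) + (- \<mu> * real (Suc j) + - real (Suc j))"
          by (simp add: algebra_simps) (metis mult.assoc mult.commute distrib_left mult_1_right)
        ultimately show ?thesis by (simp only: powr_powr powr_add[symmetric])
      qed
      ultimately show ?thesis using a(4) by (simp add: powr_mult mult_ac)
    qed
    also have "\<dots> \<le> D * (A * 2 powr (- \<mu> * real (Suc j)) * 2 powr (- real (Suc j)))"
      using D(2) a(4) by (intro mult_right_mono) auto
    also have "\<dots> = D * 2 powr (- real (Suc j)) * (A * 2 powr (- \<mu> * real (Suc j)))" by simp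
    finally show ?case
      using D(1) by (subst (asm) mult_le_cancel_left_pos) auto
  qed
  have "(\<lambda>j. A * 2 powr (- \<mu> * real j)) \<longlonglongrightarrow> A * 0"
  proof (intro tendsto_mult tendsto_const)
    have "(\<lambda>j. (2 powr (- \<mu>)) ^ j) \<longlonglongrightarrow> 0"
      using \<mu>(1) powr_less_mono[of "- \<mu>" 0 2] by (intro LIMSEQ_power_zero) auto
    moreover have "(2 powr (- \<mu>)) ^ j = (2::real) powr (- \<mu> * real j)" for j
      by (simp add: powr_powr flip: powr_realpow)
    ultimately show "(\<lambda>j. 2 powr (- \<mu> * real j)) \<longlonglongrightarrow> (0::real)" by simp
  qed
  moreover have "a D \<le> A * 2 powr (- \<mu> * real j)" for j
    using a(2)[OF kD[of j]] step[of j] by linarith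
  ultimately have "a D \<le> 0" by (intro LIMSEQ_le_const[of _ 0]) auto
  then show ?thesis using a(1)[of D] by simp
qed

lemma trunc_bounds:
  assumes "0 \<le> k" "k < l"
  shows "0 \<le> trunc k l t" "trunc k l t \<le> l - k" "\<bar>trunc k l t\<bar> \<le> \<bar>t\<bar>"
    "t \<le> k \<Longrightarrow> trunc k l t = 0" "l < t \<Longrightarrow> trunc k l t = l - k"
  using assms by (auto simp: trunc_def)

context bounded_open_set
begin

text \<open>The equation is tested with \<sigma> times the truncation of \<sigma> u. The nonlinear
  term is nonnegative since \<open>f x\<close> has the sign of its argument,
  \<open>truncation_energy\<close> bounds the principal term from below, and the sign \<sigma>
  treats upper and lower bounds of \<open>u\<close> together.\<close>

lemma energy_le_datum:
  assumes sys: "dirichlet_eigensystem \<Omega> lam e" and s: "0 < s" "s < 1"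
    and f: "structural_condition \<Omega> f" and g: "integrable M g"
    and u: "weak_solution \<Omega> lam e s f (Lp_functional \<Omega> g) u"
    and k: "0 \<le> k" "k < l" and \<sigma>: "\<sigma> = 1 \<or> \<sigma> = - 1"
  shows "(\<lambda>x. trunc k l (\<sigma> * u x)) \<in> Hr \<Omega> lam e s"
    and "(\<Sum>n. lam n powr s * (ip M (\<lambda>x. trunc k l (\<sigma> * u x)) (e n))\<^sup>2)
      \<le> (l - k) * (LINT x|M. \<bar>g x\<bar> * indicat_real {x \<in> \<Omega>. k < \<sigma> * u x} x)"
proof -
  interpret dirichlet_system \<Omega> lam e by unfold_locales (rule sys)
  have uV: "u \<in> Hr \<Omega> lam e s" "u \<in> L_F \<Omega> f"
    and weak: "\<And>w. w \<in> V_space \<Omega> lam e s f \<Longrightarrow>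
        (LINT x|M. frac_laplacian \<Omega> lam e (s / 2) u x * frac_laplacian \<Omega> lam e (s / 2) w x)
        + (LINT x|M. f x (u x) * w x) = (LINT x|M. g x * w x)"
    using u by (auto simp: weak_solution_def V_space_def Lp_functional_def)
  have uL: "u \<in> Lp M 2" using uV(1) by (simp add: Hr_iff)
  have [measurable]: "u \<in> borel_measurable M" using L2_measurable[OF uL] .
  note borel_measurable_integrable[OF g, measurable]
  have scale: "(\<lambda>x. \<sigma> * h x) \<in> Hr \<Omega> lam e s" if "h \<in> Hr \<Omega> lam e s" for h
  proof -
    have "(\<sigma> * cf h n)\<^sup>2 = (cf h n)\<^sup>2" for n using \<sigma> by (auto simp: power_mult_distrib)
    then show ?thesis using that by (auto simp: Hr_iff ip_cmult_left intro: L2_cmult)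
  qed
  define v where "v = (\<lambda>x. trunc k l (\<sigma> * u x))"
  define w where "w x = \<sigma> * v x" for x
  note t = truncation_energy[OF s scale[OF uV(1)] k v_def]
  show "(\<lambda>x. trunc k l (\<sigma> * u x)) \<in> Hr \<Omega> lam e s" using t(1) unfolding v_def .
  have [measurable]: "v \<in> borel_measurable M" using t(1) L2_measurable by (auto simp: Hr_iff)
  have wH: "w \<in> Hr \<Omega> lam e s" unfolding w_def using scale[OF t(1)] .
  have [measurable]: "w \<in> borel_measurable M" using wH L2_measurable by (auto simp: Hr_iff)
  have sgu: "\<bar>\<sigma> * u x\<bar> = \<bar>u x\<bar>" "\<bar>w x\<bar> = v x" for x
    using \<sigma> trunc_bounds(1)[OF k, of "\<sigma> * u x"] by (auto simp: w_def v_def)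
  have "w \<in> L_F \<Omega> f"
  proof (rule L_F_dominated[OF f uV(2)])
    show "\<bar>w x\<bar> \<le> \<bar>u x\<bar>" for x
      using trunc_bounds(3)[OF k, of "\<sigma> * u x"] sgu(1)[of x] sgu(2)[of x] by (simp add: v_def)
  qed simp
  then have wV: "w \<in> V_space \<Omega> lam e s f" using wH by (simp add: V_space_def)
  \<comment> \<open>Where the truncation is nonzero, \<sigma> u > k \<ge> 0, so f x (u x) and
    \<open>w x\<close> have the same sign.\<close>
  have "0 \<le> (LINT x|M. f x (u x) * w x)"
  proof (rule integral_nonneg_AE, use structural_AE(1)[OF f] in eventually_elim)
    case (elim x)
    show ?case
    proof (cases "\<sigma> * u x \<le> k")
      case True
      then show ?thesis using trunc_bounds(4)[OF k True] by (simp add: w_def v_def)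
    next
      case False
      have "0 \<le> f x (u x) * \<sigma>"
        using \<sigma> False k(1) regular_sign[OF elim, of "u x"] by auto
      then have "0 \<le> (f x (u x) * \<sigma>) * v x"
        by (rule mult_nonneg_nonneg) (simp add: v_def trunc_bounds(1)[OF k])
      then show ?thesis by (simp add: w_def mult.assoc)
    qed
  qed
  moreover have "(LINT x|M. frac_laplacian \<Omega> lam e (s / 2) u x * frac_laplacian \<Omega> lam e (s / 2) w x)
      = (\<Sum>n. lam n powr s * (cf (\<lambda>x. \<sigma> * u x) n * cf v n))"
    unfolding frac_laplacian_form[OF uV(1) wH] w_def by (simp add: ip_cmult_left mult_ac)
  moreover have "(LINT x|M. g x * w x) \<le> (LINT x|M. (l - k) * (\<bar>g x\<bar> * indicat_real {x \<in> \<Omega>. k < \<sigma> * u x} x))"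
  proof -
    have S: "{x \<in> \<Omega>. k < \<sigma> * u x} \<in> sets M"
    proof -
      have "{x \<in> space M. k < \<sigma> * u x} \<in> sets M" by measurable
      then show ?thesis by simp
    qed
    have le: "\<bar>g x * w x\<bar> \<le> (l - k) * (\<bar>g x\<bar> * indicat_real {x \<in> \<Omega>. k < \<sigma> * u x} x)" if "x \<in> \<Omega>" for x
    proof -
      have "v x \<le> (l - k) * indicat_real {x \<in> \<Omega>. k < \<sigma> * u x} x"
        using trunc_bounds(2,4)[OF k, of "\<sigma> * u x"] that by (auto simp: v_def indicator_def)
      then have "\<bar>g x\<bar> * v x \<le> \<bar>g x\<bar> * ((l - k) * indicat_real {x \<in> \<Omega>. k < \<sigma> * u x} x)"
        by (rule mult_left_mono) simp
      then show ?thesis by (simp add: abs_mult sgu(2) mult_ac)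
    qed
    have int: "integrable M (\<lambda>x. (l - k) * (\<bar>g x\<bar> * indicat_real {x \<in> \<Omega>. k < \<sigma> * u x} x))"
      using integrable_mult_indicator[OF S, of "\<lambda>x. \<bar>g x\<bar>"] g by (simp add: mult.commute)
    have "integrable M (\<lambda>x. g x * w x)"
      by (rule Bochner_Integration.integrable_bound[OF int])
        (use le in \<open>auto intro!: AE_I2 intro: order_trans[OF _ abs_ge_self]\<close>)
    then show ?thesis using int le by (intro integral_mono) (auto intro: order_trans[OF abs_ge_self])
  qed
  ultimately show "(\<Sum>n. lam n powr s * (ip M (\<lambda>x. trunc k l (\<sigma> * u x)) (e n))\<^sup>2)
      \<le> (l - k) * (LINT x|M. \<bar>g x\<bar> * indicat_real {x \<in> \<Omega>. k < \<sigma> * u x} x)"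
    using weak[OF wV] t(3) unfolding v_def by simp
qed

text \<open>This is 2 (4 r) powr (2 s) for the radius r of a ball of measure 16; for measure 16 m
  the radius scales with m powr (1 / N).\<close>

definition C_FK :: "real \<Rightarrow> real" where
  "C_FK s = 2 * (4 * (16 / unit_ball_vol (real DIM('a))) powr (1 / real DIM('a))) powr (2 * s)"

text \<open>The squared norm of the truncation is at least (l - k)^2 times the measure of the upper
  level set. Faber--Krahn, the energy bound and Hoelder estimate it from above by a multiple of l -
  k, so one factor l - k cancels.\<close>

lemma level_set_decay:
  assumes sys: "dirichlet_eigensystem \<Omega> lam e" and s: "0 < s" "s < 1"
    and f: "structural_condition \<Omega> f" and p: "p \<ge> 1" and g: "g \<in> Lp M p"
    and u: "weak_solution \<Omega> lam e s f (Lp_functional \<Omega> g) u"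
    and k: "0 \<le> k" "k < l" and \<sigma>: "\<sigma> = 1 \<or> \<sigma> = - 1"
  shows "(l - k) * measure M {x \<in> \<Omega>. l < \<sigma> * u x}
    \<le> (C_FK s * Lp_norm M p g) * measure M {x \<in> \<Omega>. k < \<sigma> * u x} powr (1 - recip p + 2 * s / real DIM('a))"
proof -
  interpret dirichlet_system \<Omega> lam e by unfold_locales (rule sys)
  let ?N = "real DIM('a)"
  define S where "S r = {x \<in> \<Omega>. r < \<sigma> * u x}" for r
  define m where "m = measure M (S k)"
  have uL: "u \<in> Lp M 2" using u by (simp add: weak_solution_def V_space_def Hr_iff)
  have [measurable]: "u \<in> borel_measurable M" using L2_measurable[OF uL] .
  have S: "S r \<in> sets M" for r
  proof -
    have "{x \<in> space M. r < \<sigma> * u x} \<in> sets M" by measurable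
    then show ?thesis by (simp add: S_def)
  qed
  have sub: "measure M (S l) \<le> m"
    unfolding m_def using k S by (intro finite_measure_mono) (auto simp: S_def)
  have n: "Lp_norm M p g \<ge> 0" by (simp add: Lp_norm_def)
  have "(l - k) * measure M (S l) \<le> (C_FK s * Lp_norm M p g) * m powr (1 - recip p + 2 * s / ?N)"
  proof (cases "m = 0")
    \<comment> \<open>\<open>Faber_Krahn\<close> and \<open>Hoelder_indicator\<close> need sets of
      positive measure; here both level sets are null.\<close>
    case True
    then have "measure M (S l) = 0" using sub measure_nonneg[of M "S l"] by linarith
    then show ?thesis using True by simp
  next
    case False
    then have m: "m > 0" using measure_nonneg[of M "S k"] by (simp add: m_def less_le)
    define v where "v = (\<lambda>x. trunc k l (\<sigma> * u x))"
    define \<omega> where "\<omega> = unit_ball_vol ?N"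
    have \<omega>: "\<omega> > 0" by (simp add: \<omega>_def)
    \<comment> \<open>The radius at which the ball has measure 16 m.\<close>
    define r where "r = (16 * m / \<omega>) powr (1 / ?N)"
    have r: "r > 0" using m \<omega> by (simp add: r_def)
    have "r ^ DIM('a) = r powr ?N" using r by (simp add: powr_realpow)
    also have "\<dots> = 16 * m / \<omega>" using m \<omega> by (simp add: r_def powr_powr)
    finally have rpow: "r ^ DIM('a) = 16 * m / \<omega>" .
    have "measure lebesgue (ball 0 r :: 'a set) = \<omega> * r ^ DIM('a)"
      using content_ball[of r "0 :: 'a"] r by (simp add: \<omega>_def)
    then have ball: "measure lebesgue (ball 0 r :: 'a set) = 16 * m"
      unfolding rpow using \<omega> by simp
    note ig = Hoelder_indicator(1)[OF p g]
    note en = energy_le_datum[OF sys s f ig u k \<sigma>, folded v_def S_def]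
    have vL: "v \<in> Lp M 2" using en(1) by (simp add: Hr_iff)
    have supp: "measure M {x \<in> \<Omega>. v x \<noteq> 0} \<le> m"
      unfolding m_def
    proof (rule finite_measure_mono[OF _ S])
      show "{x \<in> \<Omega>. v x \<noteq> 0} \<subseteq> S k"
        using trunc_bounds(4)[OF k] by (auto simp: v_def S_def not_less[symmetric])
    qed
    have "(l - k)\<^sup>2 * measure M (S l) \<le> ip M v v"
    proof -
      have iS: "integrable M (indicat_real (S l))"
        using S by (intro integrable_real_indicator) (auto simp: emeasure_eq_measure)
      have "S l \<inter> \<Omega> = S l" by (auto simp: S_def)
      then have "(l - k)\<^sup>2 * measure M (S l) = (LINT x|M. (l - k)\<^sup>2 * indicat_real (S l) x)"
        using S by simp
      also have "\<dots> \<le> (LINT x|M. v x * v x)"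
      proof (rule integral_mono)
        show "integrable M (\<lambda>x. (l - k)\<^sup>2 * indicat_real (S l) x)" using iS by simp
        show "integrable M (\<lambda>x. v x * v x)" using vL by (simp add: Lp2_iff)
        show "(l - k)\<^sup>2 * indicat_real (S l) x \<le> v x * v x" for x
          using trunc_bounds(5)[OF k, of "\<sigma> * u x"] by (auto simp: v_def S_def indicator_def power2_eq_square)
      qed
      finally show ?thesis by (simp add: ip_def)
    qed
    also have "\<dots> \<le> 2 * (4 * r) powr (2 * s) * (\<Sum>n. lam n powr s * (cf v n)\<^sup>2)"
    proof (rule Faber_Krahn[OF s en(1) _ supp m r ball])
      show "\<bar>v x\<bar> \<le> l - k" for x
        using trunc_bounds(1,2)[OF k, of "\<sigma> * u x"] by (simp add: v_def)
    qed
    also have "\<dots> \<le> 2 * (4 * r) powr (2 * s) * ((l - k) * (Lp_norm M p g * m powr (1 - recip p)))"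
    proof (rule mult_left_mono)
      have "(LINT x|M. \<bar>g x\<bar> * indicat_real (S k) x) \<le> Lp_norm M p g * m powr (1 - recip p)"
        using Hoelder_indicator(2)[OF p g S] m by (simp add: m_def)
      then have "(l - k) * (LINT x|M. \<bar>g x\<bar> * indicat_real (S k) x) \<le> (l - k) * (Lp_norm M p g * m powr (1 - recip p))"
        using k by (intro mult_left_mono) auto
      with en(2) show "(\<Sum>n. lam n powr s * (cf v n)\<^sup>2) \<le> (l - k) * (Lp_norm M p g * m powr (1 - recip p))"
        by linarith
    qed simp
    also have "2 * (4 * r) powr (2 * s) = C_FK s * m powr (2 * s / ?N)"
    proof -
      have "4 * r = (4 * (16 / \<omega>) powr (1 / ?N)) * m powr (1 / ?N)"
        by (simp add: r_def powr_mult[symmetric])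
      then show ?thesis unfolding C_FK_def \<omega>_def[symmetric] by (simp add: powr_mult powr_powr)
    qed
    also have "C_FK s * m powr (2 * s / ?N) * ((l - k) * (Lp_norm M p g * m powr (1 - recip p)))
        = (l - k) * ((C_FK s * Lp_norm M p g) * (m powr (1 - recip p) * m powr (2 * s / ?N)))"
      by (simp only: mult_ac)
    also have "m powr (1 - recip p) * m powr (2 * s / ?N) = m powr (1 - recip p + 2 * s / ?N)"
      by (simp only: powr_add)
    finally have "(l - k) * ((l - k) * measure M (S l)) \<le> (l - k) * ((C_FK s * Lp_norm M p g) * m powr (1 - recip p + 2 * s / ?N))"
      by (simp add: power2_eq_square mult.assoc)
    then show ?thesis using k by (subst (asm) mult_le_cancel_left_pos) auto
  qed
  then show ?thesis by (simp add: m_def S_def)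
qed

text \<open>The condition on \<open>p\<close> says exactly that the decay exponent \<delta> exceeds
  1. The constant is built from s, p, the dimension and the measure of \<Omega> alone.\<close>

theorem weak_solution_bounded:
  assumes s: "0 < s" "s < 1" and p: "p \<ge> 1" "recip p < 2 * s / real DIM('a)"
  shows "\<exists>C>0. \<forall>lam e f g u.
    dirichlet_eigensystem \<Omega> lam e \<longrightarrow> structural_condition \<Omega> f \<longrightarrow> g \<in> Lp M p \<longrightarrow>
    weak_solution \<Omega> lam e s f (Lp_functional \<Omega> g) u \<longrightarrow>
    u \<in> Lp M \<infinity> \<and> Lp_norm M \<infinity> u \<le> C * Lp_norm M p g"
proof -
  define \<delta> where "\<delta> = 1 - recip p + 2 * s / real DIM('a)"
  have \<delta>: "\<delta> > 1" using p(2) by (simp add: \<delta>_def)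
  \<comment> \<open>The summand 1 makes \<open>A\<close> positive even for empty \<Omega>, as
    \<open>Stampacchia\<close> requires; the one in \<open>C\<close> likewise guarantees C >
    0.\<close>
  define A where "A = measure M \<Omega> + 1"
  have A: "A > 0" using measure_nonneg[of M \<Omega>] unfolding A_def by linarith
  define C where "C = C_FK s * (A powr (\<delta> - 1) * 2 powr (\<delta> / (\<delta> - 1))) + 1"
  have CFK: "C_FK s \<ge> 0" by (simp add: C_FK_def)
  then have C: "C > 0" using A by (simp add: C_def add_nonneg_pos)
  show ?thesis
  proof (intro exI[of _ C] conjI C allI impI)
    fix lam e f g u
    assume sys: "dirichlet_eigensystem \<Omega> lam e" and f: "structural_condition \<Omega> f" and g: "g \<in> Lp M p"
      and u: "weak_solution \<Omega> lam e s f (Lp_functional \<Omega> g) u"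
    interpret dirichlet_system \<Omega> lam e by unfold_locales (rule sys)
    have uL: "u \<in> Lp M 2" using u by (simp add: weak_solution_def V_space_def Hr_iff)
    have um[measurable]: "u \<in> borel_measurable M" using L2_measurable[OF uL] .
    let ?n = "Lp_norm M p g"
    have n: "?n \<ge> 0" by (simp add: Lp_norm_def)
    \<comment> \<open>Levels \<open>D\<close> above C times the norm are allowed because
      \<open>Stampacchia\<close> needs D > 0, which the product itself violates when the norm of
      \<open>g\<close> is 0; the excess is removed at the end.\<close>
    have le: "AE x in M. \<bar>u x\<bar> \<le> D" if D: "D > 0" "C * ?n \<le> D" for D
    proof -
      have one: "AE x in M. \<sigma> * u x \<le> D" if \<sigma>: "\<sigma> = 1 \<or> \<sigma> = - 1" for \<sigma>
      proof -
        have S: "{x \<in> \<Omega>. r < \<sigma> * u x} \<in> sets M" for r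
        proof -
          have "{x \<in> space M. r < \<sigma> * u x} \<in> sets M" by measurable
          then show ?thesis by simp
        qed
        have "measure M {x \<in> \<Omega>. D < \<sigma> * u x} = 0"
        proof (rule Stampacchia[where a = "\<lambda>r. measure M {x \<in> \<Omega>. r < \<sigma> * u x}"])
          show "measure M {x \<in> \<Omega>. l < \<sigma> * u x} \<le> measure M {x \<in> \<Omega>. k < \<sigma> * u x}" if "k \<le> l" for k l
            using that S by (intro finite_measure_mono) auto
          have "measure M {x \<in> \<Omega>. 0 < \<sigma> * u x} \<le> measure M \<Omega>"
            using sets.top[of M] by (intro finite_measure_mono) auto
          then show "measure M {x \<in> \<Omega>. 0 < \<sigma> * u x} \<le> A" by (simp add: A_def)
          show "(l - k) * measure M {x \<in> \<Omega>. l < \<sigma> * u x} \<le> (C_FK s * ?n) * measure M {x \<in> \<Omega>. k < \<sigma> * u x} powr \<delta>"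
            if "0 \<le> k" "k < l" for k l
            unfolding \<delta>_def by (rule level_set_decay[OF sys s f p(1) g u that \<sigma>])
          have "C_FK s * ?n * A powr (\<delta> - 1) * 2 powr (\<delta> / (\<delta> - 1)) \<le> C * ?n"
            using n by (simp add: C_def algebra_simps)
          then show "C_FK s * ?n * A powr (\<delta> - 1) * 2 powr (\<delta> / (\<delta> - 1)) \<le> D" using D(2) by linarith
        qed (use A \<delta> CFK n D(1) in auto)
        then have "{x \<in> \<Omega>. D < \<sigma> * u x} \<in> null_sets M"
          using S by (auto simp: null_sets_def emeasure_eq_measure)
        then show ?thesis by (rule AE_I') auto
      qed
      from one[of 1] one[of "-1"] show ?thesis by (auto elim: eventually_elim2)
    qed
    have sup: "esssup M (\<lambda>x. ennreal (norm (u x))) \<le> ennreal D" if "D > 0" "C * ?n \<le> D" for D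
    proof (rule esssup_I)
      show "AE x in M. ennreal (norm (u x)) \<le> ennreal D"
        using le[OF that] by eventually_elim (auto intro: ennreal_leI)
    qed simp
    have fin: "esssup M (\<lambda>x. ennreal (norm (u x))) < \<infinity>"
      using sup[of "C * ?n + 1"] C n by (auto simp: add_nonneg_pos intro: le_less_trans)
    then show "u \<in> Lp M \<infinity>" by (simp add: Lp_def)
    show "Lp_norm M \<infinity> u \<le> C * ?n"
    proof (rule field_le_epsilon)
      fix y :: real assume y: "y > 0"
      have D: "C * ?n + y > 0" using C n y by (simp add: add_nonneg_pos)
      have "enn2real (esssup M (\<lambda>x. ennreal (norm (u x)))) \<le> enn2real (ennreal (C * ?n + y))"
        using sup[OF D] y by (intro enn2real_mono) auto
      then show "Lp_norm M \<infinity> u \<le> C * ?n + y" using D by (simp add: Lp_norm_def)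
    qed
  qed
qed

end

text \<open>The three regimes of \<open>p\<close> reduce to 1 \<le> p and 1 / p < 2 s / N. As
  \<open>C\<close> is quantified before the eigensystem, \<open>f\<close>, \<open>g\<close> and
  \<open>u\<close>, it depends only on N (through the type), s, p and \<Omega>.\<close>

theorem theorem2p9:
  fixes \<Omega> :: "(real ^ 'n) set" and s :: real and p :: ennreal
  assumes "open \<Omega>" and "bounded \<Omega>"
    and "0 < s" and "s < 1"
    and "real CARD('n) > 2 * s \<Longrightarrow> p > ennreal (real CARD('n) / (2 * s))"
    and "real CARD('n) = 2 * s \<Longrightarrow> p > 1"
    and "real CARD('n) < 2 * s \<Longrightarrow> p = 1"
  shows "\<exists>C>0. \<forall>lam e f g u.
    dirichlet_eigensystem \<Omega> lam e \<longrightarrow>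
    structural_condition \<Omega> f \<longrightarrow> global_Delta2 \<Omega> f \<longrightarrow>
    g \<in> Lp (lebesgue_on \<Omega>) p \<longrightarrow>
    weak_solution \<Omega> lam e s f (Lp_functional \<Omega> g) u \<longrightarrow>
    u \<in> Lp (lebesgue_on \<Omega>) \<infinity> \<and>
    Lp_norm (lebesgue_on \<Omega>) \<infinity> u \<le> C * Lp_norm (lebesgue_on \<Omega>) p g"
proof -
  interpret bounded_open_set \<Omega> by unfold_locales (use assms in auto)
  let ?N = "real CARD('n)"
  have N: "?N > 0" by simp
  have dim: "real DIM(real ^ 'n) = ?N" by simp
  \<comment> \<open>Serves the two regimes with a strict lower bound: c = N / (2 s) when N > 2 s,
    and c = 1 when N = 2 s. The value p = \<infinity> is included.\<close>
  have gt: "1 \<le> p \<and> recip p < 2 * s / ?N" if "c > 0" "1 \<le> c" "?N / (2 * s) \<le> c" "ennreal c < p" for c :: real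
  proof -
    have "1 \<le> ennreal c" using that(2) by simp
    then have p1: "1 \<le> p" using that(4) by order
    moreover have "recip p < 2 * s / ?N"
    proof (cases "p = \<infinity>")
      case True
      then show ?thesis using assms(3) N by (simp add: recip_def)
    next
      case False
      then have pe: "p = ennreal (enn2real p)" by (simp add: less_top)
      have "c < enn2real p"
        using that(1,4) by (subst (asm) pe) (simp add: ennreal_less_iff)
      then have "1 / enn2real p < 1 / c" using that(1) by (simp add: frac_less2)
      also have "1 / c \<le> 1 / (?N / (2 * s))"
        using that(1,3) N assms(3) by (intro divide_left_mono mult_pos_pos) auto
      finally show ?thesis using False by (simp add: recip_def)
    qed
    ultimately show ?thesis ..
  qed
  consider "?N > 2 * s" | "?N = 2 * s" | "?N < 2 * s" by linarith
  then have "1 \<le> p \<and> recip p < 2 * s / ?N"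
  proof cases
    case 1
    then show ?thesis using assms(3,5) gt[of "?N / (2 * s)"] by simp
  next
    case 2
    then show ?thesis using assms(6) gt[of 1] assms(3) by simp
  next
    case 3
    \<comment> \<open>With p = 1 the reciprocal is 1, and 1 < 2 s / N restates the case
      assumption.\<close>
    then show ?thesis using assms(7) N by (simp add: recip_def)
  qed
  then show ?thesis
    using weak_solution_bounded[OF assms(3,4), of p] unfolding dim by blast
qed

end
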